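(* Consider the forward complete differential inclusion $\dot x(t)\in F(x(t))$ on $\mathbb{R}^n$, where $F$ is a locally Lipschitz set-valued map with nonempty compact values, with locally Lipschitz output maps $h:\mathbb{R}^n\to\mathbb{R}^{p_y}$ and $g:\mathbb{R}^n\to\mathbb{R}^{p_w}$ and continuous proper map $\omega:\mathbb{R}^n\to\mathbb{R}_{\ge 0}$. (a) If the system is measurement to error stable (MES), then it admits a lower semicontinuous exponential decay SIT-Lyapunov function (with some gain $\rho\in\mathcal{K}$). (b) If the system satisfies the relative measurement to error bounded (RMEB) property and admits a lower semicontinuous SIT-Lyapunov function (with some gain $\rho\in\mathcal{K}$), then it is MES.
   Context: Setting. $F$ maps points of $\mathbb{R}^n$ to nonempty compact subsets of $\mathbb{R}^n$. $F$ is locally Lipschitz: every $\xi\in\mathbb{R}^n$ has a neighbourhood $U$ and $L>0$ with $F(\eta)\subseteq F(\zeta)+L|\eta-\zeta|\mathcal{B}$ for all $\eta,\zeta\in U$, where $\mathcal{B}$ is the closed Euclidean unit ball and $|\cdot|$ is the Euclidean norm. A solution of $\dot x\in F(x)$ on $[0,T)$, $0<T\le\infty$, is a function $x:[0,T)\to\mathbb{R}^n$, absolutely continuous on compact subintervals, with $\dot x(t)\in F(x(t))$ for almost every $t$. It is maximal if it has no extension to a solution on $[0,T_+)$ with $T_+>T$. Forward completeness means that every maximal solution is defined for all $t\ge0$. $\mathbf{S}$ is the set of all maximal solutions. Write $|\xi|_\omega:=\omega(\xi)$, $y(t):=h(x(t))$, $w(t):=g(x(t))$, and $\|w\|_{[a,b]}:=\sup_{s\in[a,b]}|w(s)|$.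 Comparison functions. $\gamma:\mathbb{R}_{\ge0}\to\mathbb{R}_{\ge0}$ is of class $\mathcal{K}$ if it is continuous, strictly increasing, zero at $0$ and positive elsewhere; it is of class $\mathcal{K}_\infty$ if in addition it is unbounded. $\beta:\mathbb{R}_{\ge0}\times\mathbb{R}_{\ge0}\to\mathbb{R}_{\ge0}$ is of class $\mathcal{KL}$ if $\beta(\cdot,t)\in\mathcal{K}$ for each fixed $t\ge 0$ and, for each fixed $s\ge 0$, $\beta(s,t)$ decreases (is nonincreasing) to $0$ as $t\to\infty$. MES: there exist $\beta\in\mathcal{KL}$ and $\gamma\in\mathcal{K}$ such that $|y(t)|\le\max\{\beta(|x(0)|_\omega,t),\gamma(\|w\|_{[0,t]})\}$ for each $x(\cdot)\in\mathbf{S}$ and all $t\ge0$. RMEB: there exist $\rho_1,\sigma_1,\sigma_2\in\mathcal{K}$ such that for every $x(\cdot)\in\mathbf{S}$ and every $t_1>0$ with $|y(t)|>\rho_1(|w(t)|)$ for all $t\in[0,t_1]$, one has $|y(t)|\le\max\{\sigma_1(|h(x(0))|),\sigma_2(\|w\|_{[0,t]})\}$ for all $t\in[0,t_1]$. Viscosity subdifferential: $\zeta\in\partial_D V(\xi)$ for $V:\mathbb{R}^n\to\mathbb{R}$ iff there are a function $r:\mathbb{R}^n\to\mathbb{R}$ with $\lim_{k\to0} r(k)/|k|=0$ and a neighbourhood $\mathcal{O}$ of the origin such that $V(\xi+k)-V(\xi)-\zeta\cdot k\ge r(k)$ for all $k\in\mathcal{O}$. (This set may be empty.) Lower semicontinuous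 SIT-Lyapunov function with gain $\rho\in\mathcal{K}$: a lower semicontinuous $V:\mathbb{R}^n\to\mathbb{R}_{\ge0}$ such that (i) there exist $\alpha_1,\alpha_2\in\mathcal{K}_\infty$ with $\alpha_1(|h(\xi)|)\le V(\xi)\le\alpha_2(|\xi|_\omega)$ for all $\xi$ with $|h(\xi)|>\rho(|g(\xi)|)$; (ii) there exists a continuous positive definite $\alpha_3:\mathbb{R}_{\ge0}\to\mathbb{R}_{\ge0}$ (zero at $0$, positive elsewhere) such that for each $\xi$ with $|h(\xi)|>\rho(|g(\xi)|)$, $\zeta\cdot v\le-\alpha_3(V(\xi))$ for all $\zeta\in\partial_D V(\xi)$ and all $v\in F(\xi)$. It is an exponential decay SIT-Lyapunov function with gain $\rho$ if in addition (ii) holds with $\alpha_3(r)=r$. *)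

theory Defs
  imports "HOL-Analysis.Analysis"
begin

text \<open>Functions on the half-line are represented by total functions on \<^typ>\<open>real\<close> of which only
  the restriction to \<open>{0..}\<close> is constrained; their values on \<open>{0..}\<close> are then automatically
  nonnegative.\<close>

definition class_K :: "(real \<Rightarrow> real) \<Rightarrow> bool" where
  "class_K \<gamma> \<longleftrightarrow> continuous_on {0..} \<gamma> \<and> strict_mono_on {0..} \<gamma> \<and> \<gamma> 0 = 0 \<and> (\<forall>s>0. \<gamma> s > 0)"

definition class_Kinf :: "(real \<Rightarrow> real) \<Rightarrow> bool" where
  "class_Kinf \<gamma> \<longleftrightarrow> class_K \<gamma> \<and> \<not> bounded (\<gamma> ` {0..})"

definition class_KL :: "(real \<Rightarrow> real \<Rightarrow> real) \<Rightarrow> bool" where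
  "class_KL \<beta> \<longleftrightarrow> (\<forall>t\<ge>0. class_K (\<lambda>s. \<beta> s t)) \<and>
     (\<forall>s\<ge>0. antimono_on {0..} (\<beta> s) \<and> (\<beta> s \<longlongrightarrow> 0) at_top)"

definition pos_def :: "(real \<Rightarrow> real) \<Rightarrow> bool" where
  "pos_def \<alpha> \<longleftrightarrow> \<alpha> 0 = 0 \<and> (\<forall>s>0. \<alpha> s > 0)"

definition locally_lipschitz :: "('a::metric_space \<Rightarrow> 'b::metric_space) \<Rightarrow> bool" where
  "locally_lipschitz f \<longleftrightarrow> (\<forall>\<xi>. \<exists>U L. open U \<and> \<xi> \<in> U \<and> L-lipschitz_on U f)"

definition set_locally_lipschitz :: "('a::real_normed_vector \<Rightarrow> 'a set) \<Rightarrow> bool" where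
  "set_locally_lipschitz F \<longleftrightarrow>
     (\<forall>\<xi>. \<exists>U L. open U \<and> \<xi> \<in> U \<and> L > 0 \<and>
        (\<forall>\<eta>\<in>U. \<forall>\<zeta>\<in>U. F \<eta> \<subseteq> {v + (L * norm (\<eta> - \<zeta>)) *\<^sub>R b | v b. v \<in> F \<zeta> \<and> b \<in> cball 0 1}))"

text \<open>A pair \<open>(u, v)\<close> in the finite set \<open>D\<close> stands for the interval from \<open>u\<close> to \<open>v\<close>; the intervals
  may share endpoints but must not overlap.\<close>

definition absolutely_continuous_on :: "real \<Rightarrow> real \<Rightarrow> (real \<Rightarrow> 'a::real_normed_vector) \<Rightarrow> bool" where
  "absolutely_continuous_on a b x \<longleftrightarrow>
     (\<forall>\<epsilon>>0. \<exists>\<delta>>0. \<forall>D. finite D \<and> (\<forall>(u, v)\<in>D. a \<le> u \<and> u \<le> v \<and> v \<le> b) \<and>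
          disjoint_family_on (\<lambda>(u, v). {u<..<v}) D \<and> (\<Sum>(u, v)\<in>D. v - u) < \<delta>
        \<longrightarrow> (\<Sum>(u, v)\<in>D. norm (x v - x u)) < \<epsilon>)"

text \<open>A solution on \<open>[0, T)\<close>, where \<open>T\<close> may be \<open>\<infinity>\<close>; the values of \<open>x\<close> outside \<open>[0, T)\<close> are
  irrelevant.\<close>

definition is_solution ::
    "('a::real_normed_vector \<Rightarrow> 'a set) \<Rightarrow> ereal \<Rightarrow> (real \<Rightarrow> 'a) \<Rightarrow> bool" where
  "is_solution F T x \<longleftrightarrow> 0 < T \<and>
     (\<forall>a b. 0 \<le> a \<and> a \<le> b \<and> ereal b < T \<longrightarrow> absolutely_continuous_on a b x) \<and>
     (AE t in lebesgue. 0 \<le> t \<and> ereal t < T \<longrightarrow>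
        (\<exists>v\<in>F (x t). (x has_vector_derivative v) (at t within {s. 0 \<le> s \<and> ereal s < T})))"

definition maximal_solution ::
    "('a::real_normed_vector \<Rightarrow> 'a set) \<Rightarrow> ereal \<Rightarrow> (real \<Rightarrow> 'a) \<Rightarrow> bool" where
  "maximal_solution F T x \<longleftrightarrow> is_solution F T x \<and>
     \<not> (\<exists>T' x'. T < T' \<and> is_solution F T' x' \<and> (\<forall>t. 0 \<le> t \<and> ereal t < T \<longrightarrow> x' t = x t))"

definition forward_complete :: "('a::real_normed_vector \<Rightarrow> 'a set) \<Rightarrow> bool" where
  "forward_complete F \<longleftrightarrow> (\<forall>T x. maximal_solution F T x \<longrightarrow> T = \<infinity>)"

definition sup_norm :: "(real \<Rightarrow> 'b::real_normed_vector) \<Rightarrow> real \<Rightarrow> real \<Rightarrow> real" where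
  "sup_norm w a b = (SUP s\<in>{a..b}. norm (w s))"

text \<open>In the next two definitions the bounds \<open>t < T\<close>, \<open>t\<^sub>1 < T\<close> only keep the times inside the
  domain of the solution; for a forward complete inclusion they hold trivially.\<close>

definition MES ::
    "('a::real_normed_vector \<Rightarrow> 'a set) \<Rightarrow> ('a \<Rightarrow> real) \<Rightarrow>
     ('a \<Rightarrow> 'b::real_normed_vector) \<Rightarrow> ('a \<Rightarrow> 'c::real_normed_vector) \<Rightarrow> bool" where
  "MES F \<omega> h g \<longleftrightarrow> (\<exists>\<beta> \<gamma>. class_KL \<beta> \<and> class_K \<gamma> \<and>
     (\<forall>T x t. maximal_solution F T x \<and> 0 \<le> t \<and> ereal t < T \<longrightarrow>
        norm (h (x t)) \<le> max (\<beta> (\<omega> (x 0)) t) (\<gamma> (sup_norm (\<lambda>s. g (x s)) 0 t))))"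

definition RMEB ::
    "('a::real_normed_vector \<Rightarrow> 'a set) \<Rightarrow>
     ('a \<Rightarrow> 'b::real_normed_vector) \<Rightarrow> ('a \<Rightarrow> 'c::real_normed_vector) \<Rightarrow> bool" where
  "RMEB F h g \<longleftrightarrow> (\<exists>\<rho>\<^sub>1 \<sigma>\<^sub>1 \<sigma>\<^sub>2. class_K \<rho>\<^sub>1 \<and> class_K \<sigma>\<^sub>1 \<and> class_K \<sigma>\<^sub>2 \<and>
     (\<forall>T x t\<^sub>1. maximal_solution F T x \<and> 0 < t\<^sub>1 \<and> ereal t\<^sub>1 < T \<and>
          (\<forall>t\<in>{0..t\<^sub>1}. norm (h (x t)) > \<rho>\<^sub>1 (norm (g (x t)))) \<longrightarrow>
        (\<forall>t\<in>{0..t\<^sub>1}. norm (h (x t)) \<le>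
            max (\<sigma>\<^sub>1 (norm (h (x 0)))) (\<sigma>\<^sub>2 (sup_norm (\<lambda>s. g (x s)) 0 t)))))"

definition lower_semicontinuous :: "('a::topological_space \<Rightarrow> real) \<Rightarrow> bool" where
  "lower_semicontinuous V \<longleftrightarrow> (\<forall>\<xi>. \<forall>c < V \<xi>. \<forall>\<^sub>F \<eta> in nhds \<xi>. c < V \<eta>)"

definition viscosity_subdiff :: "('a::real_inner \<Rightarrow> real) \<Rightarrow> 'a \<Rightarrow> 'a set" where
  "viscosity_subdiff V \<xi> =
     {\<zeta>. \<exists>r O\<^sub>0. ((\<lambda>k. r k / norm k) \<longlongrightarrow> 0) (at 0) \<and> open O\<^sub>0 \<and> 0 \<in> O\<^sub>0 \<and>
        (\<forall>k\<in>O\<^sub>0. V (\<xi> + k) - V \<xi> - \<zeta> \<bullet> k \<ge> r k)}"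

definition SIT_bounds ::
    "('a \<Rightarrow> real) \<Rightarrow> ('a \<Rightarrow> 'b::real_normed_vector) \<Rightarrow> ('a \<Rightarrow> 'c::real_normed_vector) \<Rightarrow>
     (real \<Rightarrow> real) \<Rightarrow> ('a \<Rightarrow> real) \<Rightarrow> bool" where
  "SIT_bounds \<omega> h g \<rho> V \<longleftrightarrow> (\<exists>\<alpha>\<^sub>1 \<alpha>\<^sub>2. class_Kinf \<alpha>\<^sub>1 \<and> class_Kinf \<alpha>\<^sub>2 \<and>
     (\<forall>\<xi>. norm (h \<xi>) > \<rho> (norm (g \<xi>)) \<longrightarrow> \<alpha>\<^sub>1 (norm (h \<xi>)) \<le> V \<xi> \<and> V \<xi> \<le> \<alpha>\<^sub>2 (\<omega> \<xi>)))"

definition SIT_decay ::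
    "('a::real_inner \<Rightarrow> 'a set) \<Rightarrow> ('a \<Rightarrow> 'b::real_normed_vector) \<Rightarrow>
     ('a \<Rightarrow> 'c::real_normed_vector) \<Rightarrow> (real \<Rightarrow> real) \<Rightarrow> (real \<Rightarrow> real) \<Rightarrow> ('a \<Rightarrow> real) \<Rightarrow> bool" where
  "SIT_decay F h g \<rho> \<alpha>\<^sub>3 V \<longleftrightarrow> (\<forall>\<xi>. norm (h \<xi>) > \<rho> (norm (g \<xi>)) \<longrightarrow>
     (\<forall>\<zeta>\<in>viscosity_subdiff V \<xi>. \<forall>v\<in>F \<xi>. \<zeta> \<bullet> v \<le> - \<alpha>\<^sub>3 (V \<xi>)))"

definition lsc_SIT_Lyapunov ::
    "('a::real_inner \<Rightarrow> 'a set) \<Rightarrow> ('a \<Rightarrow> real) \<Rightarrow> ('a \<Rightarrow> 'b::real_normed_vector) \<Rightarrow>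
     ('a \<Rightarrow> 'c::real_normed_vector) \<Rightarrow> (real \<Rightarrow> real) \<Rightarrow> ('a \<Rightarrow> real) \<Rightarrow> bool" where
  "lsc_SIT_Lyapunov F \<omega> h g \<rho> V \<longleftrightarrow>
     (\<forall>\<xi>. 0 \<le> V \<xi>) \<and> lower_semicontinuous V \<and> SIT_bounds \<omega> h g \<rho> V \<and>
     (\<exists>\<alpha>\<^sub>3. continuous_on {0..} \<alpha>\<^sub>3 \<and> pos_def \<alpha>\<^sub>3 \<and> SIT_decay F h g \<rho> \<alpha>\<^sub>3 V)"

definition lsc_exp_SIT_Lyapunov ::
    "('a::real_inner \<Rightarrow> 'a set) \<Rightarrow> ('a \<Rightarrow> real) \<Rightarrow> ('a \<Rightarrow> 'b::real_normed_vector) \<Rightarrow>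
     ('a \<Rightarrow> 'c::real_normed_vector) \<Rightarrow> (real \<Rightarrow> real) \<Rightarrow> ('a \<Rightarrow> real) \<Rightarrow> bool" where
  "lsc_exp_SIT_Lyapunov F \<omega> h g \<rho> V \<longleftrightarrow>
     lsc_SIT_Lyapunov F \<omega> h g \<rho> V \<and> SIT_decay F h g \<rho> (\<lambda>r. r) V"

text \<open>Properness of a continuous \<open>\<omega>\<close> into \<open>[0, \<infinity>)\<close> is expressed by the library's topological
  \<^const>\<open>proper_map\<close>; this is the usual condition that preimages of compact sets are compact.\<close>

lemma proper_map_nonneg_iff:
  fixes \<omega> :: "'a::euclidean_space \<Rightarrow> real"
  assumes "continuous_on UNIV \<omega>"
  shows "proper_map euclidean (top_of_set {0..}) \<omega> \<longleftrightarrow>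
    (\<forall>\<xi>. 0 \<le> \<omega> \<xi>) \<and> (\<forall>K. compact K \<longrightarrow> compact (\<omega> -` K))"
proof
  assume p: "proper_map euclidean (top_of_set {0..}) \<omega>"
  have nn: "\<forall>\<xi>. 0 \<le> \<omega> \<xi>"
    using proper_map_imp_subset_topspace[OF p] by auto
  have "compact (\<omega> -` K)" if "compact K" for K
  proof -
    have "compactin (top_of_set {0..}) (K \<inter> {0..})"
      using that by (auto simp: compactin_subtopology compact_Int_closed)
    from compactin_proper_map_preimage[OF p this]
    have "compact {x. \<omega> x \<in> K \<inter> {0..}}" by simp
    moreover have "{x. \<omega> x \<in> K \<inter> {0..}} = \<omega> -` K" using nn by auto
    ultimately show ?thesis by simp
  qed
  with nn show "(\<forall>\<xi>. 0 \<le> \<omega> \<xi>) \<and> (\<forall>K. compact K \<longrightarrow> compact (\<omega> -` K))" by blast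
next
  assume r: "(\<forall>\<xi>. 0 \<le> \<omega> \<xi>) \<and> (\<forall>K. compact K \<longrightarrow> compact (\<omega> -` K))"
  have "proper_map euclidean euclidean \<omega>"
    using r assms
    by (intro compact_imp_proper_map)
      (auto simp: vimage_def locally_compact_imp_k_space locally_compact_space_euclidean
        Hausdorff_imp_kc_space continuous_map_iff_continuous2)
  then show "proper_map euclidean (top_of_set {0..}) \<omega>"
    using r by (auto intro!: proper_map_into_subtopology)
qed

end

theory Submission
  imports Defs
begin

text \<open>The existence part works with solutions whose velocity is regulated, i.e. has one-sided limits
  in \<open>F\<close>. Such solutions start at every point with every admissible initial velocity, are stable
  under perturbation of either endpoint together with their velocities, and are closed under
  limits with uniformly converging velocities; no measurable selections and no convexity are needed.
  If the points reachable in bounded time were unbounded, then a sequence of such solutions, each one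
  corrected backwards in time so that its end point is a limit of bad points, would converge to a
  solution with finite escape time.

  For (a), the small-gain argument needs the bounded reachable sets to restart MES at later times.
  It yields uniform attractivity while \<open>|h| > \<rho>(|g|)\<close>, hence \<open>\<alpha>\<^sub>1(|y(t)|) \<le> \<alpha>\<^sub>2(|x(0)|\<^sub>\<omega>) e\<^sup>-\<^sup>t\<close> there, and
  \<open>V(\<xi>) = sup \<alpha>\<^sub>1(|y(t)|) e\<^sup>t\<close> over regular solutions staying in this region is the Lyapunov function.

  For (b), \<open>min\<^sub>y V(y) + k e\<^sup>-\<^sup>2\<^sup>L\<^sup>t |x(t) - y|\<^sup>2\<close> decreases along an arbitrary solution, and \<open>k \<rightarrow> \<infinity>\<close> gives the
  decrease of \<open>V\<close> itself. RMEB is applied after the last time at which \<open>|y| \<le> \<rho>(|w|)\<close>.\<close>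

section \<open>Regular solutions\<close>

text \<open>In the blow-up argument compactness therefore only selects points and times, while
  functions converge because their errors are summable in the Lipschitz seminorm as well. That
  seminorm controls the distance of velocities, and the closed graph of \<open>F\<close> does the
  rest. The two directions work with different solutions. In (a), \<open>V\<close> is built from
  regular solutions and MES is applied to these only; their stability under a change of the starting
  point is what makes \<open>V\<close> lower semicontinuous. In (b), MES must be proved for every
  absolutely continuous solution; there the argument rests on comparing \<open>F\<close> at two
  nearby points, and a Dini derivative argument disposes of the null set of bad times. The gain in
  (a) is \<open>\<rho> = 2 \<gamma>\<close>: the factor 2 makes the input term of MES at most half
  of the largest output while the solution stays where \<open>|h| > \<rho>(|g|)\<close>.\<close>

text \<open>The Lipschitz condition compares arbitrary pairs of times near \<open>t\<close>, not only pairs containing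
  \<open>t\<close>. Taken on both sides of every point, it encodes a velocity that has one-sided limits.\<close>

definition strict_velocity :: "real set \<Rightarrow> (real \<Rightarrow> 'a::real_normed_vector) \<Rightarrow> real \<Rightarrow> 'a \<Rightarrow> bool" where
  "strict_velocity A x t v \<longleftrightarrow>
     (\<forall>e>0. \<exists>d>0. e-lipschitz_on (A \<inter> ball t d) (\<lambda>s. x s - s *\<^sub>R v))"

definition regular_solution ::
    "('a::real_normed_vector \<Rightarrow> 'a set) \<Rightarrow> real \<Rightarrow> real \<Rightarrow> (real \<Rightarrow> 'a) \<Rightarrow> bool" where
  "regular_solution F a b x \<longleftrightarrow> (\<forall>t\<in>{a..b}.
     (t < b \<longrightarrow> (\<exists>v\<in>F (x t). strict_velocity {t..b} x t v)) \<and>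
     (a < t \<longrightarrow> (\<exists>v\<in>F (x t). strict_velocity {a..t} x t v)))"

lemma strict_velocity_transfer:
  assumes "strict_velocity A x t v" "r > 0" "B \<inter> ball t r \<subseteq> A"
    and "\<And>s. s \<in> B \<Longrightarrow> s \<in> ball t r \<Longrightarrow> y s = x s"
  shows "strict_velocity B y t v"
  unfolding strict_velocity_def
proof (intro allI impI)
  fix e :: real assume "e > 0"
  then obtain d where d: "d > 0" "e-lipschitz_on (A \<inter> ball t d) (\<lambda>s. x s - s *\<^sub>R v)"
    using assms(1) unfolding strict_velocity_def by blast
  have "e-lipschitz_on (B \<inter> ball t (min d r)) (\<lambda>s. x s - s *\<^sub>R v)"
    by (rule lipschitz_on_subset[OF d(2)]) (use assms(3) in auto)
  then have "e-lipschitz_on (B \<inter> ball t (min d r)) (\<lambda>s. y s - s *\<^sub>R v)"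
    by (rule lipschitz_on_transform) (use assms(4) in auto)
  then show "\<exists>d>0. e-lipschitz_on (B \<inter> ball t d) (\<lambda>s. y s - s *\<^sub>R v)"
    using d(1) assms(2) by (intro exI[of _ "min d r"]) auto
qed

text \<open>One change of variable serves shifts (\<open>k = 1\<close>) and time reversal
  (\<open>k = -1\<close>). Both are isometries of time, so the same \<open>d\<close> and
  \<open>e\<close> keep working and only the sign of the velocity can change.\<close>

lemma strict_velocity_affine:
  assumes "strict_velocity A x (c + k * t) v" "k = 1 \<or> k = -1"
  shows "strict_velocity ((\<lambda>s. c + k * s) -` A) (\<lambda>s. x (c + k * s)) t (k *\<^sub>R v)"
  unfolding strict_velocity_def
proof (intro allI impI)
  fix e :: real assume e: "e > 0"
  then obtain d where d: "d > 0"
      "e-lipschitz_on (A \<inter> ball (c + k * t) d) (\<lambda>s. x s - s *\<^sub>R v)"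
    using assms(1) unfolding strict_velocity_def by blast
  have iso: "dist (c + k * p) (c + k * q) = dist p q" for p q :: real
    using assms(2) by (auto simp: dist_real_def)
  have "e-lipschitz_on ((\<lambda>s. c + k * s) -` A \<inter> ball t d) (\<lambda>s. x (c + k * s) - s *\<^sub>R k *\<^sub>R v)"
  proof (rule lipschitz_onI)
    fix p q assume p: "p \<in> (\<lambda>s. c + k * s) -` A \<inter> ball t d" and q: "q \<in> (\<lambda>s. c + k * s) -` A \<inter> ball t d"
    have "dist (x (c + k * p) - (c + k * p) *\<^sub>R v) (x (c + k * q) - (c + k * q) *\<^sub>R v)
        \<le> e * dist (c + k * p) (c + k * q)"
      by (rule lipschitz_onD[OF d(2)]) (use p q iso[of t] in auto)
    then show "dist (x (c + k * p) - p *\<^sub>R k *\<^sub>R v) (x (c + k * q) - q *\<^sub>R k *\<^sub>R v) \<le> e * dist p q"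
      unfolding iso by (simp add: dist_norm algebra_simps)
  qed (use e in auto)
  then show "\<exists>d>0. e-lipschitz_on ((\<lambda>s. c + k * s) -` A \<inter> ball t d)
      (\<lambda>s. x (c + k * s) - s *\<^sub>R k *\<^sub>R v)"
    using d(1) by blast
qed

text \<open>Dividing increments by \<open>s - t\<close> at points of \<open>A\<close> near
  \<open>t\<close> compares the velocities. Hence velocities are Cauchy along sequences that are
  Cauchy in the Lipschitz seminorm.\<close>

lemma strict_velocity_close:
  assumes "strict_velocity A x t v" "strict_velocity A y t w"
    and "c-lipschitz_on A (\<lambda>s. x s - y s)" "t \<in> A" "t islimpt A"
  shows "norm (v - w) \<le> c"
proof (rule field_le_epsilon)
  fix e :: real assume "e > 0"
  then obtain d1 d2 where d: "d1 > 0" "(e/2)-lipschitz_on (A \<inter> ball t d1) (\<lambda>s. x s - s *\<^sub>R v)"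
      "d2 > 0" "(e/2)-lipschitz_on (A \<inter> ball t d2) (\<lambda>s. y s - s *\<^sub>R w)"
    using assms(1,2) unfolding strict_velocity_def by (meson half_gt_zero)
  obtain s where s: "s \<in> A" "s \<noteq> t" "dist s t < min d1 d2"
    using assms(5) d unfolding islimpt_approachable by (metis min_less_iff_conj)
  have 1: "norm ((x s - s *\<^sub>R v) - (x t - t *\<^sub>R v)) \<le> e/2 * \<bar>s - t\<bar>"
    using lipschitz_onD[OF d(2), of s t] s assms(4) d by (auto simp: dist_norm dist_commute)
  have 2: "norm ((y s - s *\<^sub>R w) - (y t - t *\<^sub>R w)) \<le> e/2 * \<bar>s - t\<bar>"
    using lipschitz_onD[OF d(4), of s t] s assms(4) d by (auto simp: dist_norm dist_commute)
  have 3: "norm ((x s - y s) - (x t - y t)) \<le> c * \<bar>s - t\<bar>"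
    using lipschitz_onD[OF assms(3), of s t] s assms(4) by (auto simp: dist_norm)
  have eq: "(s - t) *\<^sub>R (v - w) = ((x s - y s) - (x t - y t)) - ((x s - s *\<^sub>R v) - (x t - t *\<^sub>R v))
      + ((y s - s *\<^sub>R w) - (y t - t *\<^sub>R w))" by (simp add: algebra_simps)
  have "norm ((s - t) *\<^sub>R (v - w)) \<le> c * \<bar>s - t\<bar> + e/2 * \<bar>s - t\<bar> + e/2 * \<bar>s - t\<bar>"
    unfolding eq by (rule norm_triangle_le, rule add_mono, rule norm_triangle_le_diff, rule add_mono)
      (use 1 2 3 in auto)
  then have "\<bar>s - t\<bar> * norm (v - w) \<le> \<bar>s - t\<bar> * (c + e)"
    unfolding norm_scaleR by (simp add: distrib_left distrib_right mult.commute)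
  then show "norm (v - w) \<le> c + e" using s by (simp add: mult_le_cancel_left)
qed

lemma regular_solutionI:
  assumes "\<And>t. a \<le> t \<Longrightarrow> t < b \<Longrightarrow> \<exists>v\<in>F (x t). strict_velocity {t..b} x t v"
    and "\<And>t. a < t \<Longrightarrow> t \<le> b \<Longrightarrow> \<exists>v\<in>F (x t). strict_velocity {a..t} x t v"
  shows "regular_solution F a b x"
  using assms unfolding regular_solution_def by auto

lemma regular_solution_right:
  "regular_solution F a b x \<Longrightarrow> a \<le> t \<Longrightarrow> t < b \<Longrightarrow> \<exists>v\<in>F (x t). strict_velocity {t..b} x t v"
  unfolding regular_solution_def by auto

lemma regular_solution_left:
  "regular_solution F a b x \<Longrightarrow> a < t \<Longrightarrow> t \<le> b \<Longrightarrow> \<exists>v\<in>F (x t). strict_velocity {a..t} x t v"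
  unfolding regular_solution_def by auto

lemma regular_solution_trivial: "b \<le> a \<Longrightarrow> regular_solution F a b x"
  by (rule regular_solutionI) auto

lemma regular_solution_mono:
  assumes "regular_solution F a b x" "\<And>t. t \<in> {a..b} \<Longrightarrow> F (x t) \<subseteq> G (x t)"
  shows "regular_solution G a b x"
  using assms unfolding regular_solution_def by (meson subsetD)

lemma regular_solution_subinterval:
  assumes "regular_solution F a b x" "a \<le> c" "d \<le> b"
    and "\<And>t. t \<in> {c..d} \<Longrightarrow> y t = x t"
  shows "regular_solution F c d y"
proof (rule regular_solutionI)
  fix t assume t: "c \<le> t" "t < d"
  then obtain v where v: "v \<in> F (x t)" "strict_velocity {t..b} x t v"
    using regular_solution_right[OF assms(1), of t] assms by auto
  have "strict_velocity {t..d} y t v"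
    by (rule strict_velocity_transfer[OF v(2), of 1]) (use assms t in auto)
  then show "\<exists>v\<in>F (y t). strict_velocity {t..d} y t v" using v t assms(4) by auto
next
  fix t assume t: "c < t" "t \<le> d"
  then obtain v where v: "v \<in> F (x t)" "strict_velocity {a..t} x t v"
    using regular_solution_left[OF assms(1), of t] assms by auto
  have "strict_velocity {c..t} y t v"
    by (rule strict_velocity_transfer[OF v(2), of 1]) (use assms t in auto)
  then show "\<exists>v\<in>F (y t). strict_velocity {c..t} y t v" using v t assms(4) by auto
qed

text \<open>Velocities need not match at \<open>b\<close>: the two sides of a point are tested
  separately, so a kink is allowed there. Continuously differentiable solutions would lack this
  property.\<close>

lemma regular_solution_concat:
  assumes x: "regular_solution F a b x" and y: "regular_solution F b c y"
    and "x b = y b" "a \<le> b" "b \<le> c"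
  shows "regular_solution F a c (\<lambda>t. if t \<le> b then x t else y t)"
    (is "regular_solution F a c ?z")
proof (rule regular_solutionI)
  fix t assume t: "a \<le> t" "t < c"
  show "\<exists>v\<in>F (?z t). strict_velocity {t..c} ?z t v"
  proof (cases "t < b")
    case True
    then obtain v where v: "v \<in> F (x t)" "strict_velocity {t..b} x t v"
      using regular_solution_right[OF x, of t] t by auto
    have "strict_velocity {t..c} ?z t v"
      by (rule strict_velocity_transfer[OF v(2), of "b - t"]) (use True in \<open>auto simp: dist_real_def\<close>)
    then show ?thesis using v True by auto
  next
    case False
    then obtain v where v: "v \<in> F (y t)" "strict_velocity {t..c} y t v"
      using regular_solution_right[OF y, of t] t by auto
    have "strict_velocity {t..c} ?z t v"
    proof (rule strict_velocity_transfer[OF v(2), of 1])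
      fix s assume "s \<in> {t..c}"
      then show "?z s = y s" using False assms(3) by (cases "s = b") auto
    qed auto
    then show ?thesis using v False assms(3) by (cases "t = b") auto
  qed
next
  fix t assume t: "a < t" "t \<le> c"
  show "\<exists>v\<in>F (?z t). strict_velocity {a..t} ?z t v"
  proof (cases "t \<le> b")
    case True
    then obtain v where v: "v \<in> F (x t)" "strict_velocity {a..t} x t v"
      using regular_solution_left[OF x, of t] t by auto
    have "strict_velocity {a..t} ?z t v"
      by (rule strict_velocity_transfer[OF v(2), of 1]) (use True in auto)
    then show ?thesis using v True by auto
  next
    case False
    then obtain v where v: "v \<in> F (y t)" "strict_velocity {b..t} y t v"
      using regular_solution_left[OF y, of t] t by auto
    have "strict_velocity {a..t} ?z t v"
      by (rule strict_velocity_transfer[OF v(2), of "t - b"]) (use False in \<open>auto simp: dist_real_def\<close>)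
    then show ?thesis using v False by auto
  qed
qed

lemma regular_solution_shift:
  assumes "regular_solution F a b x" 
  shows "regular_solution F (a - c) (b - c) (\<lambda>s. x (c + s))"
proof (rule regular_solutionI)
  fix t assume t: "a - c \<le> t" "t < b - c"
  then obtain v where v: "v \<in> F (x (c + t))" "strict_velocity {c + t..b} x (c + t) v"
    using regular_solution_right[OF assms, of "c + t"] by auto
  show "\<exists>v\<in>F (x (c + t)). strict_velocity {t..b - c} (\<lambda>s. x (c + s)) t v"
  proof (rule bexI[of _ v])
    have sv: "strict_velocity ((\<lambda>s. c + 1 * s) -` {c + t..b}) (\<lambda>s. x (c + 1 * s)) t (1 *\<^sub>R v)"
      by (rule strict_velocity_affine) (use v in auto)
    show "strict_velocity {t..b-c} (\<lambda>s. x (c + s)) t (v)"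
      by (rule strict_velocity_transfer[where r = 1, OF sv[unfolded mult_1 scaleR_one]]) auto
  qed (use v in auto)
next
  fix t assume t: "a - c < t" "t \<le> b - c"
  then obtain v where v: "v \<in> F (x (c + t))" "strict_velocity {a..c + t} x (c + t) v"
    using regular_solution_left[OF assms, of "c + t"] by auto
  show "\<exists>v\<in>F (x (c + t)). strict_velocity {a - c..t} (\<lambda>s. x (c + s)) t v"
  proof (rule bexI[of _ v])
    have sv: "strict_velocity ((\<lambda>s. c + 1 * s) -` {a..c + t}) (\<lambda>s. x (c + 1 * s)) t (1 *\<^sub>R v)"
      by (rule strict_velocity_affine) (use v in auto)
    show "strict_velocity {a-c..t} (\<lambda>s. x (c + s)) t (v)"
      by (rule strict_velocity_transfer[where r = 1, OF sv[unfolded mult_1 scaleR_one]]) auto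
  qed (use v in auto)
qed

lemma regular_solution_reverse:
  assumes "regular_solution F a b x" 
  shows "regular_solution (\<lambda>p. uminus ` F p) (-b) (-a) (\<lambda>s. x (-s))"
proof (rule regular_solutionI)
  fix t assume t: "-b \<le> t" "t < -a"
  then obtain v where v: "v \<in> F (x (-t))" "strict_velocity {a..-t} x (-t) v"
    using regular_solution_left[OF assms, of "-t"] by auto
  show "\<exists>v\<in>uminus ` F (x (-t)). strict_velocity {t..-a} (\<lambda>s. x (-s)) t v"
  proof (rule bexI[of _ "-v"])
    have sv: "strict_velocity ((\<lambda>s. 0 + -1 * s) -` {a..-t}) (\<lambda>s. x (0 + -1 * s)) t (-1 *\<^sub>R v)"
      by (rule strict_velocity_affine) (use v in auto)
    show "strict_velocity {t..-a} (\<lambda>s. x (-s)) t (-v)"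
      by (rule strict_velocity_transfer[where r = 1, OF sv[unfolded mult_minus1 add_0 scaleR_minus1_left]]) auto
  qed (use v in auto)
next
  fix t assume t: "-b < t" "t \<le> -a"
  then obtain v where v: "v \<in> F (x (-t))" "strict_velocity {-t..b} x (-t) v"
    using regular_solution_right[OF assms, of "-t"] by auto
  show "\<exists>v\<in>uminus ` F (x (-t)). strict_velocity {-b..t} (\<lambda>s. x (-s)) t v"
  proof (rule bexI[of _ "-v"])
    have sv: "strict_velocity ((\<lambda>s. 0 + -1 * s) -` {-t..b}) (\<lambda>s. x (0 + -1 * s)) t (-1 *\<^sub>R v)"
      by (rule strict_velocity_affine) (use v in auto)
    show "strict_velocity {-b..t} (\<lambda>s. x (-s)) t (-v)"
      by (rule strict_velocity_transfer[where r = 1, OF sv[unfolded mult_minus1 add_0 scaleR_minus1_left]]) auto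
  qed (use v in auto)
qed

lemma strict_velocity_lipschitz:
  assumes "strict_velocity A x t v"
  shows "\<exists>d>0. (1 + norm v)-lipschitz_on (A \<inter> ball t d) x"
proof -
  obtain d where d: "d > 0" "1-lipschitz_on (A \<inter> ball t d) (\<lambda>s. x s - s *\<^sub>R v)"
    using assms unfolding strict_velocity_def by (meson zero_less_one)
  have "(norm v)-lipschitz_on (A \<inter> ball t d) (\<lambda>s. s *\<^sub>R v)"
    by (rule lipschitz_onI) (auto simp: dist_norm simp flip: scaleR_left_diff_distrib)
  from lipschitz_on_add[OF d(2) this] show ?thesis using d(1) by auto
qed

lemma lipschitz_on_join:
  fixes x :: "real \<Rightarrow> 'a::metric_space"
  assumes "L-lipschitz_on {a..b} x" "M-lipschitz_on {b..c} x"
  shows "(max L M)-lipschitz_on {a..c} x"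
  using lipschitz_on_concat_max[OF assms refl] by simp

text \<open>A one-sided velocity \<open>v\<close> makes \<open>x\<close> Lipschitz with constant
  \<open>1 + norm v\<close> on a short interval on that side; bisection joins such
  intervals.\<close>

lemma regular_solution_lipschitz:
  assumes "regular_solution F a b x"
  shows "\<exists>L. L-lipschitz_on {a..b} x"
proof (cases "a \<le> b")
  case True
  \<comment> \<open>\<open>Bolzano\<close> tests all short intervals around a point, also those that
    leave \<open>{a..b}\<close>; the guard makes \<open>P\<close> vacuous for them.\<close>
  define P where "P c d \<longleftrightarrow> (a \<le> c \<and> d \<le> b \<longrightarrow> (\<exists>L. L-lipschitz_on {c..d} x))" for c d
  have "P a b" using True
  proof (induction rule: Bolzano)
    case (trans c d e)
    then show ?case unfolding P_def by (meson lipschitz_on_join order_trans)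
  next
    case (local t)
    have 1: "\<exists>d>0. \<forall>p. a \<le> p \<and> p \<le> t \<and> t - p < d \<longrightarrow> (\<exists>L. L-lipschitz_on {p..t} x)"
    proof (cases "a < t")
      case True
      then obtain v where "strict_velocity {a..t} x t v"
        using regular_solution_left[OF assms, of t] local by auto
      then obtain d where v: "d > 0" "(1 + norm v)-lipschitz_on ({a..t} \<inter> ball t d) x"
        using strict_velocity_lipschitz by blast
      have "(1 + norm v)-lipschitz_on {p..t} x" if "a \<le> p" "p \<le> t" "t - p < d" for p
        by (rule lipschitz_on_subset[OF v(2)]) (use that in \<open>auto simp: dist_real_def\<close>)
      then show ?thesis using v by blast
    next
      case False
      then have "{p..t} \<subseteq> {t}" if "a \<le> p" for p using that local by auto
      then have "0-lipschitz_on {p..t} x" if "a \<le> p" for p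
        by (rule lipschitz_on_subset[rotated]) (use that in \<open>auto simp: lipschitz_on_def\<close>)
      then show ?thesis by (meson zero_less_one)
    qed
    have 2: "\<exists>d>0. \<forall>p. t \<le> p \<and> p \<le> b \<and> p - t < d \<longrightarrow> (\<exists>L. L-lipschitz_on {t..p} x)"
    proof (cases "t < b")
      case True
      then obtain v where "strict_velocity {t..b} x t v"
        using regular_solution_right[OF assms, of t] local by auto
      then obtain d where v: "d > 0" "(1 + norm v)-lipschitz_on ({t..b} \<inter> ball t d) x"
        using strict_velocity_lipschitz by blast
      have "(1 + norm v)-lipschitz_on {t..p} x" if "t \<le> p" "p \<le> b" "p - t < d" for p
        by (rule lipschitz_on_subset[OF v(2)]) (use that in \<open>auto simp: dist_real_def\<close>)
      then show ?thesis using v by blast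
    next
      case False
      then have "{t..p} \<subseteq> {t}" if "p \<le> b" for p using that local by auto
      then have "0-lipschitz_on {t..p} x" if "p \<le> b" for p
        by (rule lipschitz_on_subset[rotated]) (use that in \<open>auto simp: lipschitz_on_def\<close>)
      then show ?thesis by (meson zero_less_one)
    qed
    from 1 2 obtain d1 d2 where d: "d1 > 0" "d2 > 0"
      "\<And>p. a \<le> p \<Longrightarrow> p \<le> t \<Longrightarrow> t - p < d1 \<Longrightarrow> \<exists>L. L-lipschitz_on {p..t} x"
      "\<And>p. t \<le> p \<Longrightarrow> p \<le> b \<Longrightarrow> p - t < d2 \<Longrightarrow> \<exists>L. L-lipschitz_on {t..p} x" by metis
    show ?case
    proof (intro exI[of _ "min d1 d2"] conjI allI impI)
      fix p q assume pq: "p \<le> t \<and> t \<le> q \<and> q - p < min d1 d2"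
      show "P p q" unfolding P_def
      proof
        assume "a \<le> p \<and> q \<le> b"
        then obtain L M where "L-lipschitz_on {p..t} x" "M-lipschitz_on {t..q} x"
          using d(3)[of p] d(4)[of q] pq by auto
        then show "\<exists>L. L-lipschitz_on {p..q} x" using lipschitz_on_join by blast
      qed
    qed (use d in auto)
  qed
  then show ?thesis unfolding P_def by auto
next
  case False
  then show ?thesis by (intro exI[of _ 0]) (auto simp: lipschitz_on_def)
qed

lemma regular_solution_continuous:
  "regular_solution F a b x \<Longrightarrow> continuous_on {a..b} x"
  using regular_solution_lipschitz lipschitz_on_continuous_on by blast

section \<open>Existence for globally Lipschitz inclusions\<close>

text \<open>The last clause is one half of a bound on the Hausdorff distance; exchanging
  \<open>p\<close> and \<open>q\<close> gives the other half. The global constants are what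
  truncation of \<open>F\<close> to a ball will provide.\<close>

definition lipschitz_inclusion :: "('a::real_normed_vector \<Rightarrow> 'a set) \<Rightarrow> real \<Rightarrow> real \<Rightarrow> bool" where
  "lipschitz_inclusion G L B \<longleftrightarrow> 0 \<le> L \<and> 0 \<le> B \<and> (\<forall>p. G p \<noteq> {} \<and> closed (G p)) \<and>
     (\<forall>p. \<forall>v\<in>G p. norm v \<le> B) \<and> (\<forall>p q. \<forall>v\<in>G p. \<exists>w\<in>G q. norm (v - w) \<le> L * norm (p - q))"

lemma lipschitz_inclusionD:
  assumes "lipschitz_inclusion G L B"
  shows "0 \<le> L" "0 \<le> B" "G p \<noteq> {}" "closed (G p)" "v \<in> G p \<Longrightarrow> norm v \<le> B"
    "v \<in> G p \<Longrightarrow> \<exists>w\<in>G q. norm (v - w) \<le> L * norm (p - q)"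
  using assms unfolding lipschitz_inclusion_def by blast+

lemma lipschitz_inclusion_closed_graph:
  assumes "lipschitz_inclusion G L B"
  shows "closed {p. snd p \<in> G (fst p)}"
  unfolding closed_sequential_limits
proof (intro allI impI)
  fix X l assume X: "(\<forall>n. X n \<in> {p. snd p \<in> G (fst p)}) \<and> X \<longlonglongrightarrow> l"
  then have "\<forall>n. \<exists>w\<in>G (fst l). norm (snd (X n) - w) \<le> L * norm (fst (X n) - fst l)"
    using lipschitz_inclusionD(6)[OF assms] by auto
  then obtain w where w: "\<And>n. w n \<in> G (fst l)"
      "\<And>n. norm (snd (X n) - w n) \<le> L * norm (fst (X n) - fst l)" by metis
  have lim: "(\<lambda>n. fst (X n)) \<longlonglongrightarrow> fst l" "(\<lambda>n. snd (X n)) \<longlonglongrightarrow> snd l"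
    using X by (auto intro: tendsto_intros)
  have "(\<lambda>n. L * norm (fst (X n) - fst l)) \<longlonglongrightarrow> L * norm (fst l - fst l)"
    by (intro tendsto_intros lim)
  then have "(\<lambda>n. L * norm (fst (X n) - fst l)) \<longlonglongrightarrow> 0" by simp
  then have "(\<lambda>n. snd (X n) - w n) \<longlonglongrightarrow> 0"
    by (rule Lim_null_comparison[rotated]) (use w in auto)
  then have "(\<lambda>n. snd (X n) - (snd (X n) - w n)) \<longlonglongrightarrow> snd l - 0"
    by (intro tendsto_diff lim)
  then have "w \<longlonglongrightarrow> snd l" by simp
  then have "snd l \<in> G (fst l)"
    using lipschitz_inclusionD(4)[OF assms] w(1) closed_sequential_limits by blast
  then show "l \<in> {p. snd p \<in> G (fst p)}" by simp
qed

text \<open>Tychonoff's theorem, transferred to the function type with its topology of pointwise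
  convergence. It takes the place of an Ascoli argument for the Euler approximations.\<close>

lemma compact_PiE_UNIV:
  assumes "\<And>i. compact (S i :: 'b::topological_space set)"
  shows "compact (PiE UNIV S :: ('i \<Rightarrow> 'b) set)"
proof -
  have "compactin (product_topology (\<lambda>i::'i. euclidean :: 'b topology) UNIV) (PiE UNIV S)"
    unfolding compactin_PiE using assms by simp
  then show ?thesis by (simp add: euclidean_product_topology)
qed

text \<open>Picking each velocity next to the previous one makes the Euler velocities equi-Lipschitz in time,
  so that they have a limit although \<open>F\<close> is not convex-valued.\<close>

lemma euler_grid:
  assumes G: "lipschitz_inclusion G L B" and v: "v \<in> G \<xi>" and h: "0 < h"
  obtains x u :: "nat \<Rightarrow> 'a::euclidean_space" where "x 0 = \<xi>" "u 0 = v" "\<And>i. u i \<in> G (x i)"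
    "\<And>i j. i \<le> j \<Longrightarrow> norm (u j - u i) \<le> L * B * (h * real (j - i))"
    "\<And>i j. i \<le> j \<Longrightarrow> norm (x j - x i - (h * real (j - i)) *\<^sub>R u i) \<le> L * B * (h * real (j - i))\<^sup>2"
    "\<And>i. norm (x i - \<xi>) \<le> B * (h * real i)"
proof -
  note GD = lipschitz_inclusionD[OF G]
  have "\<exists>f. \<forall>n. (snd (f n) \<in> G (fst (f n)) \<and> (n = 0 \<longrightarrow> f n = (\<xi>, v))) \<and>
      (fst (f (Suc n)) = fst (f n) + h *\<^sub>R snd (f n) \<and> norm (snd (f (Suc n)) - snd (f n)) \<le> L * B * h)"
  proof (rule dependent_nat_choice)
    fix p :: "'a \<times> 'a" and n :: nat assume p: "snd p \<in> G (fst p) \<and> (n = 0 \<longrightarrow> p = (\<xi>, v))"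
    let ?q = "fst p + h *\<^sub>R snd p"
    obtain w where w: "w \<in> G ?q" "norm (snd p - w) \<le> L * norm (fst p - ?q)"
      using GD(6) p by blast
    have "norm (fst p - ?q) \<le> B * h" using GD(5)[of "snd p" "fst p"] p h by (simp add: mult.commute)
    then have "L * norm (fst p - ?q) \<le> L * (B * h)" using GD(1) by (rule mult_left_mono)
    then have "norm (w - snd p) \<le> L * B * h" using w(2) by (simp add: norm_minus_commute)
    then show "\<exists>y. (snd y \<in> G (fst y) \<and> (Suc n = 0 \<longrightarrow> y = (\<xi>, v))) \<and>
        fst y = fst p + h *\<^sub>R snd p \<and> norm (snd y - snd p) \<le> L * B * h"
      using w(1) by (intro exI[of _ "(?q, w)"]) auto
  qed (use v in auto)
  then obtain f where f: "\<And>n. snd (f n) \<in> G (fst (f n))" "f 0 = (\<xi>, v)"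
     "\<And>n. fst (f (Suc n)) = fst (f n) + h *\<^sub>R snd (f n)"
     "\<And>n. norm (snd (f (Suc n)) - snd (f n)) \<le> L * B * h" by blast
  have u: "norm (snd (f (i + k)) - snd (f i)) \<le> L * B * (h * real k)" for i k
  proof (induction k)
    case (Suc k)
    have "norm (snd (f (i + Suc k)) - snd (f i))
        \<le> norm (snd (f (Suc (i + k))) - snd (f (i + k))) + norm (snd (f (i + k)) - snd (f i))"
      using norm_triangle_ineq[of "snd (f (Suc (i + k))) - snd (f (i + k))" "snd (f (i + k)) - snd (f i)"] by simp
    also have "\<dots> \<le> L * B * h + L * B * (h * real k)" using f(4) Suc by (rule add_mono)
    finally show ?case by (simp add: algebra_simps)
  qed simp
  \<comment> \<open>The velocity errors of the single steps add up like
    \<open>0 + 1 + ... + (k - 1)\<close>. The bound \<open>k\<^sup>2\<close> is coarse, but it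
    closes the induction through \<open>k\<^sup>2 + k \<le> (k + 1)\<^sup>2\<close>.\<close>
  have x: "norm (fst (f (i + k)) - fst (f i) - (h * real k) *\<^sub>R snd (f i)) \<le> L * B * (h * real k)\<^sup>2" for i k
  proof (induction k)
    case (Suc k)
    have eq: "fst (f (i + Suc k)) - fst (f i) - (h * real (Suc k)) *\<^sub>R snd (f i)
      = (fst (f (i + k)) - fst (f i) - (h * real k) *\<^sub>R snd (f i)) + h *\<^sub>R (snd (f (i + k)) - snd (f i))"
      by (simp add: f(3) algebra_simps)
    have "norm (h *\<^sub>R (snd (f (i + k)) - snd (f i))) \<le> h * (L * B * (h * real k))"
      using u[of i k] h by simp
    then have "norm (fst (f (i + Suc k)) - fst (f i) - (h * real (Suc k)) *\<^sub>R snd (f i))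
      \<le> L * B * (h * real k)\<^sup>2 + h * (L * B * (h * real k))"
      unfolding eq by (rule norm_triangle_le[OF add_mono[OF Suc]])
    also have "\<dots> = (L * B) * (h\<^sup>2 * ((real k)\<^sup>2 + real k))" by (simp add: power2_eq_square algebra_simps)
    also have "\<dots> \<le> (L * B) * (h\<^sup>2 * (real (Suc k))\<^sup>2)"
      using GD(1,2) by (intro mult_left_mono) (auto simp: power2_eq_square algebra_simps)
    finally show ?case by (simp add: power_mult_distrib)
  qed simp
  have b: "norm (fst (f i) - \<xi>) \<le> B * (h * real i)" for i
  proof (induction i)
    case (Suc i)
    have "norm (h *\<^sub>R snd (f i)) \<le> h * B" using GD(5)[OF f(1)] h by simp
    then have "norm ((fst (f i) - \<xi>) + h *\<^sub>R snd (f i)) \<le> B * (h * real i) + h * B"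
      by (intro norm_triangle_le add_mono Suc)
    then show ?case by (simp add: f(3) algebra_simps)
  qed (simp add: f(2))
  show thesis
  proof (rule that[of "\<lambda>n. fst (f n)" "\<lambda>n. snd (f n)"])
    fix i j :: nat assume "i \<le> j"
    then obtain k where k: "j = i + k" using le_Suc_ex by blast
    show "norm (snd (f j) - snd (f i)) \<le> L * B * (h * real (j - i))" using u[of i k] k by simp
    show "norm (fst (f j) - fst (f i) - (h * real (j - i)) *\<^sub>R snd (f i)) \<le> L * B * (h * real (j - i))\<^sup>2"
      using x[of i k] k by simp
  qed (use f b in auto)
qed

text \<open>\<open>C e\<close> collects the pairs of position and velocity that satisfy the desired
  conditions up to a slack \<open>e\<close>. It is closed under pointwise convergence because a
  quadratic remainder, and not a derivative, links position and velocity. Euler step functions show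
  that finitely many of these sets meet inside the compact \<open>K\<close>; in a common point of
  all of them no slack remains.\<close>

lemma lipschitz_inclusion_C1_solution:
  assumes G: "lipschitz_inclusion G L B" and v: "v \<in> G \<xi>"
  obtains x u :: "real \<Rightarrow> 'a::euclidean_space" where "x 0 = \<xi>" "u 0 = v" "\<And>t. 0 \<le> t \<Longrightarrow> u t \<in> G (x t)"
    "\<And>s t. 0 \<le> s \<Longrightarrow> s \<le> t \<Longrightarrow> norm (u t - u s) \<le> L * B * (t - s)"
    "\<And>s t. 0 \<le> s \<Longrightarrow> s \<le> t \<Longrightarrow> norm (x t - x s - (t - s) *\<^sub>R u s) \<le> L * B * (t - s)\<^sup>2"
proof -
  note GD = lipschitz_inclusionD[OF G]
  define C :: "real \<Rightarrow> (real \<Rightarrow> 'a \<times> 'a) set" where "C e = {f. f 0 = (\<xi>, v)} \<inter>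
     {f. \<forall>t. 0 \<le> t \<longrightarrow> f t \<in> {p. snd p \<in> G (fst p)}} \<inter>
     {f. \<forall>s t. 0 \<le> s \<and> s \<le> t \<longrightarrow> norm (snd (f t) - snd (f s)) \<le> L * B * (t - s + e)} \<inter>
     {f. \<forall>s t. 0 \<le> s \<and> s \<le> t \<longrightarrow>
        norm (fst (f t) - fst (f s) - (t - s) *\<^sub>R snd (f s)) \<le> L * B * (t - s + e)\<^sup>2 + e * B}" for e
  define K :: "(real \<Rightarrow> 'a \<times> 'a) set" where "K = PiE UNIV (\<lambda>t. cball \<xi> (B * \<bar>t\<bar>) \<times> cball 0 B)"
  have cont: "continuous_on UNIV (\<lambda>f :: real \<Rightarrow> 'a \<times> 'a. f t)" for t by simp
  note cont' = continuous_on_fst[OF cont] continuous_on_snd[OF cont]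
  have "compact K" unfolding K_def by (intro compact_PiE_UNIV compact_Times) auto
  moreover have clC: "closed (C e)" for e
  proof -
    have 1: "closed {f :: real \<Rightarrow> 'a \<times> 'a. f 0 = (\<xi>, v)}"
      by (intro closed_Collect_eq cont continuous_on_const)
    have 2: "closed {f :: real \<Rightarrow> 'a \<times> 'a. \<forall>t. 0 \<le> t \<longrightarrow> f t \<in> {p. snd p \<in> G (fst p)}}"
    proof (intro closed_Collect_all closed_Collect_imp)
      fix t :: real
      have "closed ((\<lambda>f. f t) -` {p. snd p \<in> G (fst p)} \<inter> (UNIV :: (real \<Rightarrow> 'a \<times> 'a) set))"
        by (intro closed_vimage_Int lipschitz_inclusion_closed_graph[OF G] cont) auto
      then show "closed {f :: real \<Rightarrow> 'a \<times> 'a. f t \<in> {p. snd p \<in> G (fst p)}}" by (simp add: vimage_def)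
    qed auto
    have 3: "closed {f :: real \<Rightarrow> 'a \<times> 'a. \<forall>s t. 0 \<le> s \<and> s \<le> t \<longrightarrow>
        norm (snd (f t) - snd (f s)) \<le> L * B * (t - s + e)}"
      by (intro closed_Collect_all closed_Collect_imp closed_Collect_le continuous_on_norm
          continuous_on_diff continuous_on_scaleR continuous_on_const cont') auto
    have 4: "closed {f :: real \<Rightarrow> 'a \<times> 'a. \<forall>s t. 0 \<le> s \<and> s \<le> t \<longrightarrow>
        norm (fst (f t) - fst (f s) - (t - s) *\<^sub>R snd (f s)) \<le> L * B * (t - s + e)\<^sup>2 + e * B}"
      by (intro closed_Collect_all closed_Collect_imp closed_Collect_le continuous_on_norm
          continuous_on_diff continuous_on_scaleR continuous_on_const cont') auto
    show ?thesis unfolding C_def by (intro closed_Int 1 2 3 4)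
  qed
  moreover have "K \<inter> (\<Inter>n\<in>I. C (1 / real (Suc n))) \<noteq> {}" if fin: "finite I" for I
  proof -
    \<comment> \<open>One Euler grid serves a whole finite subfamily: as \<open>N\<close> bounds its
      indices, the mesh \<open>h\<close> is at most every slack \<open>1 / real (Suc n)\<close>
      involved.\<close>
    obtain N where N: "\<And>n. n \<in> I \<Longrightarrow> n \<le> N" using fin Max_ge by blast
    define h where "h = 1 / real (Suc N)"
    have h: "0 < h" by (simp add: h_def)
    obtain x u where xu: "x 0 = \<xi>" "u 0 = v" "\<And>i. u i \<in> G (x i)"
      "\<And>i j. i \<le> j \<Longrightarrow> norm (u j - u i) \<le> L * B * (h * real (j - i))"
      "\<And>i j. i \<le> j \<Longrightarrow> norm (x j - x i - (h * real (j - i)) *\<^sub>R u i) \<le> L * B * (h * real (j - i))\<^sup>2"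
      "\<And>i. norm (x i - \<xi>) \<le> B * (h * real i)"
      by (rule euler_grid[OF G v h]) (rule that; blast)
    define k where "k t = nat \<lfloor>t / h\<rfloor>" for t
    define f where "f t = (x (k t), u (k t))" for t
    have k: "h * real (k t) \<le> t" "t < h * real (k t) + h" if "0 \<le> t" for t
    proof -
      have "real (k t) = of_int \<lfloor>t / h\<rfloor>" unfolding k_def using that h by simp
      then have "real (k t) \<le> t / h" "t / h < real (k t) + 1" by linarith+
      then show "h * real (k t) \<le> t" "t < h * real (k t) + h" using h by (auto simp: field_simps)
    qed
    \<comment> \<open>Functions in \<open>K\<close> are total. Since \<open>nat\<close> sends
      negative floors to \<open>0\<close>, \<open>f\<close> keeps its initial value at negative
      times.\<close>
    have k0: "k t = 0" if "t \<le> 0" for t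
    proof -
      have "t / h \<le> 0" using that h by (simp add: divide_nonpos_pos)
      then show ?thesis unfolding k_def by simp
    qed
    have "f \<in> K"
    proof -
      have "norm (x (k t) - \<xi>) \<le> B * \<bar>t\<bar>" for t
      proof (cases "0 \<le> t")
        case True
        have "B * (h * real (k t)) \<le> B * \<bar>t\<bar>" using k(1)[OF True] GD(2) by (intro mult_left_mono) auto
        then show ?thesis using xu(6)[of "k t"] by linarith
      next
        case False then show ?thesis using k0[of t] xu(1) GD(2) by (simp add: mult_nonneg_nonpos)
      qed
      moreover have "norm (u i) \<le> B" for i using GD(5) xu(3) by blast
      ultimately show ?thesis unfolding K_def f_def by (auto simp: dist_norm norm_minus_commute)
    qed
    moreover have "f \<in> C (1 / real (Suc n))" if n: "n \<in> I" for n
    proof -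
      define e where "e = 1 / real (Suc n)"
      have e: "h \<le> e" unfolding e_def h_def using N[OF n] by (simp add: frac_le)
      have *: "norm (u (k t) - u (k s)) \<le> L * B * (t - s + e) \<and>
          norm (x (k t) - x (k s) - (t - s) *\<^sub>R u (k s)) \<le> L * B * (t - s + e)\<^sup>2 + e * B"
        if st: "0 \<le> s" "s \<le> t" for s t
      proof -
        have "s / h \<le> t / h" using st h by (simp add: divide_right_mono)
        then have kk: "k s \<le> k t" unfolding k_def by (intro nat_mono floor_mono)
        \<comment> \<open>\<open>d\<close> is the time between the two grid points. It differs from
          \<open>t - s\<close> by at most \<open>e\<close>; following a velocity of norm at most
          \<open>B\<close> for that long is the origin of the term \<open>e * B\<close> in
          \<open>C\<close>.\<close>
        define d where "d = h * real (k t - k s)"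
        have d: "d = h * real (k t) - h * real (k s)" unfolding d_def using kk by (simp add: algebra_simps of_nat_diff)
        have d1: "0 \<le> d" "d \<le> t - s + e" "\<bar>d - (t - s)\<bar> \<le> e"
          using k[of s] k[of t] st e h kk unfolding d by (auto simp: mult_left_mono)
        have LB: "0 \<le> L * B" using GD(1,2) by simp
        have 1: "norm (u (k t) - u (k s)) \<le> L * B * d" using xu(4)[OF kk] d_def by simp
        have "L * B * d \<le> L * B * (t - s + e)" using LB d1 by (intro mult_left_mono) auto
        moreover have "norm ((x (k t) - x (k s) - d *\<^sub>R u (k s)) + (d - (t - s)) *\<^sub>R u (k s))
            \<le> L * B * (t - s + e)\<^sup>2 + e * B"
        proof (rule norm_triangle_le[OF add_mono])
          have "L * B * d\<^sup>2 \<le> L * B * (t - s + e)\<^sup>2" using LB d1 by (intro mult_left_mono power_mono) auto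
          then show "norm (x (k t) - x (k s) - d *\<^sub>R u (k s)) \<le> L * B * (t - s + e)\<^sup>2"
            using xu(5)[OF kk] d_def by simp
          have "norm (u (k s)) \<le> B" using GD(5) xu(3) by blast
          then show "norm ((d - (t - s)) *\<^sub>R u (k s)) \<le> e * B"
            using d1 e h unfolding norm_scaleR by (intro mult_mono) auto
        qed
        ultimately show ?thesis using 1 by (simp add: algebra_simps)
      qed
      show ?thesis unfolding C_def e_def[symmetric] using * xu(1-3) k0[of 0] by (auto simp: f_def)
    qed
    ultimately show ?thesis by blast
  qed
  ultimately have "K \<inter> (\<Inter>n\<in>UNIV. C (1 / real (Suc n))) \<noteq> {}"
    using compact_imp_fip_image[of K UNIV "\<lambda>n. C (1 / real (Suc n))"] by blast
  then obtain f where f: "\<And>n. f \<in> C (1 / real (Suc n))" by blast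
  have lim: "(\<lambda>n. 1 / real (Suc n)) \<longlonglongrightarrow> 0" by (rule LIMSEQ_Suc[OF lim_1_over_n])
  show thesis
  proof (rule that[of "\<lambda>t. fst (f t)" "\<lambda>t. snd (f t)"])
    fix s t :: real assume st: "0 \<le> s" "s \<le> t"
    have 1: "norm (snd (f t) - snd (f s)) \<le> L * B * (t - s + 1 / real (Suc n))" for n
      using f[of n] st unfolding C_def by blast
    have 2: "norm (fst (f t) - fst (f s) - (t - s) *\<^sub>R snd (f s))
        \<le> L * B * (t - s + 1 / real (Suc n))\<^sup>2 + 1 / real (Suc n) * B" for n
      using f[of n] st unfolding C_def by blast
    have "(\<lambda>n. L * B * (t - s + 1 / real (Suc n))) \<longlonglongrightarrow> L * B * (t - s + 0)"
      by (intro tendsto_intros lim)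
    then have "norm (snd (f t) - snd (f s)) \<le> L * B * (t - s + 0)"
      by (rule LIMSEQ_le_const) (use 1 in blast)
    then show "norm (snd (f t) - snd (f s)) \<le> L * B * (t - s)" by simp
    have "(\<lambda>n. L * B * (t - s + 1 / real (Suc n))\<^sup>2 + 1 / real (Suc n) * B) \<longlonglongrightarrow> L * B * (t - s + 0)\<^sup>2 + 0 * B"
      by (intro tendsto_intros lim)
    then have "norm (fst (f t) - fst (f s) - (t - s) *\<^sub>R snd (f s)) \<le> L * B * (t - s + 0)\<^sup>2 + 0 * B"
      by (rule LIMSEQ_le_const) (use 2 in blast)
    then show "norm (fst (f t) - fst (f s) - (t - s) *\<^sub>R snd (f s)) \<le> L * B * (t - s)\<^sup>2" by simp
  qed (use f[of 0] in \<open>simp_all add: C_def\<close>)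
qed

text \<open>The solution is continuously differentiable, so one velocity serves both sides of each
  time. The last clause, which keeps the velocity within \<open>L * B * (b - a)\<close> of
  \<open>v\<close>, feeds the error estimate of a tracking step and, later, the test of subgradients
  along a solution.\<close>

lemma lipschitz_inclusion_solution:
  assumes G: "lipschitz_inclusion G L B" and v: "v \<in> G (\<xi> :: 'a::euclidean_space)"
  shows "\<exists>x. x a = \<xi> \<and> (\<forall>b. regular_solution G a b x) \<and>
    (\<forall>b\<ge>a. (L * B * (b - a))-lipschitz_on {a..b} (\<lambda>t. x t - t *\<^sub>R v))"
proof -
  obtain x u where xu: "x 0 = \<xi>" "u 0 = v" "\<And>t. 0 \<le> t \<Longrightarrow> u t \<in> G (x t)"
    "\<And>s t. 0 \<le> s \<Longrightarrow> s \<le> t \<Longrightarrow> norm (u t - u s) \<le> L * B * (t - s)"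
    "\<And>s t. 0 \<le> s \<Longrightarrow> s \<le> t \<Longrightarrow> norm (x t - x s - (t - s) *\<^sub>R u s) \<le> L * B * (t - s)\<^sup>2"
    using lipschitz_inclusion_C1_solution[OF G v] by blast
  have LB: "0 \<le> L * B" using lipschitz_inclusionD(1,2)[OF G] by simp
  define y where "y t = x (t - a)" for t
  have est: "norm ((y q - q *\<^sub>R u (t - a)) - (y p - p *\<^sub>R u (t - a))) \<le> L * B * (q - p + \<bar>p - t\<bar>) * (q - p)"
    if "a \<le> p" "p \<le> q" "a \<le> t" for p q t
  proof -
    have eq: "(y q - q *\<^sub>R u (t - a)) - (y p - p *\<^sub>R u (t - a))
      = (y q - y p - (q - p) *\<^sub>R u (p - a)) + (q - p) *\<^sub>R (u (p - a) - u (t - a))" by (simp add: algebra_simps)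
    have 1: "norm (y q - y p - (q - p) *\<^sub>R u (p - a)) \<le> L * B * (q - p)\<^sup>2"
      unfolding y_def using xu(5)[of "p - a" "q - a"] that by simp
    have "norm (u (p - a) - u (t - a)) \<le> L * B * \<bar>p - t\<bar>"
      using xu(4)[of "p - a" "t - a"] xu(4)[of "t - a" "p - a"] that
      by (cases "p \<le> t") (auto simp: norm_minus_commute)
    then have 2: "norm ((q - p) *\<^sub>R (u (p - a) - u (t - a))) \<le> (q - p) * (L * B * \<bar>p - t\<bar>)"
      using that by (simp add: mult_left_mono)
    show ?thesis unfolding eq using norm_triangle_le[OF add_mono[OF 1 2]]
      by (simp add: algebra_simps power2_eq_square)
  qed
  have sv: "strict_velocity {a..} y t (u (t - a))" if "a \<le> t" for t
    unfolding strict_velocity_def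
  proof (intro allI impI)
    fix e :: real assume e: "e > 0"
    \<comment> \<open>Within distance \<open>d\<close> of \<open>t\<close> one has
      \<open>q - p < 2 * d\<close> and \<open>\<bar>p - t\<bar> < d\<close>, hence the factor 3; the
      \<open>+ 1\<close> covers \<open>L * B = 0\<close>.\<close>
    define d where "d = e / (3 * (L * B) + 1)"
    have d: "d > 0" "L * B * (3 * d) \<le> e" using e LB by (auto simp: d_def field_simps)
    have "e-lipschitz_on ({a..} \<inter> ball t d) (\<lambda>s. y s - s *\<^sub>R u (t - a))"
    proof (rule lipschitz_on_leI)
      fix p q assume pq: "p \<in> {a..} \<inter> ball t d" "q \<in> {a..} \<inter> ball t d" "p \<le> q"
      have "q - p + \<bar>p - t\<bar> \<le> 3 * d" using pq by (auto simp: dist_real_def)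
      then have "L * B * (q - p + \<bar>p - t\<bar>) \<le> e"
        using d(2) mult_left_mono[OF _ LB, of "q - p + \<bar>p - t\<bar>" "3 * d"] by linarith
      then have "L * B * (q - p + \<bar>p - t\<bar>) * (q - p) \<le> e * (q - p)" using pq by (intro mult_right_mono) auto
      then show "dist (y p - p *\<^sub>R u (t - a)) (y q - q *\<^sub>R u (t - a)) \<le> e * dist p q"
        using est[of p q t] pq that by (auto simp: dist_norm norm_minus_commute)
    qed (use e in auto)
    then show "\<exists>d>0. e-lipschitz_on ({a..} \<inter> ball t d) (\<lambda>s. y s - s *\<^sub>R u (t - a))" using d by blast
  qed
  have "regular_solution G a b y" for b
  proof (rule regular_solutionI)
    fix t assume t: "a \<le> t" "t < b"
    have "strict_velocity {t..b} y t (u (t - a))"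
      by (rule strict_velocity_transfer[OF sv, of _ 1]) (use t in auto)
    then show "\<exists>v\<in>G (y t). strict_velocity {t..b} y t v" using xu(3)[of "t - a"] t by (auto simp: y_def)
  next
    fix t assume t: "a < t" "t \<le> b"
    have "strict_velocity {a..t} y t (u (t - a))"
      by (rule strict_velocity_transfer[OF sv, of _ 1]) (use t in auto)
    then show "\<exists>v\<in>G (y t). strict_velocity {a..t} y t v" using xu(3)[of "t - a"] t by (auto simp: y_def)
  qed
  moreover have "(L * B * (b - a))-lipschitz_on {a..b} (\<lambda>t. y t - t *\<^sub>R v)" if "a \<le> b" for b
  proof (rule lipschitz_on_leI)
    fix p q assume pq: "p \<in> {a..b}" "q \<in> {a..b}" "p \<le> q"
    have "L * B * (q - p + \<bar>p - a\<bar>) * (q - p) \<le> L * B * (b - a) * (q - p)"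
      using pq LB by (intro mult_right_mono mult_left_mono) auto
    then show "dist (y p - p *\<^sub>R v) (y q - q *\<^sub>R v) \<le> L * B * (b - a) * dist p q"
      using est[of p q a] pq xu(2) by (auto simp: dist_norm norm_minus_commute)
  qed (use that LB in auto)
  moreover have "y a = \<xi>" using xu(1) by (simp add: y_def)
  ultimately show ?thesis by blast
qed

section \<open>Tracking of regular solutions\<close>

text \<open>One step of Filippov's estimate: \<open>y\<close> starts with a velocity
  \<open>w\<close> of \<open>G q\<close> close to \<open>v\<close>. The difference
  \<open>y - z\<close> changes at a rate of at most \<open>m0/4\<close> (\<open>z\<close> against
  \<open>v\<close>) plus \<open>m0/4\<close> (\<open>y\<close> against \<open>w\<close>) plus
  \<open>L * m + m0/4\<close> (\<open>w\<close> against \<open>v\<close>), which is below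
  \<open>(L + 1) * m\<close>; hence the exponent \<open>L + 1\<close> instead of \<open>L\<close>.
  The admissible step length refers to the initial error \<open>m0\<close>, so it does not vary with
  the current error \<open>m\<close>. The separate point \<open>p\<close> is there for pieces on
  which \<open>v\<close> is the left velocity at the right end.\<close>

lemma tracking_piece:
  fixes z :: "real \<Rightarrow> 'a::euclidean_space"
  assumes G: "lipschitz_inclusion G L B" and "s \<le> t" "0 < m0" "m0 \<le> m"
    and z: "(m0/4)-lipschitz_on {s..t} (\<lambda>r. z r - r *\<^sub>R v)" and v: "v \<in> G p"
    and p: "L * norm (z s - p) \<le> m0 / 4" and st: "L * B * (t - s) \<le> m0 / 4"
    and q: "norm (q - z s) \<le> m"
  shows "\<exists>y. regular_solution G s t y \<and> y s = q \<and>
    (\<forall>r\<in>{s..t}. norm (y r - z r) \<le> m * exp ((L + 1) * (r - s))) \<and>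
    ((L + 1) * m * exp ((L + 1) * (t - s)))-lipschitz_on {s..t} (\<lambda>r. y r - z r)"
proof -
  note GD = lipschitz_inclusionD[OF G]
  obtain w where w: "w \<in> G q" "norm (v - w) \<le> L * norm (p - q)" using GD(6)[OF v] by blast
  have "norm (p - q) \<le> norm (z s - p) + norm (q - z s)"
    using norm_triangle_ineq[of "p - z s" "z s - q"] by (simp add: norm_minus_commute)
  then have "L * norm (p - q) \<le> L * norm (z s - p) + L * norm (q - z s)"
    using GD(1) by (metis distrib_left mult_left_mono)
  also have "\<dots> \<le> m0 / 4 + L * m" using p q GD(1) by (intro add_mono mult_left_mono) auto
  finally have wv: "norm (w - v) \<le> L * m + m0 / 4" using w(2) by (simp add: norm_minus_commute)
  obtain y where y: "y s = q" "\<And>b. regular_solution G s b y"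
      "\<And>b. s \<le> b \<Longrightarrow> (L * B * (b - s))-lipschitz_on {s..b} (\<lambda>r. y r - r *\<^sub>R w)"
    using lipschitz_inclusion_solution[OF G w(1)] by blast
  have 1: "(m0/4)-lipschitz_on {s..t} (\<lambda>r. y r - r *\<^sub>R w)"
    by (rule lipschitz_on_mono[OF y(3)]) (use st \<open>s \<le> t\<close> in auto)
  have 2: "(L * m + m0 / 4)-lipschitz_on {s..t} (\<lambda>r. r *\<^sub>R (w - v))"
  proof (rule lipschitz_onI)
    fix p q :: real
    have "norm ((p - q) *\<^sub>R (w - v)) \<le> \<bar>p - q\<bar> * (L * m + m0 / 4)"
      unfolding norm_scaleR using wv by (intro mult_left_mono) auto
    then show "dist (p *\<^sub>R (w - v)) (q *\<^sub>R (w - v)) \<le> (L * m + m0 / 4) * dist p q"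
      by (simp add: dist_norm scaleR_left_diff_distrib mult.commute)
  next
    show "0 \<le> L * m + m0 / 4" using GD(1) assms by simp
  qed
  have 3: "((m0/4 + m0/4) + (L * m + m0/4))-lipschitz_on {s..t} (\<lambda>r. y r - z r)"
    using lipschitz_on_add[OF lipschitz_on_diff[OF 1 z] 2] by (simp add: algebra_simps)
  have L3: "((L + 1) * m)-lipschitz_on {s..t} (\<lambda>r. y r - z r)"
    by (rule lipschitz_on_mono[OF 3]) (use assms in \<open>auto simp: algebra_simps\<close>)
  have "norm (y r - z r) \<le> m * exp ((L + 1) * (r - s))" if r: "r \<in> {s..t}" for r
  proof -
    have "norm ((y r - z r) - (y s - z s)) \<le> (L + 1) * m * (r - s)"
      using lipschitz_onD[OF L3, of r s] r by (auto simp: dist_norm)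
    then have "norm (y r - z r) \<le> m + (L + 1) * m * (r - s)"
      using q y(1) norm_triangle_sub[of "y r - z r" "y s - z s"] by simp
    also have "\<dots> = m * (1 + (L + 1) * (r - s))" by (simp add: algebra_simps)
    also have "\<dots> \<le> m * exp ((L + 1) * (r - s))"
      using assms by (intro mult_left_mono exp_ge_add_one_self) auto
    finally show ?thesis .
  qed
  moreover have "((L + 1) * m * exp ((L + 1) * (t - s)))-lipschitz_on {s..t} (\<lambda>r. y r - z r)"
  proof (rule lipschitz_on_mono[OF L3])
    have "1 \<le> exp ((L + 1) * (t - s))" using GD(1) assms(2) by simp
    then show "(L + 1) * m \<le> (L + 1) * m * exp ((L + 1) * (t - s))"
      using GD(1) assms(3,4) mult_left_mono[of 1 _ "(L + 1) * m"] by simp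
  qed simp
  ultimately show ?thesis using y by blast
qed

text \<open>Filippov's theorem for regular solutions, including closeness of velocities. Around
  every time there are pieces on which \<open>z\<close> has nearly constant velocity, and the
  exponential bound composes exactly over consecutive pieces, so bisection reaches the whole
  interval.\<close>

lemma tracking_forward:
  fixes z :: "real \<Rightarrow> 'a::euclidean_space"
  assumes G: "lipschitz_inclusion G L B" and z: "regular_solution G a b z" and ab: "a \<le> b"
    and "0 < m" "norm (q - z a) \<le> m"
  shows "\<exists>y. regular_solution G a b y \<and> y a = q \<and>
    (\<forall>r\<in>{a..b}. norm (y r - z r) \<le> m * exp ((L + 1) * (r - a))) \<and>
    ((L + 1) * m * exp ((L + 1) * (b - a)))-lipschitz_on {a..b} (\<lambda>r. y r - z r)"
proof -
  note GD = lipschitz_inclusionD[OF G]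
  define Q where "Q s t m' q' \<longleftrightarrow> (\<exists>y. regular_solution G s t y \<and> y s = q' \<and>
    (\<forall>r\<in>{s..t}. norm (y r - z r) \<le> m' * exp ((L + 1) * (r - s))) \<and>
    ((L + 1) * m' * exp ((L + 1) * (t - s)))-lipschitz_on {s..t} (\<lambda>r. y r - z r))" for s t m' q'
  \<comment> \<open>A piece inherits the error accumulated before it, so the claim has to hold for
    every error \<open>m' \<ge> m\<close> and every start \<open>q'\<close>, while step lengths
    refer to the fixed \<open>m\<close>.\<close>
  define P where "P s t \<longleftrightarrow> (a \<le> s \<and> t \<le> b \<longrightarrow> (\<forall>m' q'. m \<le> m' \<and> norm (q' - z s) \<le> m' \<longrightarrow> Q s t m' q'))" for s t
  have trans: "P s t" if "P s r" "P r t" and rt: "s \<le> r" "r \<le> t" for s r t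
    unfolding P_def
  proof (intro impI allI)
    fix m' q' assume st: "a \<le> s \<and> t \<le> b" and q': "m \<le> m' \<and> norm (q' - z s) \<le> m'"
    have "Q s r m' q'" using \<open>P s r\<close> st q' rt unfolding P_def by auto
    then obtain y1 where y1: "regular_solution G s r y1" "y1 s = q'"
      "\<And>\<tau>. \<tau> \<in> {s..r} \<Longrightarrow> norm (y1 \<tau> - z \<tau>) \<le> m' * exp ((L + 1) * (\<tau> - s))"
      "((L + 1) * m' * exp ((L + 1) * (r - s)))-lipschitz_on {s..r} (\<lambda>r. y1 r - z r)"
      unfolding Q_def by blast
    define m2 where "m2 = m' * exp ((L + 1) * (r - s))"
    have "m' * 1 \<le> m2" unfolding m2_def using q' assms(4) GD(1) rt by (intro mult_left_mono) auto
    then have "Q r t m2 (y1 r)" using \<open>P r t\<close> st q' rt y1(3)[of r] unfolding P_def m2_def by auto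
    then obtain y2 where y2: "regular_solution G r t y2" "y2 r = y1 r"
      "\<And>\<tau>. \<tau> \<in> {r..t} \<Longrightarrow> norm (y2 \<tau> - z \<tau>) \<le> m2 * exp ((L + 1) * (\<tau> - r))"
      "((L + 1) * m2 * exp ((L + 1) * (t - r)))-lipschitz_on {r..t} (\<lambda>r. y2 r - z r)"
      unfolding Q_def by blast
    have e: "m2 * exp ((L + 1) * (\<tau> - r)) = m' * exp ((L + 1) * (\<tau> - s))" for \<tau>
      unfolding m2_def by (simp add: algebra_simps flip: exp_add)
    define y where "y \<tau> = (if \<tau> \<le> r then y1 \<tau> else y2 \<tau>)" for \<tau>
    have "regular_solution G s t y"
      unfolding y_def by (rule regular_solution_concat[OF y1(1) y2(1)]) (use y2(2) rt in auto)
    moreover have "y s = q'" using y1(2) rt by (simp add: y_def)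
    moreover have "norm (y \<tau> - z \<tau>) \<le> m' * exp ((L + 1) * (\<tau> - s))" if "\<tau> \<in> {s..t}" for \<tau>
      using y1(3)[of \<tau>] y2(3)[of \<tau>] e[of \<tau>] that by (cases "\<tau> \<le> r") (auto simp: y_def)
    moreover have "((L + 1) * m' * exp ((L + 1) * (t - s)))-lipschitz_on {s..t} (\<lambda>r. y r - z r)"
    proof -
      have "((L + 1) * m' * exp ((L + 1) * (t - s)))-lipschitz_on {s..r} (\<lambda>r. y1 r - z r)"
        by (rule lipschitz_on_mono[OF y1(4)]) (use GD(1) q' assms(4) rt in \<open>auto intro!: mult_left_mono\<close>)
      moreover have "((L + 1) * m' * exp ((L + 1) * (t - s)))-lipschitz_on {r..t} (\<lambda>r. y2 r - z r)"
        using y2(4) e[of t] by (simp add: mult.assoc)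
      ultimately have "((L + 1) * m' * exp ((L + 1) * (t - s)))-lipschitz_on {s..t}
          (\<lambda>\<tau>. if \<tau> \<le> r then y1 \<tau> - z \<tau> else y2 \<tau> - z \<tau>)"
        by (rule lipschitz_on_concat) (use y2(2) in auto)
      then show ?thesis by (rule lipschitz_on_transform) (auto simp: y_def)
    qed
    ultimately show "Q s t m' q'" unfolding Q_def by blast
  qed
  have loc: "\<exists>d>0. \<forall>s t. s \<le> x \<and> x \<le> t \<and> t - s < d \<longrightarrow> P s t" if x: "a \<le> x" "x \<le> b" for x
  proof -
    define d0 where "d0 = m / (4 * (L * B + 1))"
    have LB: "0 \<le> L * B" using GD(1,2) by simp
    have d0: "d0 > 0" "L * B * d0 \<le> m / 4"
      using LB \<open>0 < m\<close> by (auto simp: d0_def field_simps)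
    have d0': "L * B * (t - s) \<le> m / 4" if "t - s < d0" for s t
      using mult_left_mono[OF less_imp_le[OF that] LB] d0(2) by linarith
    \<comment> \<open>Here \<open>v\<close> is the velocity at the right end \<open>x\<close> of the
      piece, whereas the piece starts at \<open>s\<close>. Continuity of \<open>z\<close> brings
      \<open>z s\<close> close enough to \<open>z x\<close> for \<open>tracking_piece\<close> with
      \<open>p = z x\<close>.\<close>
    have left: "\<exists>d>0. \<forall>s. a \<le> s \<and> s \<le> x \<and> x - s < d \<longrightarrow> P s x"
    proof (cases "a < x")
      case True
      then obtain v where v: "v \<in> G (z x)" "strict_velocity {a..x} z x v"
        using regular_solution_left[OF z, of x] x by auto
      obtain d1 where d1: "d1 > 0" "(m/4)-lipschitz_on ({a..x} \<inter> ball x d1) (\<lambda>r. z r - r *\<^sub>R v)"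
        using v(2) \<open>0 < m\<close> unfolding strict_velocity_def by (meson divide_pos_pos zero_less_numeral)
      have eps: "0 < m / (4 * (L + 1))" using GD(1) \<open>0 < m\<close> by simp
      have "continuous_on {a..b} z" by (rule regular_solution_continuous[OF z])
      then obtain d2 where d2: "d2 > 0" "\<And>s. s \<in> {a..b} \<Longrightarrow> dist s x < d2 \<Longrightarrow> dist (z s) (z x) < m / (4 * (L + 1))"
        using x unfolding continuous_on_iff
        by (metis atLeastAtMost_iff eps)
      have "P s x" if s: "a \<le> s" "s \<le> x" "x - s < min d0 (min d1 d2)" for s
        unfolding P_def
      proof (intro impI allI)
        fix m' q' assume q': "m \<le> m' \<and> norm (q' - z s) \<le> m'"
        have "norm (z s - z x) \<le> m / (4 * (L + 1))" using d2(2)[of s] s x by (auto simp: dist_norm)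
        then have "L * norm (z s - z x) \<le> L * (m / (4 * (L + 1)))" using GD(1) by (rule mult_left_mono)
        also have "\<dots> \<le> m / 4" using GD(1) \<open>0 < m\<close> by (simp add: field_simps)
        finally show "Q s x m' q'" unfolding Q_def
          by (intro tracking_piece[OF G _ \<open>0 < m\<close> _ _ v(1)] lipschitz_on_subset[OF d1(2)])
            (use s q' d0' in \<open>auto simp: dist_real_def\<close>)
      qed
      then show ?thesis using d0 d1 d2 by (intro exI[of _ "min d0 (min d1 d2)"]) auto
    next
      case False
      obtain v where v: "v \<in> G (z x)" using GD(3) by blast
      have "P x x" unfolding P_def
      proof (intro impI allI)
        fix m' q' assume q': "m \<le> m' \<and> norm (q' - z x) \<le> m'"
        show "Q x x m' q'" unfolding Q_def
          by (rule tracking_piece[OF G _ \<open>0 < m\<close> _ _ v]) (use q' \<open>0 < m\<close> in \<open>auto simp: lipschitz_on_def\<close>)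
      qed
      then show ?thesis using False x by (intro exI[of _ 1]) auto
    qed
    have right: "\<exists>d>0. \<forall>t. t \<le> b \<and> x \<le> t \<and> t - x < d \<longrightarrow> P x t"
    proof (cases "x < b")
      case True
      then obtain v where v: "v \<in> G (z x)" "strict_velocity {x..b} z x v"
        using regular_solution_right[OF z, of x] x by auto
      obtain d1 where d1: "d1 > 0" "(m/4)-lipschitz_on ({x..b} \<inter> ball x d1) (\<lambda>r. z r - r *\<^sub>R v)"
        using v(2) \<open>0 < m\<close> unfolding strict_velocity_def by (meson divide_pos_pos zero_less_numeral)
      have "P x t" if s: "t \<le> b" "x \<le> t" "t - x < min d0 d1" for t
        unfolding P_def
      proof (intro impI allI)
        fix m' q' assume q': "m \<le> m' \<and> norm (q' - z x) \<le> m'"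
        show "Q x t m' q'" unfolding Q_def
          by (intro tracking_piece[OF G _ \<open>0 < m\<close> _ _ v(1)] lipschitz_on_subset[OF d1(2)])
            (use s q' d0' \<open>0 < m\<close> in \<open>auto simp: dist_real_def\<close>)
      qed
      then show ?thesis using d0 d1 by (intro exI[of _ "min d0 d1"]) auto
    next
      case False
      obtain v where v: "v \<in> G (z x)" using GD(3) by blast
      have "P x x" unfolding P_def
      proof (intro impI allI)
        fix m' q' assume q': "m \<le> m' \<and> norm (q' - z x) \<le> m'"
        show "Q x x m' q'" unfolding Q_def
          by (rule tracking_piece[OF G _ \<open>0 < m\<close> _ _ v]) (use q' \<open>0 < m\<close> in \<open>auto simp: lipschitz_on_def\<close>)
      qed
      then show ?thesis using False x by (intro exI[of _ 1]) (auto simp: order.antisym)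
    qed
    from left right obtain d1 d2 where d: "d1 > 0" "d2 > 0"
      "\<And>s. a \<le> s \<Longrightarrow> s \<le> x \<Longrightarrow> x - s < d1 \<Longrightarrow> P s x"
      "\<And>t. t \<le> b \<Longrightarrow> x \<le> t \<Longrightarrow> t - x < d2 \<Longrightarrow> P x t" by metis
    have "P s t" if "s \<le> x" "x \<le> t" "t - s < min d1 d2" for s t
    proof (cases "a \<le> s \<and> t \<le> b")
      case True
      then show ?thesis using that d(3)[of s] d(4)[of t] by (intro trans[of s x t]) auto
    qed (auto simp: P_def)
    then show ?thesis using d by (intro exI[of _ "min d1 d2"]) auto
  qed
  have "P a b" using ab by (rule Bolzano[of _ _ P]) (use trans loc in blast)+
  then show ?thesis using assms unfolding P_def Q_def by auto
qed

lemma lipschitz_inclusion_uminus: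
  assumes "lipschitz_inclusion G L B"
  shows "lipschitz_inclusion (\<lambda>p. uminus ` G p) L B"
  unfolding lipschitz_inclusion_def
proof (intro conjI allI ballI)
  fix p q v assume "v \<in> uminus ` G p"
  then obtain w where w: "w \<in> G q" "norm (- v - w) \<le> L * norm (p - q)"
    using lipschitz_inclusionD(6)[OF assms] by fastforce
  then have "norm (v - (- w)) \<le> L * norm (p - q)"
    using norm_minus_cancel[of "v + w"] by (simp add: add.commute)
  then show "\<exists>w\<in>uminus ` G q. norm (v - w) \<le> L * norm (p - q)" using w(1) by blast
qed (use lipschitz_inclusionD[OF assms] in \<open>auto simp: closed_negations\<close>)

text \<open>Prescribing the end point for \<open>G\<close> is prescribing the start for the reversed
  inclusion, whose values are those of \<open>G\<close> negated and which has the same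
  constants.\<close>

lemma tracking_backward:
  fixes z :: "real \<Rightarrow> 'a::euclidean_space"
  assumes G: "lipschitz_inclusion G L B" and z: "regular_solution G a b z" and ab: "a \<le> b"
    and "0 < m" "norm (q - z b) \<le> m"
  shows "\<exists>y. regular_solution G a b y \<and> y b = q \<and>
    (\<forall>r\<in>{a..b}. norm (y r - z r) \<le> m * exp ((L + 1) * (b - r))) \<and>
    ((L + 1) * m * exp ((L + 1) * (b - a)))-lipschitz_on {a..b} (\<lambda>r. y r - z r)"
proof -
  obtain y where y: "regular_solution (\<lambda>p. uminus ` G p) (-b) (-a) y" "y (-b) = q"
    "\<And>r. r\<in>{-b..-a} \<Longrightarrow> norm (y r - z (-r)) \<le> m * exp ((L + 1) * (r - (-b)))"
    "((L + 1) * m * exp ((L + 1) * (-a - (-b))))-lipschitz_on {-b..-a} (\<lambda>r. y r - z (-r))"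
    using tracking_forward[OF lipschitz_inclusion_uminus[OF G] regular_solution_reverse[OF z] _ assms(4), of q]
      ab assms(5) by auto
  have "regular_solution G a b (\<lambda>r. y (-r))"
    using regular_solution_reverse[OF y(1)] by (simp add: image_image)
  moreover have "((L + 1) * m * exp ((L + 1) * (b - a)))-lipschitz_on {a..b} (\<lambda>r. y (-r) - z r)"
  proof (rule lipschitz_onI)
    fix p q assume "p \<in> {a..b}" "q \<in> {a..b}"
    then show "dist (y (- p) - z p) (y (- q) - z q) \<le> (L + 1) * m * exp ((L + 1) * (b - a)) * dist p q"
      using lipschitz_onD[OF y(4), of "-p" "-q"] by (simp add: dist_real_def abs_minus_commute)
  qed (use lipschitz_inclusionD(1)[OF G] \<open>0 < m\<close> in auto)
  ultimately show ?thesis using y(2) y(3)[of "-r" for r] by (intro exI[of _ "\<lambda>r. y (-r)"]) auto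
qed

section \<open>Truncation to a ball\<close>

text \<open>For \<open>R \<ge> 0\<close> the projection onto the ball is nonexpansive, so a
  Lipschitz constant and a speed bound that hold for \<open>F\<close> on the ball become
  global.\<close>

definition truncated :: "('a::euclidean_space \<Rightarrow> 'a set) \<Rightarrow> real \<Rightarrow> 'a \<Rightarrow> 'a set" where
  "truncated F R p = F (closest_point (cball 0 R) p)"

lemma truncated_eq: "norm p \<le> R \<Longrightarrow> truncated F R p = F p"
  by (simp add: truncated_def closest_point_self)

text \<open>A Lebesgue number \<open>e\<close> of a finite cover by good neighbourhoods separates
  two cases. Points closer than \<open>e\<close> share a neighbourhood and use its constant; for
  distant points the bound \<open>B\<close> on velocities is enough, since then
  \<open>2 * B \<le> 2 * B / e * norm (p - q)\<close>.\<close>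

lemma set_locally_lipschitz_cball:
  fixes F :: "'a::euclidean_space \<Rightarrow> 'a set"
  assumes F: "set_locally_lipschitz F" "\<And>\<xi>. compact (F \<xi>)" "\<And>\<xi>. F \<xi> \<noteq> {}"
  obtains L B where "0 \<le> L" "0 \<le> B" "\<And>p v. norm p \<le> R \<Longrightarrow> v \<in> F p \<Longrightarrow> norm v \<le> B"
    "\<And>p q v. norm p \<le> R \<Longrightarrow> norm q \<le> R \<Longrightarrow> v \<in> F p \<Longrightarrow> \<exists>w\<in>F q. norm (v - w) \<le> L * norm (p - q)"
proof -
  define good where "good U L B \<longleftrightarrow> 0 \<le> L \<and> 0 \<le> B \<and> (\<forall>p\<in>U. \<forall>q\<in>U. \<forall>v\<in>F p.
      norm v \<le> B \<and> (\<exists>w\<in>F q. norm (v - w) \<le> L * norm (p - q)))" for U L B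
  define \<U> where "\<U> = {U. open U \<and> (\<exists>L B. good U L B)}"
  have "\<exists>U\<in>\<U>. \<xi> \<in> U" for \<xi>
  proof -
    obtain U L where U: "open U" "\<xi> \<in> U" "L > 0"
      "\<forall>p\<in>U. \<forall>q\<in>U. F p \<subseteq> {v + (L * norm (p - q)) *\<^sub>R b | v b. v \<in> F q \<and> b \<in> cball 0 1}"
      using spec[OF F(1)[unfolded set_locally_lipschitz_def], of \<xi>] by blast
    obtain B0 where B0: "\<And>v. v \<in> F \<xi> \<Longrightarrow> norm v \<le> B0"
      using compact_imp_bounded[OF F(2)] unfolding bounded_iff by blast
    have lip: "\<exists>w\<in>F q. norm (v - w) \<le> L * norm (p - q)" if pq: "p \<in> U" "q \<in> U" "v \<in> F p" for p q v
    proof -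
      have "v \<in> {v + (L * norm (p - q)) *\<^sub>R b | v b. v \<in> F q \<and> b \<in> cball 0 1}"
        using U(4) pq by blast
      then obtain w b where w: "w \<in> F q" "norm b \<le> 1" "v = w + (L * norm (p - q)) *\<^sub>R b" by auto
      have "norm (v - w) = L * norm (p - q) * norm b" using w(3) U(3) by simp
      also have "\<dots> \<le> L * norm (p - q) * 1" using w(2) U(3) by (intro mult_left_mono) auto
      finally show ?thesis using w(1) by auto
    qed
    have "norm v \<le> \<bar>B0\<bar> + L" if p: "p \<in> U \<inter> ball \<xi> 1" "v \<in> F p" for p v
    proof -
      obtain w where w: "w \<in> F \<xi>" "norm (v - w) \<le> L * norm (p - \<xi>)" using lip[of p \<xi> v] p U(2) by auto
      have "norm (p - \<xi>) \<le> 1" using p by (auto simp: dist_norm norm_minus_commute)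
      then have "L * norm (p - \<xi>) \<le> L * 1" using U(3) by (intro mult_left_mono) auto
      then show ?thesis using B0[OF w(1)] w(2) norm_triangle_sub[of v w] by linarith
    qed
    then have "good (U \<inter> ball \<xi> 1) L (\<bar>B0\<bar> + L)" unfolding good_def using lip U(3) by auto
    then show ?thesis unfolding \<U>_def using U(1,2) by (intro bexI[of _ "U \<inter> ball \<xi> 1"]) auto
  qed
  then have sub: "cball 0 R \<subseteq> \<Union>\<U>" by blast
  have op: "\<And>U. U \<in> \<U> \<Longrightarrow> open U" unfolding \<U>_def by blast
  obtain \<V> where \<V>: "\<V> \<subseteq> \<U>" "finite \<V>" "cball 0 R \<subseteq> \<Union>\<V>"
    by (rule compactE[OF compact_cball sub op])
  then have "\<forall>U\<in>\<V>. \<exists>L B. good U L B" unfolding \<U>_def by blast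
  then obtain l b where lb: "\<And>U. U \<in> \<V> \<Longrightarrow> good U (l U) (b U)" by metis
  obtain e where e: "e > 0" "\<And>x. x \<in> cball 0 R \<Longrightarrow> \<exists>U\<in>\<V>. ball x e \<subseteq> U"
  proof (rule Heine_Borel_lemma[OF compact_cball \<V>(3)])
    show "\<And>U. U \<in> \<V> \<Longrightarrow> open U" using op \<V>(1) by blast
  qed (rule that; blast)
  \<comment> \<open>Sums of nonnegative constants serve as upper bounds; unlike a maximum they also
    make sense for an empty cover.\<close>
  define L0 B where "L0 = sum l \<V>" and "B = sum b \<V>"
  have nn: "\<And>U. U \<in> \<V> \<Longrightarrow> 0 \<le> l U \<and> 0 \<le> b U" using lb unfolding good_def by blast
  have le: "l U \<le> L0" "b U \<le> B" if "U \<in> \<V>" for U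
    unfolding L0_def B_def using that nn \<V>(2) by (auto intro!: member_le_sum)
  have pos: "0 \<le> L0" "0 \<le> B" unfolding L0_def B_def using nn by (auto intro!: sum_nonneg)
  have bd: "norm v \<le> B" if "norm p \<le> R" "v \<in> F p" for p v
  proof -
    have "p \<in> \<Union>\<V>" using \<V>(3) that(1) by (auto simp: subset_iff)
    then obtain U where "U \<in> \<V>" "p \<in> U" by blast
    then show ?thesis using lb le(2) that(2) unfolding good_def by (meson order_trans)
  qed
  show thesis
  proof (rule that[of "L0 + 2 * B / e" B])
    fix p q v :: 'a assume pq: "norm p \<le> R" "norm q \<le> R" and v: "v \<in> F p"
    show "\<exists>w\<in>F q. norm (v - w) \<le> (L0 + 2 * B / e) * norm (p - q)"
    proof (cases "norm (p - q) < e")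
      case True
      obtain U where U: "U \<in> \<V>" "ball p e \<subseteq> U" using e(2)[of p] pq by auto
      then have "p \<in> U" "q \<in> U" using True e(1) by (auto simp: dist_norm subset_iff)
      then obtain w where w: "w \<in> F q" "norm (v - w) \<le> l U * norm (p - q)"
        using lb[OF U(1)] v unfolding good_def by blast
      have "l U \<le> L0 + 2 * B / e" using le(1)[OF U(1)] pos e(1) by (simp add: add_increasing2)
      then have "l U * norm (p - q) \<le> (L0 + 2 * B / e) * norm (p - q)" by (intro mult_right_mono) auto
      then show ?thesis using w by (meson order_trans)
    next
      case False
      obtain w where w: "w \<in> F q" using F(3) by blast
      have "norm (v - w) \<le> 2 * B" using bd[OF pq(1) v] bd[OF pq(2) w] norm_triangle_ineq4[of v w] by simp
      also have "\<dots> \<le> 2 * B / e * norm (p - q)" using False pos e(1) by (simp add: field_simps mult_left_mono)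
      also have "\<dots> \<le> (L0 + 2 * B / e) * norm (p - q)" using pos by (intro mult_right_mono) auto
      finally show ?thesis using w by blast
    qed
  qed (use pos e(1) bd in auto)
qed

lemma lipschitz_inclusion_truncated:
  fixes F :: "'a::euclidean_space \<Rightarrow> 'a set"
  assumes F: "set_locally_lipschitz F" "\<And>\<xi>. compact (F \<xi>)" "\<And>\<xi>. F \<xi> \<noteq> {}" and R: "0 \<le> R"
  obtains L B where "lipschitz_inclusion (truncated F R) L B"
proof -
  obtain L B where LB: "0 \<le> L" "0 \<le> B" "\<And>p v. norm p \<le> R \<Longrightarrow> v \<in> F p \<Longrightarrow> norm v \<le> B"
    "\<And>p q v. norm p \<le> R \<Longrightarrow> norm q \<le> R \<Longrightarrow> v \<in> F p \<Longrightarrow> \<exists>w\<in>F q. norm (v - w) \<le> L * norm (p - q)"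
    by (rule set_locally_lipschitz_cball[OF F]) (rule that; blast)
  have c: "norm (closest_point (cball 0 R) p) \<le> R" for p :: 'a
    using closest_point_in_set[of "cball (0::'a) R" p] R by auto
  have d: "norm (closest_point (cball 0 R) p - closest_point (cball 0 R) q) \<le> norm (p - q)" for p q :: 'a
    using closest_point_lipschitz[of "cball (0::'a) R" p q] R by (auto simp: dist_norm)
  have "lipschitz_inclusion (truncated F R) L B"
    unfolding lipschitz_inclusion_def truncated_def
  proof (intro conjI allI ballI)
    fix p q v :: 'a assume "v \<in> F (closest_point (cball 0 R) p)"
    then obtain w where w: "w \<in> F (closest_point (cball 0 R) q)"
      "norm (v - w) \<le> L * norm (closest_point (cball 0 R) p - closest_point (cball 0 R) q)"
      using LB(4) c by blast
    have "norm (v - w) \<le> L * norm (p - q)" using w(2) mult_left_mono[OF d LB(1)] by (rule order_trans)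
    then show "\<exists>w\<in>F (closest_point (cball 0 R) q). norm (v - w) \<le> L * norm (p - q)" using w(1) by blast
  qed (use LB c F compact_imp_closed in blast)+
  then show thesis by (rule that)
qed

section \<open>Regular solutions are absolutely continuous solutions\<close>

lemma absolutely_continuous_on_lipschitz:
  assumes "L-lipschitz_on {a..b} x"
  shows "absolutely_continuous_on a b x"
  unfolding absolutely_continuous_on_def
proof (intro allI impI)
  fix e :: real assume e: "e > 0"
  have L: "0 \<le> L" using assms by (rule lipschitz_on_nonneg)
  show "\<exists>\<delta>>0. \<forall>D. finite D \<and> (\<forall>(u, v)\<in>D. a \<le> u \<and> u \<le> v \<and> v \<le> b) \<and>
      disjoint_family_on (\<lambda>(u, v). {u<..<v}) D \<and> (\<Sum>(u, v)\<in>D. v - u) < \<delta> \<longrightarrow>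
      (\<Sum>(u, v)\<in>D. norm (x v - x u)) < e"
  proof (intro exI[of _ "e / (L + 1)"] conjI allI impI)
    show "e / (L + 1) > 0" using e L by simp
    fix D assume D: "finite D \<and> (\<forall>(u, v)\<in>D. a \<le> u \<and> u \<le> v \<and> v \<le> b) \<and>
      disjoint_family_on (\<lambda>(u, v). {u<..<v}) D \<and> (\<Sum>(u, v)\<in>D. v - u) < e / (L + 1)"
    have "(\<Sum>(u, v)\<in>D. norm (x v - x u)) \<le> (\<Sum>(u, v)\<in>D. L * (v - u))"
    proof (rule sum_mono)
      fix p assume "p \<in> D"
      then have "a \<le> fst p" "fst p \<le> snd p" "snd p \<le> b" using D by auto
      then show "(case p of (u, v) \<Rightarrow> norm (x v - x u)) \<le> (case p of (u, v) \<Rightarrow> L * (v - u))"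
        using lipschitz_onD[OF assms, of "snd p" "fst p"] by (auto simp: dist_norm split: prod.split)
    qed
    also have "\<dots> = L * (\<Sum>(u, v)\<in>D. v - u)" by (simp add: sum_distrib_left split_def)
    also have "\<dots> \<le> L * (e / (L + 1))" using D L by (intro mult_left_mono) auto
    also have "\<dots> < e" using e L by (simp add: field_simps)
    finally show "(\<Sum>(u, v)\<in>D. norm (x v - x u)) < e" .
  qed
qed

lemma absolutely_continuous_on_imp_continuous_on:
  assumes "absolutely_continuous_on a b x"
  shows "continuous_on {a..b} x"
  unfolding continuous_on_iff
proof (intro ballI allI impI)
  fix t e :: real assume t: "t \<in> {a..b}" and e: "e > 0"
  then obtain d where d: "d > 0" "\<forall>D. finite D \<and> (\<forall>(u, v)\<in>D. a \<le> u \<and> u \<le> v \<and> v \<le> b) \<and>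
      disjoint_family_on (\<lambda>(u, v). {u<..<v}) D \<and> (\<Sum>(u, v)\<in>D. v - u) < d \<longrightarrow>
      (\<Sum>(u, v)\<in>D. norm (x v - x u)) < e"
    using assms unfolding absolutely_continuous_on_def by blast
  show "\<exists>d>0. \<forall>s\<in>{a..b}. dist s t < d \<longrightarrow> dist (x s) (x t) < e"
  proof (intro exI[of _ d] conjI ballI impI)
    fix s assume s: "s \<in> {a..b}" "dist s t < d"
    show "dist (x s) (x t) < e"
      using spec[OF d(2), of "{(min s t, max s t)}"] s t
      by (auto simp: disjoint_family_on_def dist_real_def dist_norm norm_minus_commute min_def max_def split: if_splits)
  qed (rule d)
qed

lemma islimpt_atLeastAtMost:
  "t < b \<Longrightarrow> t islimpt {t..b::real}" "a < t \<Longrightarrow> t islimpt {a..t::real}"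
proof -
  show "t islimpt {t..b}" if "t < b"
    using connected_imp_perfect[of "{t..b}" t] that by (auto simp: set_eq_iff)
  show "t islimpt {a..t}" if "a < t"
    using connected_imp_perfect[of "{a..t}" t] that by (auto simp: set_eq_iff)
qed

text \<open>Comparison with the straight line of velocity \<open>v\<close>. As \<open>x\<close> is
  nearly linear on a small ball only, \<open>A\<close> is first cut down to that ball.\<close>

lemma strict_velocity_estimate:
  assumes "strict_velocity A x t w" "e-lipschitz_on (A \<inter> ball t d) (\<lambda>s. x s - s *\<^sub>R v)"
    and "d > 0" "t \<in> A" "t islimpt A"
  shows "norm (w - v) \<le> e"
proof (rule strict_velocity_close[where A = "A \<inter> ball t d"])
  show "strict_velocity (A \<inter> ball t d) x t w"
    by (rule strict_velocity_transfer[OF assms(1), of 1]) auto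
  show "strict_velocity (A \<inter> ball t d) (\<lambda>s. s *\<^sub>R v) t v"
    unfolding strict_velocity_def lipschitz_on_def by (auto intro!: exI[of _ 1])
  show "t islimpt A \<inter> ball t d"
    unfolding islimpt_approachable
  proof (intro allI impI)
    fix r :: real assume "r > 0"
    then obtain s where "s \<in> A" "s \<noteq> t" "dist s t < min r d"
      using assms(3,5) unfolding islimpt_approachable by (metis min_less_iff_conj)
    then show "\<exists>s\<in>A \<inter> ball t d. s \<noteq> t \<and> dist s t < r" by (auto simp: dist_commute)
  qed
qed (use assms in auto)

text \<open>A regulated function has finitely many jumps above a given size: the one-sided
  velocities at \<open>t\<close> keep a punctured neighbourhood of \<open>t\<close> free of such
  kinks, so they cannot accumulate, and bisection makes them finite in number.\<close>

lemma finite_kinks: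
  assumes x: "regular_solution F a b x" and ab: "a \<le> b" and e: "e > 0"
  shows "finite {t\<in>{a<..<b}. \<not> (\<exists>d>0. \<exists>v. e-lipschitz_on (ball t d) (\<lambda>s. x s - s *\<^sub>R v))}"
    (is "finite ?K")
proof -
  define P where "P c d \<longleftrightarrow> finite (?K \<inter> {c..d})" for c d
  have "P a b" using ab
  proof (rule Bolzano)
    fix c d f assume "P c d" "P d f" "c \<le> d" "d \<le> f"
    then have "finite ((?K \<inter> {c..d}) \<union> (?K \<inter> {d..f}))" unfolding P_def by blast
    then show "P c f" unfolding P_def by (rule finite_subset[rotated]) auto
  next
    fix t assume t: "a \<le> t" "t \<le> b"
    have left: "\<exists>d>0. \<forall>s\<in>?K. s < t \<longrightarrow> t - s \<ge> d"
    proof (cases "a < t")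
      case True
      then obtain v where "strict_velocity {a..t} x t v" using regular_solution_left[OF x, of t] t by auto
      then obtain d where d: "d > 0" "e-lipschitz_on ({a..t} \<inter> ball t d) (\<lambda>s. x s - s *\<^sub>R v)"
        using e unfolding strict_velocity_def by blast
      have "t - s \<ge> d" if s: "s \<in> ?K" "s < t" for s
      proof (rule ccontr)
        assume "\<not> t - s \<ge> d"
        define r where "r = Min {t - s, s - a, d - (t - s)}"
        have r: "r > 0" "r \<le> t - s" "r \<le> s - a" "r \<le> d - (t - s)"
          using s \<open>\<not> t - s \<ge> d\<close> unfolding r_def by auto
        have "e-lipschitz_on (ball s r) (\<lambda>s. x s - s *\<^sub>R v)"
          by (rule lipschitz_on_subset[OF d(2)]) (use r in \<open>auto simp: dist_real_def\<close>)
        then show False using s(1) r(1) by blast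
      qed
      then show ?thesis using d by blast
    qed (use t in \<open>auto intro!: exI[of _ 1]\<close>)
    have right: "\<exists>d>0. \<forall>s\<in>?K. t < s \<longrightarrow> s - t \<ge> d"
    proof (cases "t < b")
      case True
      then obtain v where "strict_velocity {t..b} x t v" using regular_solution_right[OF x, of t] t by auto
      then obtain d where d: "d > 0" "e-lipschitz_on ({t..b} \<inter> ball t d) (\<lambda>s. x s - s *\<^sub>R v)"
        using e unfolding strict_velocity_def by blast
      have "s - t \<ge> d" if s: "s \<in> ?K" "t < s" for s
      proof (rule ccontr)
        assume "\<not> s - t \<ge> d"
        define r where "r = Min {s - t, b - s, d - (s - t)}"
        have r: "r > 0" "r \<le> s - t" "r \<le> b - s" "r \<le> d - (s - t)"
          using s \<open>\<not> s - t \<ge> d\<close> unfolding r_def by auto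
        have "e-lipschitz_on (ball s r) (\<lambda>s. x s - s *\<^sub>R v)"
          by (rule lipschitz_on_subset[OF d(2)]) (use r in \<open>auto simp: dist_real_def\<close>)
        then show False using s(1) r(1) by blast
      qed
      then show ?thesis using d by blast
    qed (use t in \<open>auto intro!: exI[of _ 1]\<close>)
    obtain d1 where d1: "d1 > 0" "\<forall>s\<in>?K. s < t \<longrightarrow> t - s \<ge> d1" using left by (elim exE conjE)
    obtain d2 where d2: "d2 > 0" "\<forall>s\<in>?K. t < s \<longrightarrow> s - t \<ge> d2" using right by (elim exE conjE)
    show "\<exists>d>0. \<forall>p q. p \<le> t \<and> t \<le> q \<and> q - p < d \<longrightarrow> P p q"
    proof (intro exI[of _ "min d1 d2"] conjI allI impI)
      fix p q assume pq: "p \<le> t \<and> t \<le> q \<and> q - p < min d1 d2"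
      have "s = t" if s: "s \<in> ?K" "s \<in> {p..q}" for s
        using bspec[OF d1(2) s(1)] bspec[OF d2(2) s(1)] s(2) pq by (cases s t rule: linorder_cases) auto
      then have "?K \<inter> {p..q} \<subseteq> {t}" by blast
      then show "P p q" unfolding P_def by (rule finite_subset) simp
    qed (use d1(1) d2(1) in auto)
  qed
  then show ?thesis unfolding P_def by (rule finite_subset[rotated]) auto
qed

lemma strict_velocity_has_vector_derivative:
  assumes "strict_velocity {a..t} x t v" "strict_velocity {t..b} x t v" "a < t" "t < b"
  shows "(x has_vector_derivative v) (at t)"
  unfolding has_vector_derivative_def has_derivative_at_alt
proof (intro conjI allI impI)
  show "bounded_linear (\<lambda>h. h *\<^sub>R v)" by (rule bounded_linear_scaleR_left)
  fix e :: real assume "e > 0"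
  then obtain d1 d2 where d: "d1 > 0" "e-lipschitz_on ({a..t} \<inter> ball t d1) (\<lambda>s. x s - s *\<^sub>R v)"
    "d2 > 0" "e-lipschitz_on ({t..b} \<inter> ball t d2) (\<lambda>s. x s - s *\<^sub>R v)"
    using assms(1,2) unfolding strict_velocity_def by meson
  show "\<exists>d>0. \<forall>y. norm (y - t) < d \<longrightarrow> norm (x y - x t - (y - t) *\<^sub>R v) \<le> e * norm (y - t)"
  proof (intro exI[of _ "Min {d1, d2, t - a, b - t}"] conjI allI impI)
    fix y assume y: "norm (y - t) < Min {d1, d2, t - a, b - t}"
    have eq: "x y - x t - (y - t) *\<^sub>R v = (x y - y *\<^sub>R v) - (x t - t *\<^sub>R v)" by (simp add: algebra_simps)
    show "norm (x y - x t - (y - t) *\<^sub>R v) \<le> e * norm (y - t)"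
    proof (cases "y \<le> t")
      case True
      then show ?thesis unfolding eq using lipschitz_onD[OF d(2), of y t] y assms d
        by (auto simp: dist_norm norm_minus_commute)
    next
      case False
      then show ?thesis unfolding eq using lipschitz_onD[OF d(4), of y t] y assms d
        by (auto simp: dist_norm norm_minus_commute)
    qed
  qed (use d assms in auto)
qed

text \<open>At a time that is no kink of any size \<open>1 / real (Suc n)\<close>, both one-sided
  velocities are arbitrarily close to a common slope. So they agree, and the common value is a
  derivative in \<open>F\<close>. Each size contributes finitely many kinks.\<close>

lemma countable_nondifferentiable:
  assumes x: "regular_solution F a b x" and ab: "a \<le> b"
  shows "countable {t\<in>{a<..<b}. \<not> (\<exists>v\<in>F (x t). (x has_vector_derivative v) (at t))}"
proof -
  define K where "K e = {t\<in>{a<..<b}. \<not> (\<exists>d>0. \<exists>v. e-lipschitz_on (ball t d) (\<lambda>s. x s - s *\<^sub>R v))}" for e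
  have "t \<in> (\<Union>n. K (1 / real (Suc n)))"
    if t: "t \<in> {a<..<b}" "\<not> (\<exists>v\<in>F (x t). (x has_vector_derivative v) (at t))" for t
  proof (rule ccontr)
    assume nK: "t \<notin> (\<Union>n. K (1 / real (Suc n)))"
    obtain v w where vw: "v \<in> F (x t)" "strict_velocity {a..t} x t v" "strict_velocity {t..b} x t w"
      using regular_solution_left[OF x, of t] regular_solution_right[OF x, of t] t(1) by auto
    have "norm (v - w) \<le> e" if e: "e > 0" for e
    proof -
      obtain n where n: "1 / real (Suc n) < e / 2" using nat_approx_posE[of "e/2"] e by auto
      obtain d u where d: "d > 0" "(1 / real (Suc n))-lipschitz_on (ball t d) (\<lambda>s. x s - s *\<^sub>R u)"
        using nK t(1) unfolding K_def by blast
      have "norm (v - u) \<le> 1 / real (Suc n)"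
        by (rule strict_velocity_estimate[OF vw(2) lipschitz_on_subset[OF d(2)] d(1)])
          (use t islimpt_atLeastAtMost in auto)
      moreover have "norm (w - u) \<le> 1 / real (Suc n)"
        by (rule strict_velocity_estimate[OF vw(3) lipschitz_on_subset[OF d(2)] d(1)])
          (use t islimpt_atLeastAtMost in auto)
      ultimately show ?thesis using n norm_triangle_ineq4[of "v - u" "w - u"] by simp
    qed
    then have "norm (v - w) \<le> 0" using field_le_epsilon[of "norm (v - w)" 0] by simp
    then have "v = w" by simp
    then have "(x has_vector_derivative v) (at t)"
      by (intro strict_velocity_has_vector_derivative[OF vw(2), of b]) (use vw(3) t(1) in auto)
    then show False using t(2) vw(1) by blast
  qed
  then have "{t\<in>{a<..<b}. \<not> (\<exists>v\<in>F (x t). (x has_vector_derivative v) (at t))} \<subseteq> (\<Union>n. K (1 / real (Suc n)))"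
    by blast
  moreover have "countable (\<Union>n. K (1 / real (Suc n)))"
  proof (rule countable_UN)
    show "countable (K (1 / real (Suc n)))" for n
      unfolding K_def by (rule countable_finite, rule finite_kinks[OF x ab]) simp
  qed simp
  ultimately show ?thesis by (rule countable_subset)
qed

lemma regular_solution_is_solution:
  assumes x: "\<And>b. 0 \<le> b \<Longrightarrow> ereal b < T \<Longrightarrow> regular_solution F 0 b x" and T: "0 < T"
  shows "is_solution F T x"
  unfolding is_solution_def
proof (intro conjI T allI impI)
  fix a b assume ab: "0 \<le> a \<and> a \<le> b \<and> ereal b < T"
  then obtain L where "L-lipschitz_on {0..b} x" using regular_solution_lipschitz[OF x[of b]] by auto
  then have "L-lipschitz_on {a..b} x" by (rule lipschitz_on_subset) (use ab in auto)
  then show "absolutely_continuous_on a b x" by (rule absolutely_continuous_on_lipschitz)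
next
  define N where "N q = {t\<in>{0<..<q}. \<not> (\<exists>v\<in>F (x t). (x has_vector_derivative v) (at t))}" for q
  \<comment> \<open>\<open>T\<close> may be infinite, so the domain is exhausted by intervals with
    rational right ends, which keeps the union countable; \<open>0\<close> is added because each
    \<open>N q\<close> contains interior times only.\<close>
  define Z where "Z = insert 0 (\<Union>q\<in>{q\<in>\<rat>. 0 \<le> q \<and> ereal q < T}. N q)"
  have "countable Z"
    unfolding Z_def
  proof (intro countable_insert countable_UN)
    show "countable {q \<in> \<rat>. 0 \<le> q \<and> ereal q < T}"
      by (rule countable_subset[OF _ countable_rat]) auto
    fix q assume "q \<in> {q \<in> \<rat>. 0 \<le> q \<and> ereal q < T}"
    then show "countable (N q)" unfolding N_def using countable_nondifferentiable[OF x[of q]] by auto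
  qed
  then have "Z \<in> null_sets lebesgue" by (intro null_sets_completionI countable_imp_null_set_lborel)
  moreover have "{t\<in>space lebesgue. \<not> (0 \<le> t \<and> ereal t < T \<longrightarrow>
      (\<exists>v\<in>F (x t). (x has_vector_derivative v) (at t within {s. 0 \<le> s \<and> ereal s < T})))} \<subseteq> Z"
  proof (rule subsetI)
    fix t assume "t \<in> {t\<in>space lebesgue. \<not> (0 \<le> t \<and> ereal t < T \<longrightarrow>
      (\<exists>v\<in>F (x t). (x has_vector_derivative v) (at t within {s. 0 \<le> s \<and> ereal s < T})))}"
    then have t: "0 \<le> t" "ereal t < T"
      "\<not> (\<exists>v\<in>F (x t). (x has_vector_derivative v) (at t within {s. 0 \<le> s \<and> ereal s < T}))"
      by auto
    show "t \<in> Z"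
    proof (cases "t = 0")
      case False
      obtain c where c: "t < c" "ereal c < T"
        using ereal_dense2[OF t(2)] by auto
      obtain q where q: "q \<in> \<rat>" "t < q" "q < c" using Rats_dense_in_real[OF c(1)] by blast
      then have "ereal q < T" using c(2) by (meson ereal_less(1) less_ereal.simps(1) less_trans)
      moreover have "t \<in> N q" unfolding N_def using t(1,3) False q has_vector_derivative_at_within by fastforce
      ultimately show ?thesis using q t(1) unfolding Z_def by auto
    qed (simp add: Z_def)
  qed
  ultimately show "AE t in lebesgue. 0 \<le> t \<and> ereal t < T \<longrightarrow>
      (\<exists>v\<in>F (x t). (x has_vector_derivative v) (at t within {s. 0 \<le> s \<and> ereal s < T}))"
    by (rule AE_I')
qed

section \<open>Limits of regular solutions\<close>

locale lipschitz_system =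
  fixes F :: "'a::euclidean_space \<Rightarrow> 'a set"
  assumes F_lip: "set_locally_lipschitz F" and F_compact: "\<And>\<xi>. compact (F \<xi>)"
    and F_nonempty: "\<And>\<xi>. F \<xi> \<noteq> {}"
begin

lemma closed_graph:
  assumes "\<And>n. v n \<in> F (p n)" "p \<longlonglongrightarrow> q" "v \<longlonglongrightarrow> w"
  shows "w \<in> F q"
proof -
  obtain R where R: "\<And>n. norm (p n) \<le> R"
    using convergent_imp_Bseq[of p] assms(2) unfolding convergent_def Bseq_def by blast
  have q: "norm q \<le> R"
    by (rule LIMSEQ_le_const2[OF tendsto_norm[OF assms(2)]]) (use R in blast)
  have "0 \<le> R" using R[of 0] norm_ge_zero order_trans by blast
  then obtain L B where G: "lipschitz_inclusion (truncated F R) L B"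
    using lipschitz_inclusion_truncated[OF F_lip F_compact F_nonempty] by blast
  have "(\<lambda>n. (p n, v n)) \<longlonglongrightarrow> (q, w)" by (intro tendsto_Pair assms)
  moreover have "(p n, v n) \<in> {p. snd p \<in> truncated F R (fst p)}" for n
    using assms(1) R by (simp add: truncated_eq)
  ultimately have "(q, w) \<in> {p. snd p \<in> truncated F R (fst p)}"
    using closed_sequentially[OF lipschitz_inclusion_closed_graph[OF G], of "\<lambda>n. (p n, v n)" "(q, w)"]
    by blast
  then show ?thesis using q by (simp add: truncated_eq)
qed

text \<open>By \<open>strict_velocity_close\<close> the velocities of the approximations form a
  Cauchy sequence. They converge strongly, so the closed graph places their limit in
  \<open>F (x t)\<close> itself and not merely in its convex hull.\<close>

lemma strict_velocity_limit:
  assumes "t \<in> A" "t islimpt A"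
    and "\<And>e. e > 0 \<Longrightarrow> \<exists>y v. v \<in> F (y t) \<and> strict_velocity A y t v \<and>
      e-lipschitz_on A (\<lambda>s. x s - y s) \<and> norm (x t - y t) \<le> e"
  shows "\<exists>v\<in>F (x t). strict_velocity A x t v"
proof -
  define r where "r n = 1 / real (Suc n)" for n
  have r: "r n > 0" for n by (simp add: r_def)
  have r0: "r \<longlonglongrightarrow> 0" unfolding r_def by (rule LIMSEQ_Suc[OF lim_1_over_n])
  have "\<forall>n. \<exists>y v. v \<in> F (y t) \<and> strict_velocity A y t v \<and>
      (r n)-lipschitz_on A (\<lambda>s. x s - y s) \<and> norm (x t - y t) \<le> r n"
    using assms(3) r by blast
  then obtain y v where yv: "\<And>n. v n \<in> F (y n t)" "\<And>n. strict_velocity A (y n) t (v n)"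
    "\<And>n. (r n)-lipschitz_on A (\<lambda>s. x s - y n s)" "\<And>n. norm (x t - y n t) \<le> r n" by metis
  have vv: "norm (v m - v n) \<le> r n + r m" for m n
  proof (rule strict_velocity_close[OF yv(2) yv(2) _ assms(1,2)])
    show "(r n + r m)-lipschitz_on A (\<lambda>s. y m s - y n s)"
      using lipschitz_on_diff[OF yv(3)[of n] yv(3)[of m]] by simp
  qed
  have "Cauchy v"
  proof (rule metric_CauchyI)
    fix e :: real assume "e > 0"
    then obtain N where N: "\<And>n. n \<ge> N \<Longrightarrow> norm (r n) < e / 2"
      using LIMSEQ_D[OF r0, of "e/2"] by auto
    have "dist (v m) (v n) < e" if "m \<ge> N" "n \<ge> N" for m n
      using vv[of m n] N[OF that(1)] N[OF that(2)] by (simp add: dist_norm)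
    then show "\<exists>M. \<forall>m\<ge>M. \<forall>n\<ge>M. dist (v m) (v n) < e" by blast
  qed
  then obtain w where w: "v \<longlonglongrightarrow> w" using Cauchy_convergent_iff convergent_def by blast
  have vw: "norm (v n - w) \<le> r n" for n
  proof -
    have "(\<lambda>m. norm (v n - v m)) \<longlonglongrightarrow> norm (v n - w)" by (intro tendsto_intros w)
    moreover have "(\<lambda>m. r n + r m) \<longlonglongrightarrow> r n + 0" by (intro tendsto_intros r0)
    moreover have "norm (v n - v m) \<le> r n + r m" for m using vv[of n m] by simp
    ultimately show ?thesis using LIMSEQ_le by fastforce
  qed
  have "(\<lambda>n. x t - y n t) \<longlonglongrightarrow> 0" by (rule Lim_null_comparison[OF _ r0]) (use yv(4) in auto)
  then have "(\<lambda>n. x t - (x t - y n t)) \<longlonglongrightarrow> x t - 0" by (intro tendsto_intros)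
  then have "(\<lambda>n. y n t) \<longlonglongrightarrow> x t" by simp
  then have "w \<in> F (x t)" using closed_graph[of v "\<lambda>n. y n t", OF yv(1) _ w] by blast
  moreover have "strict_velocity A x t w"
    unfolding strict_velocity_def
  proof (intro allI impI)
    fix e :: real assume e: "e > 0"
    obtain n where n: "r n < e / 4" using nat_approx_posE[of "e/4"] e unfolding r_def by auto
    obtain d where d: "d > 0" "(e/4)-lipschitz_on (A \<inter> ball t d) (\<lambda>s. y n s - s *\<^sub>R v n)"
      using yv(2)[of n] e unfolding strict_velocity_def by (meson divide_pos_pos zero_less_numeral)
    have 1: "(r n)-lipschitz_on (A \<inter> ball t d) (\<lambda>s. x s - y n s)"
      by (rule lipschitz_on_subset[OF yv(3)]) auto
    have 2: "(r n)-lipschitz_on (A \<inter> ball t d) (\<lambda>s. s *\<^sub>R (v n - w))"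
    proof (rule lipschitz_onI)
      fix p q :: real
      have "norm ((p - q) *\<^sub>R (v n - w)) \<le> \<bar>p - q\<bar> * r n"
        unfolding norm_scaleR by (intro mult_left_mono vw) auto
      then show "dist (p *\<^sub>R (v n - w)) (q *\<^sub>R (v n - w)) \<le> r n * dist p q"
        by (simp add: dist_norm scaleR_left_diff_distrib mult.commute)
    qed (use r[of n] in simp)
    have "(r n + e/4 + r n)-lipschitz_on (A \<inter> ball t d) (\<lambda>s. x s - s *\<^sub>R w)"
      using lipschitz_on_add[OF lipschitz_on_add[OF 1 d(2)] 2] by (simp add: algebra_simps)
    then have "e-lipschitz_on (A \<inter> ball t d) (\<lambda>s. x s - s *\<^sub>R w)"
      by (rule lipschitz_on_mono) (use n e in auto)
    then show "\<exists>d>0. e-lipschitz_on (A \<inter> ball t d) (\<lambda>s. x s - s *\<^sub>R w)" using d(1) by blast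
  qed
  ultimately show ?thesis by blast
qed

lemma regular_solution_limit:
  assumes "\<And>e. e > 0 \<Longrightarrow> \<exists>y. regular_solution F a b y \<and> e-lipschitz_on {a..b} (\<lambda>s. x s - y s) \<and>
     (\<forall>t\<in>{a..b}. norm (x t - y t) \<le> e)"
  shows "regular_solution F a b x"
proof (rule regular_solutionI)
  fix t assume t: "a \<le> t" "t < b"
  show "\<exists>v\<in>F (x t). strict_velocity {t..b} x t v"
  proof (rule strict_velocity_limit)
    fix e :: real assume "e > 0"
    then obtain y where y: "regular_solution F a b y" "e-lipschitz_on {a..b} (\<lambda>s. x s - y s)"
      "\<forall>t\<in>{a..b}. norm (x t - y t) \<le> e" using assms by blast
    obtain v where "v \<in> F (y t)" "strict_velocity {t..b} y t v"
      using regular_solution_right[OF y(1) t] by blast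
    moreover have "e-lipschitz_on {t..b} (\<lambda>s. x s - y s)"
      by (rule lipschitz_on_subset[OF y(2)]) (use t in auto)
    ultimately show "\<exists>y v. v \<in> F (y t) \<and> strict_velocity {t..b} y t v \<and>
        e-lipschitz_on {t..b} (\<lambda>s. x s - y s) \<and> norm (x t - y t) \<le> e"
      using y(3) t by (intro exI[of _ y] exI[of _ v]) auto
  qed (use t islimpt_atLeastAtMost in auto)
next
  fix t assume t: "a < t" "t \<le> b"
  show "\<exists>v\<in>F (x t). strict_velocity {a..t} x t v"
  proof (rule strict_velocity_limit)
    fix e :: real assume "e > 0"
    then obtain y where y: "regular_solution F a b y" "e-lipschitz_on {a..b} (\<lambda>s. x s - y s)"
      "\<forall>t\<in>{a..b}. norm (x t - y t) \<le> e" using assms by blast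
    obtain v where "v \<in> F (y t)" "strict_velocity {a..t} y t v"
      using regular_solution_left[OF y(1) t] by blast
    moreover have "e-lipschitz_on {a..t} (\<lambda>s. x s - y s)"
      by (rule lipschitz_on_subset[OF y(2)]) (use t in auto)
    ultimately show "\<exists>y v. v \<in> F (y t) \<and> strict_velocity {a..t} y t v \<and>
        e-lipschitz_on {a..t} (\<lambda>s. x s - y s) \<and> norm (x t - y t) \<le> e"
      using y(3) t by (intro exI[of _ y] exI[of _ v]) auto
  qed (use t islimpt_atLeastAtMost in auto)
qed

end

section \<open>Bounded reachable sets\<close>

lemma first_exit:
  fixes z :: "real \<Rightarrow> 'a::real_normed_vector"
  assumes z: "continuous_on {a..b} z" and ab: "a \<le> b" and r: "norm (z a) < r" "r \<le> norm (z b)"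
  obtains c where "a < c" "c \<le> b" "norm (z c) = r" "\<And>t. a \<le> t \<Longrightarrow> t \<le> c \<Longrightarrow> norm (z t) \<le> r"
proof -
  define S where "S = {t\<in>{a..b}. r \<le> norm (z t)}"
  have "closed S" unfolding S_def
    by (intro continuous_on_closed_Collect_le z continuous_intros)
  then have "compact S" using compact_Int_closed[of "{a..b}" S] by (auto simp: S_def Int_absorb1 subset_eq inf.absorb2)
  moreover have "b \<in> S" using ab r by (auto simp: S_def)
  ultimately obtain c where c: "c \<in> S" "\<And>t. t \<in> S \<Longrightarrow> c \<le> t" using compact_attains_inf[of S] by blast
  have lt: "norm (z t) < r" if "a \<le> t" "t < c" for t
    using c that by (force simp: S_def)
  have "norm (z c) \<le> r"
  proof (rule ccontr)
    assume "\<not> norm (z c) \<le> r"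
    moreover have "continuous_on {a..c} (\<lambda>t. norm (z t))"
      by (intro continuous_on_norm continuous_on_subset[OF z]) (use c in \<open>auto simp: S_def\<close>)
    ultimately obtain t where "a \<le> t" "t \<le> c" "norm (z t) = r"
      using IVT'[of "\<lambda>t. norm (z t)" a r c] r c by (auto simp: S_def)
    then show False using lt[of t] \<open>\<not> norm (z c) \<le> r\<close> by (cases "t = c") auto
  qed
  then have cr: "norm (z c) = r" using c by (auto simp: S_def)
  moreover have "a \<noteq> c" using cr r by auto
  ultimately show thesis using that[of c] c lt by (force simp: S_def less_le)
qed

context lipschitz_system
begin

text \<open>The Lipschitz clause bounds the distance of velocities; uniform closeness alone would
  not let membership in \<open>F\<close> pass to limits.\<close>

definition shadows :: "real \<Rightarrow> real \<Rightarrow> (real \<Rightarrow> 'a) \<Rightarrow> real \<Rightarrow> (real \<Rightarrow> 'a) \<Rightarrow> bool" where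
  "shadows a b z e y \<longleftrightarrow> regular_solution F a b y \<and> (\<forall>t\<in>{a..b}. norm (y t - z t) \<le> e) \<and>
     e-lipschitz_on {a..b} (\<lambda>t. y t - z t)"

text \<open>The margin 1 in the truncation radius leaves room for the shadow: \<open>d\<close> keeps
  its error below \<open>min e 1\<close>, so it never leaves the ball on which the truncated and the
  original inclusion agree. That \<open>d\<close> is fixed before the solution \<open>z\<close> and
  the point \<open>q\<close> is essential in the limit arguments below.\<close>

lemma tracking:
  assumes "0 \<le> R" "0 \<le> T" "0 < e"
  obtains d where "d > 0" "\<And>a b z q. regular_solution F a b z \<Longrightarrow> a \<le> b \<Longrightarrow> b - a \<le> T \<Longrightarrow>
      (\<And>t. t \<in> {a..b} \<Longrightarrow> norm (z t) \<le> R) \<Longrightarrow>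
      (norm (q - z a) \<le> d \<longrightarrow> (\<exists>y. shadows a b z e y \<and> y a = q)) \<and>
      (norm (q - z b) \<le> d \<longrightarrow> (\<exists>y. shadows a b z e y \<and> y b = q))"
proof -
  obtain L B where G: "lipschitz_inclusion (truncated F (R + 1)) L B"
    using lipschitz_inclusion_truncated[OF F_lip F_compact F_nonempty, of "R + 1"] assms by auto
  have L: "0 \<le> L" using lipschitz_inclusionD(1)[OF G] .
  \<comment> \<open>\<open>M\<close> bounds both amplification factors, the exponential for
    positions and \<open>L + 1\<close> times the exponential for velocities.\<close>
  define M where "M = (L + 1) * exp ((L + 1) * T)"
  define d where "d = min e 1 / M"
  have M: "0 < M" using L by (simp add: M_def)
  have d: "0 < d" using M assms by (simp add: d_def)
  have M1: "exp ((L + 1) * s) \<le> M" "(L + 1) * exp ((L + 1) * s) \<le> M" if "s \<le> T" for s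
  proof -
    have *: "exp ((L + 1) * s) \<le> exp ((L + 1) * T)" using that L by (simp add: mult_left_mono)
    then show "(L + 1) * exp ((L + 1) * s) \<le> M" unfolding M_def using L by (intro mult_left_mono) auto
    have "1 * exp ((L + 1) * T) \<le> M" unfolding M_def using L by (intro mult_right_mono) auto
    then have "exp ((L + 1) * T) \<le> M" by (simp only: mult_1)
    with * show "exp ((L + 1) * s) \<le> M" by (rule order_trans)
  qed
  have dM: "d * M = min e 1" using M by (simp add: d_def)
  have b1: "d * exp ((L + 1) * s) \<le> min e 1" if "s \<le> T" for s
    using mult_left_mono[OF M1(1)[OF that], of d] d dM by simp
  have b2: "(L + 1) * d * exp ((L + 1) * s) \<le> e" if "s \<le> T" for s
  proof -
    have "(L + 1) * d * exp ((L + 1) * s) = d * ((L + 1) * exp ((L + 1) * s))" by (simp add: mult_ac)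
    also have "\<dots> \<le> d * M" by (rule mult_left_mono[OF M1(2)[OF that]]) (use d in simp)
    finally show ?thesis using dM by simp
  qed
  show thesis
  proof (rule that[OF d], intro conjI impI)
    fix a b z and q :: 'a
    assume z: "regular_solution F a b z" "a \<le> b" "b - a \<le> T" "\<And>t. t \<in> {a..b} \<Longrightarrow> norm (z t) \<le> R"
    have zG: "regular_solution (truncated F (R + 1)) a b z"
    proof (rule regular_solution_mono[OF z(1)])
      fix t assume "t \<in> {a..b}"
      then have "norm (z t) \<le> R + 1" using z(4)[of t] by simp
      then show "F (z t) \<subseteq> truncated F (R + 1) (z t)" by (simp add: truncated_eq)
    qed
    have untrunc: "regular_solution F a b y" if y: "regular_solution (truncated F (R + 1)) a b y"
      "\<And>t. t \<in> {a..b} \<Longrightarrow> norm (y t - z t) \<le> min e 1" for y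
    proof (rule regular_solution_mono[OF y(1)])
      fix t assume t: "t \<in> {a..b}"
      then have "norm (y t) \<le> R + 1" using y(2)[OF t] z(4)[OF t] norm_triangle_sub[of "y t" "z t"] by simp
      then show "truncated F (R + 1) (y t) \<subseteq> F (y t)" by (simp add: truncated_eq)
    qed
    show "\<exists>y. shadows a b z e y \<and> y a = q" if q: "norm (q - z a) \<le> d"
    proof -
      obtain y where y: "regular_solution (truncated F (R + 1)) a b y" "y a = q"
        "\<And>r. r\<in>{a..b} \<Longrightarrow> norm (y r - z r) \<le> d * exp ((L + 1) * (r - a))"
        "((L + 1) * d * exp ((L + 1) * (b - a)))-lipschitz_on {a..b} (\<lambda>r. y r - z r)"
        using tracking_forward[OF G zG z(2) d q] by blast
      have "norm (y r - z r) \<le> min e 1" if "r \<in> {a..b}" for r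
        using y(3)[OF that] b1[of "r - a"] that z(3) by simp
      moreover have "e-lipschitz_on {a..b} (\<lambda>r. y r - z r)"
        by (rule lipschitz_on_mono[OF y(4)]) (use b2[of "b - a"] z(3) in auto)
      ultimately show ?thesis using untrunc[OF y(1)] y(2) unfolding shadows_def by (intro exI[of _ y]) auto
    qed
    show "\<exists>y. shadows a b z e y \<and> y b = q" if q: "norm (q - z b) \<le> d"
    proof -
      obtain y where y: "regular_solution (truncated F (R + 1)) a b y" "y b = q"
        "\<And>r. r\<in>{a..b} \<Longrightarrow> norm (y r - z r) \<le> d * exp ((L + 1) * (b - r))"
        "((L + 1) * d * exp ((L + 1) * (b - a)))-lipschitz_on {a..b} (\<lambda>r. y r - z r)"
        using tracking_backward[OF G zG z(2) d q] by blast
      have "norm (y r - z r) \<le> min e 1" if "r \<in> {a..b}" for r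
        using y(3)[OF that] b1[of "b - r"] that z(3) by simp
      moreover have "e-lipschitz_on {a..b} (\<lambda>r. y r - z r)"
        by (rule lipschitz_on_mono[OF y(4)]) (use b2[of "b - a"] z(3) in auto)
      ultimately show ?thesis using untrunc[OF y(1)] y(2) unfolding shadows_def by (intro exI[of _ y]) auto
    qed
  qed
qed

section \<open>Blow-up from unbounded reachable sets\<close>

text \<open>Unboundedness of the reachable set of \<open>p\<close> up to time \<open>\<tau>\<close>.
  Each radius \<open>R\<close> may need its own solution; that a single solution blows up remains to
  be shown.\<close>

definition escapes :: "'a \<Rightarrow> real \<Rightarrow> bool" where
  "escapes p \<tau> \<longleftrightarrow> (\<forall>R. \<exists>z s. 0 \<le> s \<and> s \<le> \<tau> \<and> regular_solution F 0 s z \<and> z 0 = p \<and> R < norm (z s))"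

lemma escapes_mono: "escapes p \<sigma> \<Longrightarrow> \<sigma> \<le> \<tau> \<Longrightarrow> escapes p \<tau>"
  unfolding escapes_def by (meson order_trans)

lemma escapes_nonneg: "escapes p \<tau> \<Longrightarrow> 0 \<le> \<tau>"
  unfolding escapes_def by (meson order_trans)

text \<open>Cut each solution where it first reaches a large radius. Up to then it stays in a ball,
  so tracking moves its start to \<open>p\<close> and changes its end by at most 1.\<close>

lemma escapes_limit:
  assumes "\<And>k::nat. 0 \<le> s k \<and> s k \<le> \<tau> \<and> regular_solution F 0 (s k) (z k) \<and> real k < norm (z k (s k))"
    and lim: "(\<lambda>k. z k 0) \<longlonglongrightarrow> p"
  shows "escapes p \<tau>"
  unfolding escapes_def
proof
  fix R
  \<comment> \<open>\<open>R1\<close> exceeds \<open>norm p\<close>, so late solutions start inside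
    the ball, and it exceeds \<open>R\<close> by more than the tracking error 1.\<close>
  define R1 where "R1 = max \<bar>R\<bar> (norm p) + 2"
  have R1: "0 \<le> R1" "norm p < R1" "R < R1 - 1" by (auto simp: R1_def)
  have "0 \<le> \<tau>" using assms(1)[of 0] by linarith
  obtain d where d: "d > 0" and tr: "\<And>a b z q. regular_solution F a b z \<Longrightarrow> a \<le> b \<Longrightarrow> b - a \<le> \<tau> \<Longrightarrow>
      (\<And>t. t \<in> {a..b} \<Longrightarrow> norm (z t) \<le> R1) \<Longrightarrow> norm (q - z a) \<le> d \<Longrightarrow> \<exists>y. shadows a b z 1 y \<and> y a = q"
    using tracking[OF R1(1) \<open>0 \<le> \<tau>\<close> zero_less_one] by metis
  have ev: "\<forall>\<^sub>F k in sequentially. norm (z k 0 - p) < min d (R1 - norm p)"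
    using lim d R1(2) by (intro tendstoD[OF lim, unfolded dist_norm]) auto
  moreover have "\<forall>\<^sub>F k in sequentially. R1 \<le> real k" using eventually_ge_at_top[of "nat \<lceil>R1\<rceil>"]
    by eventually_elim linarith
  ultimately obtain k where k: "norm (z k 0 - p) < min d (R1 - norm p)" "R1 \<le> real k"
    using eventually_happens[OF eventually_conj] by fastforce
  have sk: "0 \<le> s k" "s k \<le> \<tau>" "regular_solution F 0 (s k) (z k)" "real k < norm (z k (s k))" using assms(1) by auto
  have "norm (z k 0) < R1" using k(1) norm_triangle_sub[of "z k 0" p] by simp
  moreover have "R1 \<le> norm (z k (s k))" using sk k by simp
  ultimately obtain c where c: "0 < c" "c \<le> s k" "norm (z k c) = R1" "\<And>t. 0 \<le> t \<Longrightarrow> t \<le> c \<Longrightarrow> norm (z k t) \<le> R1"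
    using first_exit[OF regular_solution_continuous[OF sk(3)] sk(1)] by blast
  have "regular_solution F 0 c (z k)" by (rule regular_solution_subinterval[OF sk(3)]) (use c in auto)
  then obtain y where y: "regular_solution F 0 c y" "y 0 = p" "\<forall>t\<in>{0..c}. norm (y t - z k t) \<le> 1"
    using tr[of 0 c "z k" p] c sk k by (auto simp: norm_minus_commute shadows_def)
  have "norm (z k c - y c) \<le> 1" using bspec[OF y(3), of c] c by (simp add: norm_minus_commute)
  then have "R < norm (y c)" using c(3) R1(3) norm_triangle_sub[of "z k c" "y c"] by simp
  then show "\<exists>z s. 0 \<le> s \<and> s \<le> \<tau> \<and> regular_solution F 0 s z \<and> z 0 = p \<and> R < norm (z s)"
    using y c sk by (intro exI[of _ y] exI[of _ c]) auto
qed

text \<open>Solutions from \<open>p\<close> that go far cross the sphere of radius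
  \<open>norm p + 1\<close>. Their first crossing points accumulate at some \<open>q\<close>, and
  the pieces after the crossing show that \<open>q\<close> escapes too. The crossing points are only
  near \<open>q\<close>, while the next stage has to continue from \<open>q\<close> itself; so
  \<open>x\<close>, prolonged to a crossing, is corrected backwards to end exactly at
  \<open>q\<close>. This alters the part on \<open>{0..S}\<close> by at most \<open>e\<close>, in
  value and in velocity.\<close>

lemma escapes_step:
  assumes esc: "escapes p \<tau>" and x: "regular_solution F 0 S x" "0 \<le> S" "x S = p" and e: "e > 0"
  shows "\<exists>s q y. 0 < s \<and> regular_solution F 0 (S + s) y \<and> y (S + s) = q \<and> norm q = norm p + 1 \<and>
    escapes q (\<tau> - s + e) \<and> (\<forall>t\<in>{0..S}. norm (y t - x t) \<le> e) \<and> e-lipschitz_on {0..S} (\<lambda>t. y t - x t)"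
proof -
  have \<tau>: "0 \<le> \<tau>" by (rule escapes_nonneg[OF esc])
  have "\<forall>k::nat. \<exists>z s. 0 \<le> s \<and> s \<le> \<tau> \<and> regular_solution F 0 s z \<and> z 0 = p \<and> real k + norm p + 1 < norm (z s)"
    using esc unfolding escapes_def by blast
  then obtain z s where z: "\<And>k::nat. 0 \<le> s k \<and> s k \<le> \<tau> \<and> regular_solution F 0 (s k) (z k) \<and> z k 0 = p \<and>
      real k + norm p + 1 < norm (z k (s k))" by metis
  have "\<exists>c. 0 < c \<and> c \<le> s k \<and> norm (z k c) = norm p + 1 \<and> (\<forall>t. 0 \<le> t \<and> t \<le> c \<longrightarrow> norm (z k t) \<le> norm p + 1)" for k
    using first_exit[OF regular_solution_continuous, of F 0 "s k" "z k" "norm p + 1"] z[of k]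
    by (smt (verit) norm_ge_zero of_nat_0_le_iff)
  then obtain c where c: "\<And>k. 0 < c k \<and> c k \<le> s k \<and> norm (z k (c k)) = norm p + 1 \<and>
      (\<forall>t. 0 \<le> t \<and> t \<le> c k \<longrightarrow> norm (z k t) \<le> norm p + 1)" by metis
  have "(c k, z k (c k)) \<in> {0..\<tau>} \<times> sphere 0 (norm p + 1)" for k
    using c[of k] z[of k] by auto
  moreover have "compact ({0..\<tau>} \<times> sphere (0::'a) (norm p + 1))" by (intro compact_Times) auto
  ultimately obtain l r where lr: "l \<in> {0..\<tau>} \<times> sphere (0::'a) (norm p + 1)" "strict_mono r"
      "((\<lambda>k. (c k, z k (c k))) \<circ> r) \<longlonglongrightarrow> l"
    unfolding compact_def by meson
  obtain \<sigma> q where l: "l = (\<sigma>, q)" by fastforce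
  have q: "norm q = norm p + 1" using lr(1) l by simp
  have lim: "(\<lambda>k. c (r k)) \<longlonglongrightarrow> \<sigma>" "(\<lambda>k. z (r k) (c (r k))) \<longlonglongrightarrow> q"
    using tendsto_fst[OF lr(3)] tendsto_snd[OF lr(3)] l by (auto simp: o_def)
  obtain N where N: "\<And>k. k \<ge> N \<Longrightarrow> \<bar>c (r k) - \<sigma>\<bar> < e / 2"
    using LIMSEQ_D[OF lim(1), of "e/2"] e by auto
  have "escapes q (\<tau> - \<sigma> + e / 2)"
  \<comment> \<open>The shift by \<open>N\<close> puts all crossing times used within
    \<open>e / 2\<close> of \<open>\<sigma>\<close>, and \<open>r (k + N) \<ge> k\<close> supplies
    end norms above \<open>k\<close>.\<close>
  proof (rule escapes_limit[where s = "\<lambda>k. s (r (k + N)) - c (r (k + N))"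
        and z = "\<lambda>k t. z (r (k + N)) (c (r (k + N)) + t)"])
    show "(\<lambda>k. z (r (k + N)) (c (r (k + N)) + 0)) \<longlonglongrightarrow> q"
      using LIMSEQ_ignore_initial_segment[OF lim(2)] by simp
    fix k
    define n where "n = r (k + N)"
    have "k \<le> n" unfolding n_def using seq_suble[OF lr(2), of "k + N"] by simp
    moreover have "\<bar>c n - \<sigma>\<bar> < e / 2" unfolding n_def by (rule N) simp
    moreover have "regular_solution F 0 (s n - c n) (\<lambda>t. z n (c n + t))"
      using regular_solution_subinterval[OF regular_solution_shift[of F 0 "s n" "z n" "c n"], of 0 "s n - c n" "\<lambda>t. z n (c n + t)"]
        z[of n] c[of n] by auto
    ultimately show "0 \<le> s (r (k + N)) - c (r (k + N)) \<and> s (r (k + N)) - c (r (k + N)) \<le> \<tau> - \<sigma> + e / 2 \<and>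
      regular_solution F 0 (s (r (k + N)) - c (r (k + N))) (\<lambda>t. z (r (k + N)) (c (r (k + N)) + t)) \<and>
      real k < norm (z (r (k + N)) (c (r (k + N)) + (s (r (k + N)) - c (r (k + N)))))"
    proof (unfold n_def[symmetric], intro conjI)
      assume kn: "k \<le> n" "\<bar>c n - \<sigma>\<bar> < e / 2"
      show "0 \<le> s n - c n" using c[of n] by simp
      have "s n \<le> \<tau>" using z[of n] by blast
      then show "s n - c n \<le> \<tau> - \<sigma> + e / 2" using kn(2) by linarith
      have "real n + norm p + 1 < norm (z n (s n))" using z[of n] by blast
      moreover have "real k \<le> real n" using kn(1) by simp
      ultimately have "real k < norm (z n (s n))" using norm_ge_zero[of p] by linarith
      then show "real k < norm (z n (c n + (s n - c n)))" by simp
    qed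
  qed
  obtain R2 where R2: "\<And>t. t \<in> {0..S} \<Longrightarrow> norm (x t) \<le> R2"
  proof -
    have "bounded (x ` {0..S})"
      by (intro compact_imp_bounded compact_continuous_image regular_solution_continuous[OF x(1)]) simp
    then show thesis using that unfolding bounded_iff by blast
  qed
  define R where "R = max \<bar>R2\<bar> (norm p + 1)"
  have "0 \<le> R" "0 \<le> S + \<tau>" using x(2) \<tau> by (auto simp: R_def)
  obtain d where d: "d > 0" and tr: "\<And>a b z q. regular_solution F a b z \<Longrightarrow> a \<le> b \<Longrightarrow> b - a \<le> S + \<tau> \<Longrightarrow>
      (\<And>t. t \<in> {a..b} \<Longrightarrow> norm (z t) \<le> R) \<Longrightarrow> norm (q - z b) \<le> d \<Longrightarrow> \<exists>y. shadows a b z e y \<and> y b = q"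
    using tracking[OF \<open>0 \<le> R\<close> \<open>0 \<le> S + \<tau>\<close> e] by metis
  obtain N' where N': "\<And>k. k \<ge> N' \<Longrightarrow> norm (z (r k) (c (r k)) - q) < d"
    using LIMSEQ_D[OF lim(2) d] by auto
  \<comment> \<open>Late enough for the crossing point to be within \<open>d\<close> of
    \<open>q\<close>, as the correction demands, and for the crossing time to be within
    \<open>e / 2\<close> of \<open>\<sigma>\<close>. With the \<open>e / 2\<close> already granted
    to \<open>q\<close> this adds up to the slack \<open>e\<close>.\<close>
  define n where "n = r (max N N')"
  have n: "\<bar>c n - \<sigma>\<bar> < e / 2" "norm (z n (c n) - q) < d" unfolding n_def using N N' by auto
  have cn: "0 < c n" "c n \<le> \<tau>" "c n \<le> s n" using c[of n] z[of n] by auto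
  define w where "w t = (if t \<le> S then x t else z n (- S + t))" for t
  have "regular_solution F 0 (S + c n) w" unfolding w_def
  proof (rule regular_solution_concat[OF x(1)])
    have "regular_solution F (0 - (- S)) (s n - (- S)) (\<lambda>t. z n (- S + t))"
      by (rule regular_solution_shift) (use z[of n] in blast)
    then show "regular_solution F S (S + c n) (\<lambda>t. z n (- S + t))"
      by (rule regular_solution_subinterval) (use cn in auto)
  qed (use x cn z[of n] in auto)
  moreover have "\<forall>t\<in>{0..S + c n}. norm (w t) \<le> R"
  proof
    fix t assume t: "t \<in> {0..S + c n}"
    show "norm (w t) \<le> R"
    proof (cases "t \<le> S")
      case True
      then show ?thesis using R2[of t] t by (simp add: w_def R_def)
    next
      case False
      then have "norm (z n (- S + t)) \<le> norm p + 1" using c[of n] t by simp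
      then show ?thesis using False by (simp add: w_def R_def)
    qed
  qed
  moreover have "w (S + c n) = z n (c n)" using cn by (simp add: w_def)
  ultimately obtain y where y: "regular_solution F 0 (S + c n) y" "y (S + c n) = q"
    "\<forall>t\<in>{0..S + c n}. norm (y t - w t) \<le> e" "e-lipschitz_on {0..S + c n} (\<lambda>t. y t - w t)"
    using tr[of 0 "S + c n" w q] cn x(2) n(2) by (auto simp: norm_minus_commute shadows_def)
  have "e-lipschitz_on {0..S} (\<lambda>t. y t - w t)" by (rule lipschitz_on_subset[OF y(4)]) (use cn in auto)
  then have "e-lipschitz_on {0..S} (\<lambda>t. y t - x t)" by (rule lipschitz_on_transform) (auto simp: w_def)
  moreover have "\<forall>t\<in>{0..S}. norm (y t - x t) \<le> e"
  proof
    fix t assume "t \<in> {0..S}"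
    then show "norm (y t - x t) \<le> e" using bspec[OF y(3), of t] cn by (auto simp: w_def)
  qed
  moreover have "escapes q (\<tau> - c n + e)"
    by (rule escapes_mono[OF \<open>escapes q (\<tau> - \<sigma> + e / 2)\<close>]) (use n(1) in linarith)
  ultimately show ?thesis using y cn q by blast
qed


text \<open>Iterating \<open>escapes_step\<close> with errors \<open>(1/2) ^ n\<close> raises the
  norm of the end point by 1 at each stage, while the end times stay below \<open>\<tau> + 2\<close>
  because the slack granted in total is 2. The errors are summable in the Lipschitz seminorm, so the
  limit \<open>X\<close> is regular on each \<open>{0..S n}\<close>, yet unbounded before the finite
  time \<open>T\<close>.\<close>

lemma escapes_imp_blow_up:
  assumes esc: "escapes p \<tau>"
  obtains x S where "0 < S" "is_solution F (ereal S) x" "\<not> bounded (x ` {0..<S})"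
proof -
  define e :: "nat \<Rightarrow> real" where "e n = (1/2) ^ n" for n
  have e: "e n > 0" "e (Suc n) = e n / 2" for n by (auto simp: e_def)
  have "\<exists>f. \<forall>n. (0 \<le> fst (f n) \<and> regular_solution F 0 (fst (f n)) (fst (snd (f n))) \<and>
      escapes (fst (snd (f n)) (fst (f n))) (snd (snd (f n))) \<and> (n = 0 \<longrightarrow> f n = (0, \<lambda>_. p, \<tau>))) \<and>
    (fst (f n) < fst (f (Suc n)) \<and> fst (f (Suc n)) + snd (snd (f (Suc n))) = fst (f n) + snd (snd (f n)) + e n \<and>
     norm (fst (snd (f (Suc n))) (fst (f (Suc n)))) = norm (fst (snd (f n)) (fst (f n))) + 1 \<and>
     (\<forall>t\<in>{0..fst (f n)}. norm (fst (snd (f (Suc n))) t - fst (snd (f n)) t) \<le> e n) \<and>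
     (e n)-lipschitz_on {0..fst (f n)} (\<lambda>t. fst (snd (f (Suc n))) t - fst (snd (f n)) t))"
  \<comment> \<open>The state consists of an end time, a solution up to it, and the time within
    which its end point escapes. The first and the last add up to a quantity that grows by
    \<open>e n\<close> only.\<close>
  proof (rule dependent_nat_choice)
    show "\<exists>a :: real \<times> (real \<Rightarrow> 'a) \<times> real. 0 \<le> fst a \<and> regular_solution F 0 (fst a) (fst (snd a)) \<and>
      escapes (fst (snd a) (fst a)) (snd (snd a)) \<and> (0 = (0::nat) \<longrightarrow> a = (0, \<lambda>_. p, \<tau>))"
      using esc by (intro exI[of _ "(0, \<lambda>_. p, \<tau>)"]) (auto simp: regular_solution_trivial)
  next
    fix a :: "real \<times> (real \<Rightarrow> 'a) \<times> real" and n :: nat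
    obtain S x \<sigma> where a: "a = (S, x, \<sigma>)" by (cases a) auto
    assume "0 \<le> fst a \<and> regular_solution F 0 (fst a) (fst (snd a)) \<and>
      escapes (fst (snd a) (fst a)) (snd (snd a)) \<and> (n = 0 \<longrightarrow> a = (0, \<lambda>_. p, \<tau>))"
    then have "0 \<le> S" "regular_solution F 0 S x" "escapes (x S) \<sigma>" by (auto simp: a)
    then obtain s q y where "0 < s" "regular_solution F 0 (S + s) y" "y (S + s) = q" "norm q = norm (x S) + 1"
      "escapes q (\<sigma> - s + e n)" "\<forall>t\<in>{0..S}. norm (y t - x t) \<le> e n" "(e n)-lipschitz_on {0..S} (\<lambda>t. y t - x t)"
      using escapes_step[of "x S" \<sigma> S x "e n"] e(1) by blast
    then show "\<exists>b. (0 \<le> fst b \<and> regular_solution F 0 (fst b) (fst (snd b)) \<and>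
      escapes (fst (snd b) (fst b)) (snd (snd b)) \<and> (Suc n = 0 \<longrightarrow> b = (0, \<lambda>_. p, \<tau>))) \<and>
      (fst a < fst b \<and> fst b + snd (snd b) = fst a + snd (snd a) + e n \<and>
       norm (fst (snd b) (fst b)) = norm (fst (snd a) (fst a)) + 1 \<and>
       (\<forall>t\<in>{0..fst a}. norm (fst (snd b) t - fst (snd a) t) \<le> e n) \<and>
       (e n)-lipschitz_on {0..fst a} (\<lambda>t. fst (snd b) t - fst (snd a) t))"
      using \<open>0 \<le> S\<close> by (intro exI[of _ "(S + s, y, \<sigma> - s + e n)"]) (auto simp: a)
  qed
  then obtain f where f: "\<And>n. 0 \<le> fst (f n) \<and> regular_solution F 0 (fst (f n)) (fst (snd (f n))) \<and>
      escapes (fst (snd (f n)) (fst (f n))) (snd (snd (f n))) \<and> (n = 0 \<longrightarrow> f n = (0, \<lambda>_. p, \<tau>))"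
    "\<And>n. fst (f n) < fst (f (Suc n)) \<and> fst (f (Suc n)) + snd (snd (f (Suc n))) = fst (f n) + snd (snd (f n)) + e n \<and>
     norm (fst (snd (f (Suc n))) (fst (f (Suc n)))) = norm (fst (snd (f n)) (fst (f n))) + 1 \<and>
     (\<forall>t\<in>{0..fst (f n)}. norm (fst (snd (f (Suc n))) t - fst (snd (f n)) t) \<le> e n) \<and>
     (e n)-lipschitz_on {0..fst (f n)} (\<lambda>t. fst (snd (f (Suc n))) t - fst (snd (f n)) t)" by blast
  define S x \<sigma> where "S n = fst (f n)" and "x n = fst (snd (f n))" and "\<sigma> n = snd (snd (f n))" for n
  have inv: "0 \<le> S n" "regular_solution F 0 (S n) (x n)" "escapes (x n (S n)) (\<sigma> n)" for n
    using f(1)[of n] unfolding S_def x_def \<sigma>_def by blast+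
  have init: "S 0 = 0" "\<sigma> 0 = \<tau>" using f(1)[of 0] by (auto simp: S_def \<sigma>_def)
  have step: "S n < S (Suc n)" "S (Suc n) + \<sigma> (Suc n) = S n + \<sigma> n + e n"
     "norm (x (Suc n) (S (Suc n))) = norm (x n (S n)) + 1"
     "\<And>t. t\<in>{0..S n} \<Longrightarrow> norm (x (Suc n) t - x n t) \<le> e n"
     "(e n)-lipschitz_on {0..S n} (\<lambda>t. x (Suc n) t - x n t)" for n
    using f(2)[of n] unfolding S_def x_def \<sigma>_def by blast+
  have smono: "strict_mono S" using step(1) by (simp add: strict_mono_Suc_iff)
  have sm: "S m \<le> S n" if "m \<le> n" for m n using smono that by (simp add: strict_mono_less_eq)
  have tot: "S n + \<sigma> n = \<tau> + 2 - 2 * e n" for n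
    by (induction n) (use init step(2) in \<open>auto simp: e_def\<close>)
  \<comment> \<open>Escape times are never negative, so a bound on \<open>S n + \<sigma> n\<close>
    bounds \<open>S n\<close>.\<close>
  have Sb: "S n \<le> \<tau> + 2" for n using tot[of n] escapes_nonneg[OF inv(3), of n] e(1)[of n] by linarith
  define T where "T = (SUP n. S n)"
  have bdd: "bdd_above (range S)" using Sb by (auto intro!: bdd_aboveI)
  have ST: "S n < T" for n
    using step(1)[of n] cSUP_upper[OF _ bdd, of "Suc n"] unfolding T_def by auto
  have exS: "\<exists>n. t < S n" if "t < T" for t
    using that less_cSUP_iff[OF _ bdd] unfolding T_def by auto
  have T: "0 < T" using ST[of 0] init by simp
  have far: "norm (x n (S n)) = norm (x 0 (S 0)) + real n" for n
    by (induction n) (use step(3) in auto)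
  have diff: "norm (x m t - x n t) \<le> 2 * e n - 2 * e m" if "n \<le> m" "t \<in> {0..S n}" for m n t
    using that(1)
  proof (induction m rule: dec_induct)
    case (step m)
    have "t \<in> {0..S m}" using sm[OF step.hyps(1)] that(2) by auto
    then show ?case using norm_triangle_ineq[of "x (Suc m) t - x m t" "x m t - x n t"]
        \<open>\<And>n t. t \<in> {0..S n} \<Longrightarrow> norm (x (Suc n) t - x n t) \<le> e n\<close>[of t m] step.IH e(2)[of m] by simp
  qed simp
  have dlip: "(2 * e n - 2 * e m)-lipschitz_on {0..S n} (\<lambda>t. x m t - x n t)" if "n \<le> m" for m n
    using that
  proof (induction m rule: dec_induct)
    case base then show ?case by (simp add: lipschitz_on_def)
  next
    case (step m)
    have "(e m)-lipschitz_on {0..S n} (\<lambda>t. x (Suc m) t - x m t)"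
      by (rule lipschitz_on_subset[OF \<open>\<And>n. (e n)-lipschitz_on {0..S n} (\<lambda>t. x (Suc n) t - x n t)\<close>])
        (use sm[OF step.hyps(1)] in auto)
    moreover have "e m + (2 * e n - 2 * e m) = 2 * e n - 2 * e (Suc m)" using e(2)[of m] by simp
    ultimately show ?case using lipschitz_on_add[OF _ step.IH, of "e m"] by fastforce
  qed
  define X where "X t = lim (\<lambda>n. x n t)" for t
  have e0: "e \<longlonglongrightarrow> 0" unfolding e_def by (rule LIMSEQ_power_zero) simp
  have conv: "(\<lambda>n. x n t) \<longlonglongrightarrow> X t" if t: "0 \<le> t" "t < T" for t
  proof -
    obtain N where N: "t < S N" using exS t by blast
    have "Cauchy (\<lambda>n. x n t)"
    proof (rule CauchyI')
      fix d :: real assume "d > 0"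
      then obtain M where M: "\<And>n. n \<ge> M \<Longrightarrow> \<bar>e n\<bar> < d / 2"
        using LIMSEQ_D[OF e0, of "d/2"] by auto
      have "norm (x m t - x n t) < d" if "m \<ge> max M N" "n > m" for m n
      proof -
        have "t \<in> {0..S m}" using sm[of N m] N t that by auto
        then have "norm (x n t - x m t) \<le> 2 * e m - 2 * e n" using diff[of m n t] that by simp
        then show ?thesis using M[of m] that e(1)[of n] by (simp add: norm_minus_commute)
      qed
      then show "\<exists>M. \<forall>m\<ge>M. \<forall>n>m. dist (x m t) (x n t) < d"
        by (intro exI[of _ "max M N"]) (auto simp: dist_norm)
    qed
    then show ?thesis unfolding X_def by (simp add: Cauchy_convergent_iff convergent_LIMSEQ_iff)
  qed
  have Xd: "norm (X t - x n t) \<le> 2 * e n" if t: "t \<in> {0..S n}" for t n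
  proof (rule LIMSEQ_le_const2)
    show "(\<lambda>m. norm (x m t - x n t)) \<longlonglongrightarrow> norm (X t - x n t)"
      by (intro tendsto_intros conv) (use t ST[of n] in auto)
    have "norm (x m t - x n t) \<le> 2 * e n" if "m \<ge> n" for m
      using diff[OF that t] e(1)[of m] by simp
    then show "\<exists>N. \<forall>m\<ge>N. norm (x m t - x n t) \<le> 2 * e n" by blast
  qed
  have Xl: "(2 * e n)-lipschitz_on {0..S n} (\<lambda>t. X t - x n t)" for n
  proof (rule lipschitz_onI)
    fix s t assume st: "s \<in> {0..S n}" "t \<in> {0..S n}"
    have "(\<lambda>m. dist (x m s - x n s) (x m t - x n t)) \<longlonglongrightarrow> dist (X s - x n s) (X t - x n t)"
      by (intro tendsto_intros conv) (use st ST[of n] in auto)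
    moreover have "dist (x m s - x n s) (x m t - x n t) \<le> 2 * e n * dist s t" if "m \<ge> n" for m
    proof -
      have "(2 * e n)-lipschitz_on {0..S n} (\<lambda>t. x m t - x n t)"
        by (rule lipschitz_on_mono[OF dlip[OF that]]) (use e(1)[of m] in auto)
      then show ?thesis using st by (rule lipschitz_onD)
    qed
    ultimately show "dist (X s - x n s) (X t - x n t) \<le> 2 * e n * dist s t"
      by (intro LIMSEQ_le_const2) auto
  qed (use e(1)[of n] in simp)
  have reg: "regular_solution F 0 (S N) X" for N
  proof (rule regular_solution_limit)
    fix d :: real assume d: "d > 0"
    then obtain M where M: "\<And>n. n \<ge> M \<Longrightarrow> \<bar>e n\<bar> < d / 2"
      using LIMSEQ_D[OF e0, of "d/2"] by auto
    define n where "n = max M N"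
    have n: "2 * e n \<le> d" "S N \<le> S n" using M[of n] sm[of N n] by (auto simp: n_def)
    have "regular_solution F 0 (S N) (x n)"
      by (rule regular_solution_subinterval[OF inv(2)[of n]]) (use n in auto)
    moreover have "d-lipschitz_on {0..S N} (\<lambda>s. X s - x n s)"
      by (rule lipschitz_on_mono[OF Xl _ n(1)]) (use n in auto)
    moreover have "norm (X t - x n t) \<le> d" if "t \<in> {0..S N}" for t
      using Xd[of t n] n that by force
    ultimately show "\<exists>y. regular_solution F 0 (S N) y \<and> d-lipschitz_on {0..S N} (\<lambda>s. X s - y s) \<and>
        (\<forall>t\<in>{0..S N}. norm (X t - y t) \<le> d)" by blast
  qed
  have "is_solution F (ereal T) X"
  proof (rule regular_solution_is_solution)
    fix b assume "0 \<le> b" "ereal b < ereal T"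
    then obtain N where "b < S N" using exS by auto
    then show "regular_solution F 0 b X" by (intro regular_solution_subinterval[OF reg[of N]]) auto
  qed (use T in simp)
  moreover have "\<not> bounded (X ` {0..<T})"
  proof
    assume "bounded (X ` {0..<T})"
    then obtain M where "\<forall>t\<in>{0..<T}. norm (X t) \<le> M" unfolding bounded_iff by blast
    then have M: "\<And>t. 0 \<le> t \<Longrightarrow> t < T \<Longrightarrow> norm (X t) \<le> M" by simp
    \<comment> \<open>At time \<open>S n\<close> the limit differs from \<open>x n\<close> by at
      most \<open>2 * e n \<le> 2\<close>, whereas \<open>norm (x n (S n))\<close> is at least
      \<open>n\<close>.\<close>
    obtain n :: nat where n: "real n > M + 2" using reals_Archimedean2 by blast
    have "e n \<le> 1" by (simp add: e_def power_le_one)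
    then have "norm (x n (S n)) \<le> M + 2"
      using M[of "S n"] inv(1)[of n] ST[of n] Xd[of "S n" n] norm_triangle_sub[of "x n (S n)" "X (S n)"]
      by (simp add: norm_minus_commute)
    then show False using far[of n] n norm_ge_zero[of "x 0 (S 0)"] by linarith
  qed
  ultimately show thesis using that T by blast
qed

text \<open>By forward completeness a solution on \<open>{0..<S}\<close> extends past
  \<open>S\<close>, and continuity bounds it up to \<open>S\<close>; so no point escapes. Uniformity
  over a ball of starting points follows from a convergent subsequence of starts and
  \<open>escapes_limit\<close>.\<close>

lemma bounded_reachable_set:
  assumes fc: "forward_complete F"
  obtains R' where "\<And>x s. regular_solution F 0 s x \<Longrightarrow> 0 \<le> s \<Longrightarrow> s \<le> T \<Longrightarrow> norm (x 0) \<le> R \<Longrightarrow> norm (x s) \<le> R'"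
proof -
  have no_escape: False if "escapes p \<tau>" for p \<tau>
  proof -
    obtain x S where x: "0 < S" "is_solution F (ereal S) x" "\<not> bounded (x ` {0..<S})"
      using escapes_imp_blow_up[OF \<open>escapes p \<tau>\<close>] by blast
    have "\<not> maximal_solution F (ereal S) x" using fc unfolding forward_complete_def by fastforce
    then obtain T' x' where T': "ereal S < T'" "is_solution F T' x'" "\<And>t. 0 \<le> t \<Longrightarrow> t < S \<Longrightarrow> x' t = x t"
      using x(2) unfolding maximal_solution_def by auto
    then have "absolutely_continuous_on 0 S x'" using x(1) unfolding is_solution_def by auto
    then have "bounded (x' ` {0..S})"
      by (intro compact_imp_bounded compact_continuous_image absolutely_continuous_on_imp_continuous_on) auto
    moreover have "x ` {0..<S} \<subseteq> x' ` {0..S}" using T'(3) by force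
    ultimately show False using x(3) bounded_subset by blast
  qed
  have "\<exists>R'. \<forall>x s. regular_solution F 0 s x \<and> 0 \<le> s \<and> s \<le> T \<and> norm (x 0) \<le> R \<longrightarrow> norm (x s) \<le> R'"
  proof (rule ccontr)
    assume "\<nexists>R'. \<forall>x s. regular_solution F 0 s x \<and> 0 \<le> s \<and> s \<le> T \<and> norm (x 0) \<le> R \<longrightarrow> norm (x s) \<le> R'"
    then have "\<forall>k::nat. \<exists>x s. regular_solution F 0 s x \<and> 0 \<le> s \<and> s \<le> T \<and> norm (x 0) \<le> R \<and> real k < norm (x s)"
      by (meson not_le)
    then obtain x s where x: "\<And>k::nat. regular_solution F 0 (s k) (x k) \<and> 0 \<le> s k \<and> s k \<le> T \<and>
        norm (x k 0) \<le> R \<and> real k < norm (x k (s k))" by metis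
    have "compact (cball (0::'a) R)" by simp
    moreover have "\<forall>k. x k 0 \<in> cball 0 R" using x by simp
    ultimately obtain p r where r: "strict_mono r" "((\<lambda>k. x k 0) \<circ> r) \<longlonglongrightarrow> p"
      unfolding compact_def by meson
    have "escapes p T"
    proof (rule escapes_limit[where s = "s \<circ> r" and z = "x \<circ> r"])
      fix k
      have "real k \<le> real (r k)" using seq_suble[OF r(1)] by simp
      then show "0 \<le> (s \<circ> r) k \<and> (s \<circ> r) k \<le> T \<and> regular_solution F 0 ((s \<circ> r) k) ((x \<circ> r) k) \<and>
          real k < norm ((x \<circ> r) k ((s \<circ> r) k))" using x[of "r k"] by auto
    qed (use r(2) in \<open>simp add: o_def\<close>)
    then show False by (rule no_escape)
  qed
  then show thesis using that by blast
qed

text \<open>The bound \<open>R'\<close> on genuine solutions permits a truncation radius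
  \<open>R > R'\<close>. Until the truncated solution first reaches radius \<open>R\<close> it is
  genuine, so it never gets there.\<close>

lemma regular_solution_unit_interval:
  assumes fc: "forward_complete F"
  shows "\<exists>x. regular_solution F a (a + 1) x \<and> x a = p"
proof -
  obtain R' where R': "\<And>x s. regular_solution F 0 s x \<Longrightarrow> 0 \<le> s \<Longrightarrow> s \<le> 1 \<Longrightarrow> norm (x 0) \<le> norm p \<Longrightarrow> norm (x s) \<le> R'"
    using bounded_reachable_set[OF fc, of 1 "norm p"] by blast
  define R where "R = \<bar>R'\<bar> + norm p + 1"
  have R: "0 \<le> R" "norm p < R" "R' < R" using norm_ge_zero[of p] unfolding R_def by linarith+
  obtain L B where G: "lipschitz_inclusion (truncated F R) L B"
    using lipschitz_inclusion_truncated[OF F_lip F_compact F_nonempty R(1)] by blast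
  obtain v where v: "v \<in> truncated F R p" using lipschitz_inclusionD(3)[OF G] by blast
  obtain x where x: "x 0 = p" "regular_solution (truncated F R) 0 1 x"
    using lipschitz_inclusion_solution[OF G v, of 0] by blast
  have tr: "regular_solution F 0 c x" if "c \<le> 1" "\<And>t. t \<in> {0..c} \<Longrightarrow> norm (x t) \<le> R" for c
  proof (rule regular_solution_mono)
    show "regular_solution (truncated F R) 0 c x"
      by (rule regular_solution_subinterval[OF x(2)]) (use that in auto)
    show "truncated F R (x t) \<subseteq> F (x t)" if "t \<in> {0..c}" for t
      using \<open>\<And>t. t \<in> {0..c} \<Longrightarrow> norm (x t) \<le> R\<close>[OF that] by (simp add: truncated_eq)
  qed
  have "norm (x t) \<le> R" if t: "t \<in> {0..1}" for t
  proof (rule ccontr)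
    assume "\<not> norm (x t) \<le> R"
    moreover have "continuous_on {0..t} x"
      by (rule continuous_on_subset[OF regular_solution_continuous[OF x(2)]]) (use t in auto)
    ultimately obtain c where c: "0 < c" "c \<le> t" "norm (x c) = R" "\<And>s. 0 \<le> s \<Longrightarrow> s \<le> c \<Longrightarrow> norm (x s) \<le> R"
      using first_exit[of 0 t x R] x(1) R t by auto
    have "regular_solution F 0 c x" by (rule tr) (use c t in auto)
    then show False using R'[of c x] c t x(1) R by auto
  qed
  then have "regular_solution F 0 1 x" by (intro tr) auto
  from regular_solution_shift[OF this, of "-a"]
  have "regular_solution F a (a + 1) (\<lambda>s. x (- a + s))" by (simp add: add.commute)
  then show ?thesis using x(1) by (intro exI[of _ "\<lambda>s. x (- a + s)"]) auto
qed

text \<open>MES speaks of maximal solutions only; this continuation makes it applicable to a regular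
  solution on a finite interval.\<close>

lemma regular_solution_extend:
  assumes fc: "forward_complete F" and x: "regular_solution F 0 t x" "0 \<le> t"
  obtains y where "\<And>s. s \<le> t \<Longrightarrow> y s = x s" "maximal_solution F \<infinity> y" "\<And>b. regular_solution F 0 b y"
proof -
  have "\<exists>f. \<forall>n. (regular_solution F 0 (t + real n) (f n) \<and> (n = 0 \<longrightarrow> f n = x)) \<and>
      (\<forall>s\<le>t + real n. f (Suc n) s = f n s)"
  proof (rule dependent_nat_choice)
    fix g and n :: nat assume g: "regular_solution F 0 (t + real n) g \<and> (n = 0 \<longrightarrow> g = x)"
    obtain h where h: "regular_solution F (t + real n) (t + real n + 1) h" "h (t + real n) = g (t + real n)"
      using regular_solution_unit_interval[OF fc] by blast
    have "regular_solution F 0 (t + real n + 1) (\<lambda>s. if s \<le> t + real n then g s else h s)"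
      by (rule regular_solution_concat[OF _ h(1)]) (use g h(2) x(2) in auto)
    then show "\<exists>k. (regular_solution F 0 (t + real (Suc n)) k \<and> (Suc n = 0 \<longrightarrow> k = x)) \<and> (\<forall>s\<le>t + real n. k s = g s)"
      by (intro exI[of _ "\<lambda>s. if s \<le> t + real n then g s else h s"]) (auto simp: add_ac)
  qed (use x in auto)
  then obtain f where f: "\<And>n. regular_solution F 0 (t + real n) (f n)" "f 0 = x"
    "\<And>n s. s \<le> t + real n \<Longrightarrow> f (Suc n) s = f n s" by blast
  have agree: "f m s = f n s" if "n \<le> m" "s \<le> t + real n" for m n s
    using that(1)
  proof (induction m rule: dec_induct)
    case (step m)
    then show ?case using f(3)[of s m] that(2) by simp
  qed simp
  \<comment> \<open>\<open>nat \<lceil>s - t\<rceil>\<close> is the first stage whose interval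
    contains \<open>s\<close>; later stages agree with it there.\<close>
  define y where "y s = f (nat \<lceil>s - t\<rceil>) s" for s
  have y: "y s = f n s" if "s \<le> t + real n" for s n
  proof -
    have "nat \<lceil>s - t\<rceil> \<le> n" using that by linarith
    moreover have "s \<le> t + real (nat \<lceil>s - t\<rceil>)" by linarith
    ultimately show ?thesis unfolding y_def using agree by metis
  qed
  have reg: "regular_solution F 0 b y" for b
  proof -
    obtain n :: nat where "b - t \<le> real n" using real_arch_simple by blast
    then show ?thesis by (intro regular_solution_subinterval[OF f(1)[of n]]) (use y[of _ n] in auto)
  qed
  have "is_solution F \<infinity> y" by (rule regular_solution_is_solution[OF reg]) simp
  then have "maximal_solution F \<infinity> y" unfolding maximal_solution_def by auto
  then show thesis using that[of y] y[of _ 0] f(2) reg by simp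
qed

end

section \<open>Decrease along solutions of a lower semicontinuous function\<close>

lemma absolutely_continuous_on_dominated:
  assumes x: "absolutely_continuous_on a b x" and C: "0 \<le> C"
    and le: "\<And>u v. a \<le> u \<Longrightarrow> u \<le> v \<Longrightarrow> v \<le> b \<Longrightarrow> norm (\<phi> v - \<phi> u) \<le> C * (norm (x v - x u) + (v - u))"
  shows "absolutely_continuous_on a b \<phi>"
  unfolding absolutely_continuous_on_def
proof (intro allI impI)
  fix e :: real assume e: "e > 0"
  define e' where "e' = (e / (C + 1)) / 2"
  have e': "e' > 0" using e C by (simp add: e'_def)
  obtain d where d: "d > 0" "\<forall>D. finite D \<and> (\<forall>(u, v)\<in>D. a \<le> u \<and> u \<le> v \<and> v \<le> b) \<and>
      disjoint_family_on (\<lambda>(u, v). {u<..<v}) D \<and> (\<Sum>(u, v)\<in>D. v - u) < d \<longrightarrow>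
      (\<Sum>(u, v)\<in>D. norm (x v - x u)) < e'"
    using x e' unfolding absolutely_continuous_on_def by blast
  show "\<exists>\<delta>>0. \<forall>D. finite D \<and> (\<forall>(u, v)\<in>D. a \<le> u \<and> u \<le> v \<and> v \<le> b) \<and>
      disjoint_family_on (\<lambda>(u, v). {u<..<v}) D \<and> (\<Sum>(u, v)\<in>D. v - u) < \<delta> \<longrightarrow>
      (\<Sum>(u, v)\<in>D. norm (\<phi> v - \<phi> u)) < e"
  proof (intro exI[of _ "min d e'"] conjI allI impI)
    fix D assume D: "finite D \<and> (\<forall>(u, v)\<in>D. a \<le> u \<and> u \<le> v \<and> v \<le> b) \<and>
      disjoint_family_on (\<lambda>(u, v). {u<..<v}) D \<and> (\<Sum>(u, v)\<in>D. v - u) < min d e'"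
    then have xD: "(\<Sum>(u, v)\<in>D. norm (x v - x u)) < e'" using spec[OF d(2), of D] by simp
    have "(\<Sum>(u, v)\<in>D. norm (\<phi> v - \<phi> u)) \<le> (\<Sum>(u, v)\<in>D. (C + 1) * (norm (x v - x u) + (v - u)))"
    proof (rule sum_mono)
      fix p assume "p \<in> D"
      then have p: "a \<le> fst p" "fst p \<le> snd p" "snd p \<le> b" using D by auto
      then have "C * (norm (x (snd p) - x (fst p)) + (snd p - fst p))
          \<le> (C + 1) * (norm (x (snd p) - x (fst p)) + (snd p - fst p))"
        by (intro mult_right_mono) auto
      then show "(case p of (u, v) \<Rightarrow> norm (\<phi> v - \<phi> u)) \<le> (case p of (u, v) \<Rightarrow> (C + 1) * (norm (x v - x u) + (v - u)))"
        using le[OF p] by (simp add: split_def)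
    qed
    also have "\<dots> = (C + 1) * ((\<Sum>(u, v)\<in>D. norm (x v - x u)) + (\<Sum>(u, v)\<in>D. v - u))"
      unfolding split_def sum.distrib[symmetric] sum_distrib_left[symmetric] by simp
    also have "\<dots> < (C + 1) * (e' + e')"
      using xD D C by (intro mult_strict_left_mono add_strict_mono) auto
    also have "e' + e' = e / (C + 1)" unfolding e'_def by (rule field_sum_of_halves)
    also have "(C + 1) * \<dots> = e" using C by simp
    finally show "(\<Sum>(u, v)\<in>D. norm (\<phi> v - \<phi> u)) < e" .
  qed (use d e' in auto)
qed

text \<open>On the exceptional null set the growth of \<open>\<phi>\<close> is paid for by its variation \<open>G\<close> over an open
  superset \<open>W\<close> of small measure.\<close>

lemma absolutely_continuous_on_dini_decreasing:
  fixes \<phi> :: "real \<Rightarrow> real"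
  assumes ac: "absolutely_continuous_on a b \<phi>" and ab: "a \<le> b" and N: "N \<in> null_sets lebesgue"
    and dini: "\<And>s e. a \<le> s \<Longrightarrow> s < b \<Longrightarrow> s \<notin> N \<Longrightarrow> e > 0 \<Longrightarrow>
      \<exists>d>0. \<forall>r. s < r \<and> r < s + d \<and> r \<le> b \<longrightarrow> \<phi> r - \<phi> s \<le> e * (r - s)"
  shows "\<phi> b \<le> \<phi> a"
proof -
  have main: "\<phi> b \<le> \<phi> a + e * (b - a) + e" if e: "e > 0" for e
  proof -
    obtain \<delta> where \<delta>: "\<delta> > 0" "\<forall>D. finite D \<and> (\<forall>(u, v)\<in>D. a \<le> u \<and> u \<le> v \<and> v \<le> b) \<and>
      disjoint_family_on (\<lambda>(u, v). {u<..<v}) D \<and> (\<Sum>(u, v)\<in>D. v - u) < \<delta> \<longrightarrow>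
      (\<Sum>(u, v)\<in>D. norm (\<phi> v - \<phi> u)) < e"
      using ac e unfolding absolutely_continuous_on_def by blast
    have "N \<in> sets lebesgue" using N by auto
    then obtain W where W: "open W" "N \<subseteq> W" "W - N \<in> lmeasurable" "emeasure lebesgue (W - N) < ennreal \<delta>"
      using sets_lebesgue_outer_open[OF _ \<delta>(1)] by blast
    have "emeasure lebesgue W = emeasure lebesgue (W - N)"
      using emeasure_Diff_null_set[OF N, of W] W(1) by auto
    then have Wd: "emeasure lebesgue W < ennreal \<delta>" using W(4) by simp
    \<comment> \<open>Finite families of nonoverlapping intervals inside \<open>W\<close> up to time
      \<open>s\<close>. The supremum \<open>G s\<close> of the sums \<open>var\<close> is the
      variation of \<open>\<phi>\<close> on this part of \<open>W\<close>; absolute continuity keeps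
      it at most \<open>e\<close> because \<open>W\<close> has measure below
      \<open>\<delta>\<close>.\<close>
    define \<D> where "\<D> s = {D. finite D \<and> (\<forall>(u, v)\<in>D. a \<le> u \<and> u \<le> v \<and> v \<le> s \<and> {u..v} \<subseteq> W) \<and>
      disjoint_family_on (\<lambda>(u, v). {u<..<v}) D}" for s :: real
    define var where "var D = (\<Sum>(u, v)\<in>D. norm (\<phi> v - \<phi> u))" for D
    have small: "var D < e" if D: "D \<in> \<D> s" "s \<le> b" for D s
    proof -
      have D': "finite D" "\<And>u v. (u, v) \<in> D \<Longrightarrow> a \<le> u \<and> u \<le> v \<and> v \<le> s \<and> {u..v} \<subseteq> W"
        "disjoint_family_on (\<lambda>(u, v). {u<..<v}) D" using D(1) unfolding \<D>_def by auto
      have "ennreal (\<Sum>(u, v)\<in>D. v - u) = (\<Sum>p\<in>D. ennreal (snd p - fst p))"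
        using D'(2) by (subst sum_ennreal) (auto simp: split_def)
      also have "\<dots> = (\<Sum>p\<in>D. emeasure lebesgue ((\<lambda>(u, v). {u<..<v}) p))"
        using D'(2) by (intro sum.cong) (auto simp: split_def)
      also have "\<dots> = emeasure lebesgue (\<Union>p\<in>D. (\<lambda>(u, v). {u<..<v}) p)"
        using D' by (intro sum_emeasure) auto
      also have "\<dots> \<le> emeasure lebesgue W"
      proof (rule emeasure_mono)
        show "(\<Union>p\<in>D. (\<lambda>(u, v). {u<..<v}) p) \<subseteq> W" using D'(2) by fastforce
      qed (use W(1) in auto)
      also note Wd
      finally have "(\<Sum>(u, v)\<in>D. v - u) < \<delta>"
        using D'(2) by (subst (asm) ennreal_less_iff) (auto intro!: sum_nonneg simp: split_def)
      moreover have "\<forall>(u, v)\<in>D. a \<le> u \<and> u \<le> v \<and> v \<le> b" using D'(2) D(2) by force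
      ultimately show ?thesis using spec[OF \<delta>(2), of D] D'(1,3) unfolding var_def by blast
    qed
    define G where "G s = (SUP D\<in>\<D> s. var D)" for s
    have emp: "{} \<in> \<D> s" for s by (auto simp: \<D>_def disjoint_family_on_def)
    have bdd: "bdd_above (var ` \<D> s)" if "s \<le> b" for s
      using small[OF _ that] by (auto intro!: bdd_aboveI[of _ e] less_imp_le)
    have up: "var D \<le> G s" if "D \<in> \<D> s" "s \<le> b" for D s
      unfolding G_def by (rule cSUP_upper[OF that(1) bdd[OF that(2)]])
    have G0: "0 \<le> G s" if "s \<le> b" for s using up[OF emp that] by (simp add: var_def)
    have Ge: "G s \<le> e" if "s \<le> b" for s
      unfolding G_def by (rule cSUP_least) (use emp small[OF _ that] less_imp_le in blast)+
    have Gmono: "G s \<le> G r" if "s \<le> r" "r \<le> b" for s r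
      unfolding G_def
    proof (rule cSUP_subset_mono)
      show "\<D> s \<subseteq> \<D> r" using that(1) unfolding \<D>_def by force
    qed (use emp bdd[OF that(2)] in auto)
    \<comment> \<open>\<open>c = Sup S\<close> belongs to \<open>S\<close> since
      \<open>\<phi>\<close> is continuous and \<open>G\<close> monotone, and it equals
      \<open>b\<close> since the bound can be carried past any \<open>c < b\<close>: by the Dini
      hypothesis if \<open>c\<close> is outside \<open>N\<close>, and otherwise by inserting a short
      interval \<open>(c, r)\<close> into every family, which raises \<open>G\<close> by at least
      \<open>norm (\<phi> r - \<phi> c)\<close>.\<close>
    define S where "S = {s\<in>{a..b}. \<phi> s \<le> \<phi> a + e * (s - a) + G s}"
    define c where "c = Sup S"
    have aS: "a \<in> S" using ab G0[OF ab] by (simp add: S_def)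
    have Sb: "bdd_above S" unfolding S_def by (auto intro!: bdd_aboveI[of _ b])
    have cab: "a \<le> c" "c \<le> b"
    proof -
      show "a \<le> c" unfolding c_def by (rule cSup_upper[OF aS Sb])
      show "c \<le> b" unfolding c_def by (rule cSup_least) (use aS in \<open>auto simp: S_def\<close>)
    qed
    have cS: "\<phi> c \<le> \<phi> a + e * (c - a) + G c"
    proof (rule field_le_epsilon)
      fix \<eta> :: real assume "\<eta> > 0"
      then obtain d where d: "d > 0" "\<And>s. s \<in> {a..b} \<Longrightarrow> dist s c < d \<Longrightarrow> dist (\<phi> s) (\<phi> c) < \<eta>"
        using absolutely_continuous_on_imp_continuous_on[OF ac] cab unfolding continuous_on_iff
        by (metis atLeastAtMost_iff)
      obtain s where s: "s \<in> S" "c - d < s"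
        using less_cSup_iff[of S "c - d"] aS Sb d(1) unfolding c_def by auto
      have sc: "s \<le> c" using cSup_upper[OF s(1) Sb] unfolding c_def .
      have "\<phi> s \<le> \<phi> a + e * (s - a) + G s" "s \<in> {a..b}" using s(1) by (auto simp: S_def)
      moreover have "dist (\<phi> s) (\<phi> c) < \<eta>" using d(2)[of s] s sc by (auto simp: S_def dist_real_def)
      moreover have "G s \<le> G c" by (rule Gmono[OF sc cab(2)])
      moreover have "e * (s - a) \<le> e * (c - a)" using sc e by simp
      ultimately show "\<phi> c \<le> \<phi> a + e * (c - a) + G c + \<eta>" unfolding dist_real_def by linarith
    qed
    have "c = b"
    proof (rule ccontr)
      assume "c \<noteq> b"
      then have cb: "c < b" using cab by simp
      have "\<exists>r>c. r \<le> b \<and> \<phi> r - \<phi> c \<le> e * (r - c) + (G r - G c)"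
      proof (cases "c \<in> N")
        case False
        then obtain d where d: "d > 0" "\<And>r. c < r \<Longrightarrow> r < c + d \<Longrightarrow> r \<le> b \<Longrightarrow> \<phi> r - \<phi> c \<le> e * (r - c)"
          using dini[OF cab(1) cb _ e] by blast
        define r where "r = min b (c + d / 2)"
        have r: "c < r" "r < c + d" "r \<le> b" using cb d(1) by (auto simp: r_def)
        have "G c \<le> G r" by (rule Gmono) (use r in auto)
        then show ?thesis using d(2)[OF r] r by (intro exI[of _ r]) auto
      next
        case True
        then obtain d where d: "d > 0" "ball c d \<subseteq> W" using W openE by blast
        define r where "r = min b (c + d / 2)"
        have r: "c < r" "r < c + d" "r \<le> b" using cb d(1) by (auto simp: r_def)
        have crW: "{c..r} \<subseteq> W" using d(2) r by (force simp: dist_real_def)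
        have "G c \<le> G r - norm (\<phi> r - \<phi> c)"
          unfolding G_def[of c]
        proof (rule cSUP_least)
          fix D assume D: "D \<in> \<D> c"
          have nin: "(c, r) \<notin> D" using D r(1) unfolding \<D>_def by force
          have "insert (c, r) D \<in> \<D> r"
            using D r(1) cab(1) crW nin unfolding \<D>_def disjoint_family_on_def by fastforce
          moreover have "var (insert (c, r) D) = norm (\<phi> r - \<phi> c) + var D"
            unfolding var_def using nin D by (subst sum.insert) (auto simp: \<D>_def)
          ultimately show "var D \<le> G r - norm (\<phi> r - \<phi> c)" using up[of "insert (c, r) D" r] r(3) by simp
        qed (use emp in auto)
        moreover have "0 \<le> e * (r - c)" using e r by simp
        ultimately show ?thesis using r by (intro exI[of _ r]) (auto simp: abs_le_iff)
      qed
      then obtain r where r: "c < r" "r \<le> b" "\<phi> r - \<phi> c \<le> e * (r - c) + (G r - G c)" by blast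
      then have "\<phi> r \<le> \<phi> a + e * (r - a) + G r" using cS by (simp add: algebra_simps)
      then have "r \<in> S" using r cab by (simp add: S_def)
      then show False using cSup_upper[OF _ Sb] r(1) unfolding c_def by fastforce
    qed
    then show ?thesis using cS Ge[of b] by simp
  qed
  show ?thesis
  proof (rule field_le_epsilon)
    fix e :: real assume e: "e > 0"
    define e' where "e' = e / (b - a + 1)"
    have e': "e' > 0" using e ab by (simp add: e'_def)
    have "e' * (b - a) + e' = e' * (b - a + 1)" by (simp add: algebra_simps)
    also have "\<dots> = e" using ab by (simp add: e'_def)
    finally show "\<phi> b \<le> \<phi> a + e" using main[OF e'] by linarith
  qed
qed

section \<open>Penalised minima and subgradients\<close>

lemma lower_semicontinuous_attains_inf:
  fixes V :: "'a::metric_space \<Rightarrow> real"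
  assumes V: "lower_semicontinuous V" and K: "compact K" "K \<noteq> {}" and nn: "\<And>y. 0 \<le> V y"
  shows "\<exists>y\<in>K. \<forall>z\<in>K. V y \<le> V z"
proof -
  define m where "m = Inf (V ` K)"
  have bdd: "bdd_below (V ` K)" using nn by (auto intro!: bdd_belowI[of _ 0])
  have "\<exists>y\<in>K. V y < m + 1 / real (Suc n)" for n
    using cInf_lessD[of "V ` K" "m + 1 / real (Suc n)"] K(2) unfolding m_def by auto
  then obtain y where y: "\<And>n. y n \<in> K" "\<And>n. V (y n) < m + 1 / real (Suc n)" by metis
  obtain l r where l: "l \<in> K" "strict_mono r" "(y \<circ> r) \<longlonglongrightarrow> l"
    using K(1) y(1) unfolding compact_def by meson
  have "V l \<le> m"
  proof (rule ccontr)
    assume "\<not> V l \<le> m"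
    define c where "c = (m + V l) / 2"
    have c: "m < c" "c < V l" using \<open>\<not> V l \<le> m\<close> by (auto simp: c_def)
    have "\<forall>\<^sub>F z in nhds l. c < V z" using V c(2) unfolding lower_semicontinuous_def by blast
    then have "\<forall>\<^sub>F n in sequentially. c < V ((y \<circ> r) n)" by (rule eventually_compose_filterlim[OF _ l(3)])
    then have "\<forall>\<^sub>F n in sequentially. c < V (y (r n))" by (simp add: o_def)
    moreover have "\<forall>\<^sub>F n in sequentially. m + 1 / real (Suc n) < c"
    proof -
      have "(\<lambda>n. m + 1 / real (Suc n)) \<longlonglongrightarrow> m + 0"
        by (intro tendsto_intros LIMSEQ_Suc[OF lim_1_over_n])
      then show ?thesis using c(1) by (intro order_tendstoD(2)[of _ m]) auto
    qed
    then have "\<forall>\<^sub>F n in sequentially. m + 1 / real (Suc (r n)) < c"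
      using filterlim_subseq[OF l(2)] eventually_compose_filterlim by blast
    ultimately obtain n where "c < V (y (r n))" "m + 1 / real (Suc (r n)) < c"
      using eventually_happens[OF eventually_conj] by fastforce
    then show False using y(2)[of "r n"] by linarith
  qed
  then show ?thesis using l(1) cInf_lower[OF _ bdd] unfolding m_def by (meson image_eqI order_trans)
qed

lemma abs_exp_minus_diff_le:
  fixes p q :: real
  assumes "0 \<le> p" "0 \<le> q"
  shows "\<bar>exp (- p) - exp (- q)\<bar> \<le> \<bar>p - q\<bar>"
proof -
  have *: "exp (- p) - exp (- q) \<le> q - p" "0 \<le> exp (- p) - exp (- q)" if "0 \<le> p" "p \<le> q" for p q :: real
  proof -
    have "exp (- p) - exp (- q) = exp (- p) * (1 - exp (p - q))" by (simp add: algebra_simps flip: exp_add)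
    also have "1 - exp (p - q) \<le> q - p" using exp_ge_add_one_self[of "p - q"] by linarith
    then have "exp (- p) * (1 - exp (p - q)) \<le> 1 * (q - p)"
      using that by (intro mult_mono) auto
    finally show "exp (- p) - exp (- q) \<le> q - p" by simp
    show "0 \<le> exp (- p) - exp (- q)" using that by simp
  qed
  show ?thesis using *[of p q] *[of q p] assms by (cases "p \<le> q") auto
qed

text \<open>Minimality says that \<open>V\<close> lies above a downward paraboloid touching it at
  \<open>y\<close>; the gradient of the paraboloid there is the subgradient, with remainder
  \<open>- c * (norm k)\<^sup>2\<close>. The subdifferential may be empty at a given point, but
  never at such a minimiser.\<close>

lemma viscosity_subdiff_quadratic:
  fixes V :: "'a::real_inner \<Rightarrow> real"
  assumes "open W" "y \<in> W"
    and min: "\<And>z. z \<in> W \<Longrightarrow> V y + c * (norm (x - y))\<^sup>2 \<le> V z + c * (norm (x - z))\<^sup>2"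
  shows "(2 * c) *\<^sub>R (x - y) \<in> viscosity_subdiff V y"
  unfolding viscosity_subdiff_def
proof (intro CollectI exI conjI ballI)
  have "((\<lambda>k :: 'a. norm k) \<longlongrightarrow> norm (0::'a)) (at 0)" by (rule tendsto_norm[OF tendsto_ident_at])
  from tendsto_mult[OF tendsto_const[of "- c"] this]
  have "((\<lambda>k :: 'a. - c * norm k) \<longlongrightarrow> 0) (at 0)" by (simp only: norm_zero mult_zero_right)
  then show "((\<lambda>k :: 'a. (- c * (norm k)\<^sup>2) / norm k) \<longlongrightarrow> 0) (at 0)"
    by (rule Lim_transform_eventually) (auto simp: eventually_at_filter power2_eq_square)
  show "open ((\<lambda>k. y + k) -` W)" using assms(1) by (intro open_vimage continuous_intros)
  show "0 \<in> (\<lambda>k. y + k) -` W" using assms(2) by simp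
  fix k assume "k \<in> (\<lambda>k. y + k) -` W"
  then have "V y + c * (norm (x - y))\<^sup>2 \<le> V (y + k) + c * (norm (x - (y + k)))\<^sup>2" using min by simp
  moreover have eq: "(norm (x - (y + k)))\<^sup>2 = (norm (x - y))\<^sup>2 - 2 * ((x - y) \<bullet> k) + (norm k)\<^sup>2"
    unfolding power2_norm_eq_inner by (simp add: algebra_simps inner_commute)
  then have "c * (norm (x - (y + k)))\<^sup>2 = c * (norm (x - y))\<^sup>2 - 2 * c * ((x - y) \<bullet> k) + c * (norm k)\<^sup>2"
    unfolding eq by (simp add: distrib_left right_diff_distrib)
  ultimately show "- c * (norm k)\<^sup>2 \<le> V (y + k) - V y - (2 * c) *\<^sub>R (x - y) \<bullet> k"
    unfolding inner_scaleR_left by linarith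
qed

context lipschitz_system
begin

text \<open>Decay is required only near the trajectory and below the level \<open>M\<close>, because
  the penalised minimisers \<open>Y s\<close> lie within \<open>r\<close> of \<open>x s\<close> and
  satisfy \<open>V (Y s) \<le> V (x s)\<close>. So \<open>W\<close> may be a region where the decay
  rate has a constant lower bound \<open>m\<close>, such as a superlevel set of
  \<open>V\<close>.\<close>

lemma strong_decrease:
  assumes V: "lower_semicontinuous V" "\<And>y. 0 \<le> V y" and T: "0 \<le> T"
    and ac: "absolutely_continuous_on 0 T x" and N: "N \<in> null_sets lebesgue"
    and sol: "\<And>s. 0 \<le> s \<Longrightarrow> s < T \<Longrightarrow> s \<notin> N \<Longrightarrow> \<exists>v\<in>F (x s). (x has_vector_derivative v) (at s within {s..T})"
    and W: "open W" "\<And>s. s \<in> {0..T} \<Longrightarrow> x s \<in> W" and M: "\<And>s. s \<in> {0..T} \<Longrightarrow> V (x s) \<le> M"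
    and dec: "\<And>y \<zeta> v. y \<in> W \<Longrightarrow> V y \<le> M \<Longrightarrow> \<zeta> \<in> viscosity_subdiff V y \<Longrightarrow> v \<in> F y \<Longrightarrow> \<zeta> \<bullet> v \<le> - m"
  shows "V (x T) \<le> V (x 0) - m * T"
proof -
  have cx: "continuous_on {0..T} x" by (rule absolutely_continuous_on_imp_continuous_on[OF ac])
  have cA: "compact (x ` {0..T})" by (intro compact_continuous_image cx) simp
  obtain R where R: "\<And>s. s \<in> {0..T} \<Longrightarrow> norm (x s) \<le> R"
    using compact_imp_bounded[OF cA] unfolding bounded_iff by blast
  have "norm (x 0) \<le> R" using R[of 0] T by simp
  then have R0: "0 \<le> R" using norm_ge_zero order_trans by blast
  have M0: "0 \<le> M" using M[of 0] V(2)[of "x 0"] T by simp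
  obtain r0 where r0: "r0 > 0" "(\<Union>a\<in>x ` {0..T}. cball a r0) \<subseteq> W"
    using compact_subset_open_imp_cball_epsilon_subset[OF cA W(1)] W(2) by (metis image_subsetI)
  obtain L B where L: "0 \<le> L" and
    lip: "\<And>p q v. norm p \<le> R + 1 \<Longrightarrow> norm q \<le> R + 1 \<Longrightarrow> v \<in> F p \<Longrightarrow> \<exists>w\<in>F q. norm (v - w) \<le> L * norm (p - q)"
    by (rule set_locally_lipschitz_cball[OF F_lip F_compact F_nonempty, of "R + 1"]) (rule that; blast)
  \<comment> \<open>The extra radius 1 makes a minimiser within \<open>r \<le> 1\<close> of
    \<open>x s\<close> an interior point of \<open>K\<close>, so that it minimises over an open
    set.\<close>
  define K where "K = cball (0::'a) (R + 1)"
  have xK: "x s \<in> K" if "s \<in> {0..T}" for s using R[OF that] by (simp add: K_def)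
  \<comment> \<open>The weight \<open>exp (- 2 L s)\<close> of the penalty absorbs the error \<open>L |x s - y|\<close> made by
    moving a velocity from \<open>F (x s)\<close> to \<open>F y\<close>.\<close>
  have key: "\<exists>y. norm (x T - y) < r \<and> V y \<le> V (x 0) - m * T" if r: "0 < r" "r \<le> min r0 1" for r
  proof -
    \<comment> \<open>Chosen so that even the smallest weight \<open>\<kappa> T\<close> equals
      \<open>(M + 1) / r\<^sup>2\<close>. The penalty at a minimiser is at most \<open>M\<close>,
      which forces its distance from \<open>x s\<close> below \<open>r\<close>.\<close>
    define k where "k = exp (2 * L * T) * (M + 1) / r\<^sup>2"
    define \<kappa> where "\<kappa> s = k * exp (- (2 * L * s))" for s
    have k0: "0 < k" using r M0 by (simp add: k_def)
    have \<kappa>0: "0 < \<kappa> s" for s using k0 by (simp add: \<kappa>_def)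
    have \<kappa>le: "\<kappa> s \<le> k" if "0 \<le> s" for s
    proof -
      have "exp (- (2 * L * s)) \<le> 1" using L that by simp
      then show ?thesis unfolding \<kappa>_def using k0 by (simp add: mult_left_le)
    qed
    have \<kappa>ge: "(M + 1) / r\<^sup>2 \<le> \<kappa> s" if "s \<le> T" for s
    proof -
      have "(M + 1) / r\<^sup>2 = k * exp (- (2 * L * T))" using r by (simp add: k_def exp_minus field_simps)
      also have "\<dots> \<le> \<kappa> s" unfolding \<kappa>_def using that L k0 by (simp add: mult_left_mono)
      finally show ?thesis .
    qed
    have "\<exists>y\<in>K. \<forall>z\<in>K. V y + \<kappa> s * (norm (x s - y))\<^sup>2 \<le> V z + \<kappa> s * (norm (x s - z))\<^sup>2" for s
    proof (rule lower_semicontinuous_attains_inf)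
      show "compact K" "K \<noteq> {}" using R0 by (auto simp: K_def)
      show "0 \<le> V y + \<kappa> s * (norm (x s - y))\<^sup>2" for y using V(2)[of y] \<kappa>0[of s] by simp
      show "lower_semicontinuous (\<lambda>y. V y + \<kappa> s * (norm (x s - y))\<^sup>2)"
        unfolding lower_semicontinuous_def
      proof (intro allI impI)
        fix y c assume c: "c < V y + \<kappa> s * (norm (x s - y))\<^sup>2"
        define e where "e = (V y + \<kappa> s * (norm (x s - y))\<^sup>2 - c) / 2"
        have e: "0 < e" using c by (simp add: e_def)
        have "\<forall>\<^sub>F z in nhds y. V y - e < V z" using V(1) e unfolding lower_semicontinuous_def by simp
        moreover have "((\<lambda>z. \<kappa> s * (norm (x s - z))\<^sup>2) \<longlongrightarrow> \<kappa> s * (norm (x s - y))\<^sup>2) (nhds y)"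
          by (intro tendsto_intros filterlim_ident)
        then have "\<forall>\<^sub>F z in nhds y. \<kappa> s * (norm (x s - y))\<^sup>2 - e < \<kappa> s * (norm (x s - z))\<^sup>2"
          by (rule order_tendstoD(1)) (use e in simp)
        ultimately show "\<forall>\<^sub>F z in nhds y. c < V z + \<kappa> s * (norm (x s - z))\<^sup>2"
          by eventually_elim (simp add: e_def field_simps)
      qed
    qed
    then obtain Y where Y: "\<And>s. Y s \<in> K"
      "\<And>s z. z \<in> K \<Longrightarrow> V (Y s) + \<kappa> s * (norm (x s - Y s))\<^sup>2 \<le> V z + \<kappa> s * (norm (x s - z))\<^sup>2" by metis
    define \<phi> where "\<phi> s = V (Y s) + \<kappa> s * (norm (x s - Y s))\<^sup>2" for s
    have \<phi>V: "\<phi> s \<le> V (x s)" if "s \<in> {0..T}" for s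
      using Y(2)[OF xK[OF that], of s] by (simp add: \<phi>_def)
    have VY: "V (Y s) \<le> \<phi> s" for s using \<kappa>0[of s] by (simp add: \<phi>_def)
    have near: "norm (x s - Y s) < r" if s: "s \<in> {0..T}" for s
    proof -
      have "(M + 1) / r\<^sup>2 * (norm (x s - Y s))\<^sup>2 \<le> \<kappa> s * (norm (x s - Y s))\<^sup>2"
        using \<kappa>ge[of s] s by (intro mult_right_mono) auto
      also have "\<dots> \<le> M" using \<phi>V[OF s] M[OF s] V(2)[of "Y s"] by (simp add: \<phi>_def)
      also have "\<dots> < (M + 1) / r\<^sup>2 * r\<^sup>2" using r by simp
      finally have "(norm (x s - Y s))\<^sup>2 < r\<^sup>2"
        by (rule mult_left_less_imp_less) (use r M0 in simp)
      then show ?thesis by (rule power_less_imp_less_base) (use r in simp)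
    qed
    define D where "D = 2 * R + 1"
    have D: "0 \<le> D" "\<And>s y. s \<in> {0..T} \<Longrightarrow> y \<in> K \<Longrightarrow> norm (x s - y) \<le> D"
    proof -
      show "0 \<le> D" using R0 by (simp add: D_def)
      fix s y assume "s \<in> {0..T}" "y \<in> K"
      then show "norm (x s - y) \<le> D" using R[of s] norm_triangle_ineq4[of "x s" y] by (simp add: K_def D_def)
    qed
    define C where "C = k * (2 * D) + k * (2 * L) * D\<^sup>2"
    have Cle: "\<bar>\<kappa> v * (norm (x v - y))\<^sup>2 - \<kappa> u * (norm (x u - y))\<^sup>2\<bar> \<le> C * (norm (x v - x u) + (v - u))"
      if uv: "0 \<le> u" "u \<le> v" "v \<le> T" and y: "y \<in> K" for u v y
    proof -
      define a b where "a = norm (x v - y)" and "b = norm (x u - y)"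
      have ab: "0 \<le> a" "a \<le> D" "0 \<le> b" "b \<le> D" using D(2) uv y by (auto simp: a_def b_def)
      have "\<bar>a - b\<bar> \<le> norm (x v - x u)"
        unfolding a_def b_def using norm_triangle_ineq3[of "x v - y" "x u - y"] by simp
      then have "\<bar>a\<^sup>2 - b\<^sup>2\<bar> \<le> norm (x v - x u) * (2 * D)"
        unfolding power2_eq_square square_diff_square_factored abs_mult mult.commute[of "\<bar>a + b\<bar>"]
        using ab by (intro mult_mono) auto
      then have 1: "\<kappa> v * \<bar>a\<^sup>2 - b\<^sup>2\<bar> \<le> k * (norm (x v - x u) * (2 * D))"
        using \<kappa>le[of v] k0 uv by (intro mult_mono) auto
      have "\<bar>exp (- (2 * L * v)) - exp (- (2 * L * u))\<bar> \<le> \<bar>2 * L * v - 2 * L * u\<bar>"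
        by (rule abs_exp_minus_diff_le) (use L uv in auto)
      also have "\<dots> = 2 * L * (v - u)" using L uv by (simp add: mult_left_mono flip: right_diff_distrib)
      finally have "\<bar>\<kappa> v - \<kappa> u\<bar> \<le> k * (2 * L * (v - u))"
        unfolding \<kappa>_def using k0 by (simp add: abs_mult flip: right_diff_distrib)
      then have 2: "\<bar>\<kappa> v - \<kappa> u\<bar> * b\<^sup>2 \<le> k * (2 * L * (v - u)) * D\<^sup>2"
        using ab k0 L uv by (intro mult_mono power_mono) auto
      have "\<kappa> v * a\<^sup>2 - \<kappa> u * b\<^sup>2 = \<kappa> v * (a\<^sup>2 - b\<^sup>2) + (\<kappa> v - \<kappa> u) * b\<^sup>2" by (simp add: algebra_simps)
      then have "\<bar>\<kappa> v * a\<^sup>2 - \<kappa> u * b\<^sup>2\<bar> \<le> \<kappa> v * \<bar>a\<^sup>2 - b\<^sup>2\<bar> + \<bar>\<kappa> v - \<kappa> u\<bar> * b\<^sup>2"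
        using abs_triangle_ineq[of "\<kappa> v * (a\<^sup>2 - b\<^sup>2)" "(\<kappa> v - \<kappa> u) * b\<^sup>2"] \<kappa>0[of v] by (simp add: abs_mult)
      also have "\<dots> \<le> k * (2 * D) * norm (x v - x u) + k * (2 * L) * D\<^sup>2 * (v - u)"
        using add_mono[OF 1 2] by (simp only: mult_ac)
      also have "\<dots> \<le> C * norm (x v - x u) + C * (v - u)"
        unfolding C_def using k0 L D(1) uv by (intro add_mono mult_right_mono) auto
      finally show ?thesis unfolding a_def b_def by (simp add: algebra_simps)
    qed
    define \<Phi> where "\<Phi> s = \<phi> s + m * s" for s
    have C0: "0 \<le> C" using k0 L D(1) by (simp add: C_def)
    have "absolutely_continuous_on 0 T \<Phi>"
    \<comment> \<open>Testing the minimum at one time with the minimiser of the other leaves only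
      the change of the penalty at a fixed point, so the discontinuities of \<open>V\<close> do not
      enter.\<close>
    proof (rule absolutely_continuous_on_dominated[OF ac, of "C + \<bar>m\<bar>"])
      fix u v assume uv: "0 \<le> u" "u \<le> v" "v \<le> T"
      have "\<phi> v - \<phi> u \<le> C * (norm (x v - x u) + (v - u))"
        using Y(2)[OF Y(1), of v u] Cle[OF uv Y(1), of u] unfolding \<phi>_def by linarith
      moreover have "\<phi> u - \<phi> v \<le> C * (norm (x v - x u) + (v - u))"
        using Y(2)[OF Y(1), of u v] Cle[OF uv Y(1), of v] unfolding \<phi>_def by linarith
      moreover have "\<bar>m * v - m * u\<bar> \<le> \<bar>m\<bar> * (norm (x v - x u) + (v - u))"
        using uv by (simp add: abs_mult mult_left_mono flip: right_diff_distrib)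
      ultimately show "norm (\<Phi> v - \<Phi> u) \<le> (C + \<bar>m\<bar>) * (norm (x v - x u) + (v - u))"
        unfolding \<Phi>_def real_norm_def distrib_right by linarith
    qed (use C0 in simp)
    then have "\<Phi> T \<le> \<Phi> 0"
    proof (rule absolutely_continuous_on_dini_decreasing[OF _ T N])
      fix s e :: real assume s: "0 \<le> s" "s < T" "s \<notin> N" and e: "0 < e"
      then obtain v where v: "v \<in> F (x s)" "(x has_vector_derivative v) (at s within {s..T})" using sol by blast
      have sT: "s \<in> {0..T}" using s by simp
      have YR: "norm (Y s) < R + 1" using near[OF sT] R[OF sT] r norm_triangle_sub[of "Y s" "x s"]
        by (simp add: norm_minus_commute)
      have YW: "Y s \<in> W"
      proof -
        have "Y s \<in> cball (x s) r0" using near[OF sT] r by (simp add: dist_norm)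
        then show ?thesis using r0(2) sT by blast
      qed
      define \<zeta> where "\<zeta> = (2 * \<kappa> s) *\<^sub>R (x s - Y s)"
      have "\<zeta> \<in> viscosity_subdiff V (Y s)"
        unfolding \<zeta>_def
      proof (rule viscosity_subdiff_quadratic[of "ball 0 (R + 1)"])
        show "V (Y s) + \<kappa> s * (norm (x s - Y s))\<^sup>2 \<le> V z + \<kappa> s * (norm (x s - z))\<^sup>2"
          if "z \<in> ball 0 (R + 1)" for z using Y(2)[of z s] that by (simp add: K_def)
      qed (use YR in auto)
      moreover obtain w where w: "w \<in> F (Y s)" "norm (v - w) \<le> L * norm (x s - Y s)"
        using lip[OF _ _ v(1), of "Y s"] R[OF sT] YR by auto
      moreover have "V (Y s) \<le> M" using VY[of s] \<phi>V[OF sT] M[OF sT] by linarith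
      ultimately have \<zeta>w: "\<zeta> \<bullet> w \<le> - m" using dec[OF YW] by blast
      have "\<zeta> \<bullet> (v - w) \<le> norm \<zeta> * norm (v - w)" by (rule norm_cauchy_schwarz)
      also have "\<dots> \<le> (2 * \<kappa> s * norm (x s - Y s)) * (L * norm (x s - Y s))"
        using w(2) \<kappa>0[of s] by (intro mult_mono) (auto simp: \<zeta>_def)
      finally have \<zeta>v: "\<zeta> \<bullet> v \<le> - m + 2 * L * \<kappa> s * (norm (x s - Y s))\<^sup>2"
        using \<zeta>w by (simp add: inner_diff_right power2_eq_square mult_ac)
      \<comment> \<open>\<open>\<psi>\<close> keeps the minimiser of time \<open>s\<close> fixed. Up
        to the constant \<open>V (Y s)\<close> it lies above \<open>\<Phi>\<close> and touches it at
        \<open>s\<close>, so its derivative controls the upper Dini derivative of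
        \<open>\<Phi>\<close>.\<close>
      define \<psi> where "\<psi> t = \<kappa> t * ((x t - Y s) \<bullet> (x t - Y s)) + m * t" for t
      define \<psi>' where "\<psi>' = \<kappa> s * (2 * ((x s - Y s) \<bullet> v)) + k * (exp (- (2 * L * s)) * (- (2 * L))) * ((x s - Y s) \<bullet> (x s - Y s)) + m"
      have "((\<lambda>t. (x t - Y s) \<bullet> (x t - Y s)) has_real_derivative 2 * ((x s - Y s) \<bullet> v)) (at s within {s..T})"
        using v(2) unfolding has_vector_derivative_def has_field_derivative_def
        by (auto intro!: derivative_eq_intros simp: inner_commute algebra_simps)
      moreover have "(\<kappa> has_real_derivative k * (exp (- (2 * L * s)) * (- (2 * L)))) (at s within {s..T})"
        unfolding \<kappa>_def by (auto intro!: derivative_eq_intros)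
      ultimately have "(\<psi> has_real_derivative \<psi>') (at s within {s..T})"
        unfolding \<psi>_def \<psi>'_def by (auto intro!: derivative_eq_intros)
      moreover have "\<psi>' \<le> 0"
      proof -
        \<comment> \<open>The derivative of \<open>\<kappa>\<close> contributes
          \<open>- 2 * L * \<kappa> s * (norm (x s - Y s))\<^sup>2\<close>, the exact opposite of
          the error term in \<open>\<zeta>v\<close>.\<close>
        have "\<psi>' = \<zeta> \<bullet> v - 2 * L * \<kappa> s * (norm (x s - Y s))\<^sup>2 + m"
          unfolding \<psi>'_def \<zeta>_def \<kappa>_def power2_norm_eq_inner by (simp add: algebra_simps)
        then show ?thesis using \<zeta>v by simp
      qed
      ultimately obtain d where d: "d > 0" "\<And>t. t \<in> {s..T} \<Longrightarrow> norm (t - s) < d \<Longrightarrow> norm (\<psi> t - \<psi> s - \<psi>' * (t - s)) \<le> e * norm (t - s)"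
        using e unfolding has_field_derivative_def has_derivative_within_alt by blast
      have \<Phi>\<psi>: "\<Phi> t - \<Phi> s \<le> \<psi> t - \<psi> s" for t
        using Y(2)[OF Y(1), of t s] unfolding \<Phi>_def \<phi>_def \<psi>_def power2_norm_eq_inner by linarith
      show "\<exists>d>0. \<forall>t. s < t \<and> t < s + d \<and> t \<le> T \<longrightarrow> \<Phi> t - \<Phi> s \<le> e * (t - s)"
      proof (intro exI[of _ d] conjI allI impI)
        fix t assume t: "s < t \<and> t < s + d \<and> t \<le> T"
        have "\<psi> t - \<psi> s - \<psi>' * (t - s) \<le> e * (t - s)" using d(2)[of t] t by auto
        moreover have "\<psi>' * (t - s) \<le> 0" using \<open>\<psi>' \<le> 0\<close> t by (simp add: mult_nonpos_nonneg)
        ultimately show "\<Phi> t - \<Phi> s \<le> e * (t - s)" using \<Phi>\<psi>[of t] by linarith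
      qed (rule d)
    qed
    then have "V (Y T) \<le> V (x 0) - m * T"
      using VY[of T] \<phi>V[of 0] T unfolding \<Phi>_def by simp
    then show ?thesis using near[of T] T by auto
  qed
  show ?thesis
  \<comment> \<open>As \<open>r\<close> shrinks, the points supplied by \<open>key\<close> approach
    \<open>x T\<close>; lower semicontinuity passes their bound on to \<open>x T\<close>.\<close>
  proof (rule ccontr)
    assume "\<not> V (x T) \<le> V (x 0) - m * T"
    then have "\<forall>\<^sub>F y in nhds (x T). V (x 0) - m * T < V y" using V(1) unfolding lower_semicontinuous_def by simp
    then obtain d where d: "d > 0" "\<And>y. dist y (x T) < d \<Longrightarrow> V (x 0) - m * T < V y"
      unfolding eventually_nhds_metric by blast
    obtain y where "norm (x T - y) < min d (min r0 1)" "V y \<le> V (x 0) - m * T"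
      using key[of "min d (min r0 1)"] d(1) r0(1) by (metis min.cobounded2 min_less_iff_conj zero_less_one)
    then show False using d(2)[of y] by (simp add: dist_norm norm_minus_commute)
  qed
qed

end

section \<open>Comparison functions\<close>

lemma class_K_less: "class_K \<gamma> \<Longrightarrow> 0 \<le> a \<Longrightarrow> a < b \<Longrightarrow> \<gamma> a < \<gamma> b"
  unfolding class_K_def strict_mono_on_def by auto

lemma class_K_le: "class_K \<gamma> \<Longrightarrow> 0 \<le> a \<Longrightarrow> a \<le> b \<Longrightarrow> \<gamma> a \<le> \<gamma> b"
  using class_K_less[of \<gamma> a b] by (cases "a = b") auto

lemma class_K_nonneg: "class_K \<gamma> \<Longrightarrow> 0 \<le> a \<Longrightarrow> 0 \<le> \<gamma> a"
  using class_K_le[of \<gamma> 0 a] unfolding class_K_def by simp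

lemma class_KI:
  assumes "continuous_on {0..} \<gamma>" "\<gamma> 0 = 0" "\<And>a b. 0 \<le> a \<Longrightarrow> a < b \<Longrightarrow> \<gamma> a < \<gamma> b"
  shows "class_K \<gamma>"
  using assms(1,2) assms(3)[of 0] assms(3) unfolding class_K_def strict_mono_on_def by fastforce

lemma class_K_comp:
  assumes "class_K f" "class_K g"
  shows "class_K (\<lambda>s. f (g s))"
proof (rule class_KI)
  show "continuous_on {0..} (\<lambda>s. f (g s))"
  proof (rule continuous_on_compose2[of "{0..}" f "{0..}" g])
    show "continuous_on {0..} f" "continuous_on {0..} g" using assms unfolding class_K_def by auto
    show "g ` {0..} \<subseteq> {0..}" using class_K_nonneg[OF assms(2)] by auto
  qed
  show "f (g 0) = 0" using assms unfolding class_K_def by simp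
  show "f (g a) < f (g b)" if "0 \<le> a" "a < b" for a b
    using class_K_less[OF assms(1) class_K_nonneg[OF assms(2)] class_K_less[OF assms(2)]] that by simp
qed

lemma class_K_max:
  assumes "class_K f" "class_K g"
  shows "class_K (\<lambda>s. max (f s) (g s))"
proof (rule class_KI)
  show "continuous_on {0..} (\<lambda>s. max (f s) (g s))"
    using assms unfolding class_K_def by (intro continuous_on_max) auto
  show "max (f 0) (g 0) = 0" using assms unfolding class_K_def by simp
  show "max (f a) (g a) < max (f b) (g b)" if "0 \<le> a" "a < b" for a b
    using class_K_less[OF assms(1) that] class_K_less[OF assms(2) that] by auto
qed

lemma class_K_add:
  assumes "class_K f" "class_K g"
  shows "class_K (\<lambda>s. f s + g s)"
proof (rule class_KI)
  show "continuous_on {0..} (\<lambda>s. f s + g s)"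
    using assms unfolding class_K_def by (intro continuous_on_add) auto
  show "f 0 + g 0 = 0" using assms unfolding class_K_def by simp
  show "f a + g a < f b + g b" if "0 \<le> a" "a < b" for a b
    using class_K_less[OF assms(1) that] class_K_less[OF assms(2) that] by auto
qed

lemma class_K_cmult:
  assumes "class_K f" "0 < c"
  shows "class_K (\<lambda>s. c * f s)"
proof (rule class_KI)
  show "continuous_on {0..} (\<lambda>s. c * f s)"
    using assms unfolding class_K_def by (intro continuous_intros) auto
  show "c * f 0 = 0" using assms unfolding class_K_def by simp
  show "c * f a < c * f b" if "0 \<le> a" "a < b" for a b
    using class_K_less[OF assms(1) that] assms(2) by simp
qed

lemma class_Kinf_iff:
  "class_Kinf \<gamma> \<longleftrightarrow> class_K \<gamma> \<and> (\<forall>r. \<exists>s\<ge>0. r < \<gamma> s)"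
proof (cases "class_K \<gamma>")
  case True
  have "bounded (\<gamma> ` {0..}) \<longleftrightarrow> (\<exists>r. \<forall>s\<ge>0. \<gamma> s \<le> r)"
    unfolding bounded_iff using class_K_nonneg[OF True] by force
  then show ?thesis unfolding class_Kinf_def by (meson not_le)
qed (simp add: class_Kinf_def)

lemma class_Kinf_inverse:
  assumes "class_Kinf \<alpha>"
  obtains \<beta> where "class_K \<beta>" "\<And>s. 0 \<le> s \<Longrightarrow> \<beta> (\<alpha> s) = s"
proof -
  have K: "class_K \<alpha>" using assms by (simp add: class_Kinf_iff)
  note less = class_K_less[OF K]
  have inj: "inj_on \<alpha> {0..}"
  proof (rule inj_onI)
    fix a b assume "a \<in> {0..}" "b \<in> {0..}" "\<alpha> a = \<alpha> b"
    then show "a = b" using less[of a b] less[of b a] by (cases a b rule: linorder_cases) auto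
  qed
  have surj: "\<exists>s\<ge>0. \<alpha> s = r" if r: "0 \<le> r" for r
  proof -
    obtain s where s: "0 \<le> s" "r < \<alpha> s" using assms by (auto simp: class_Kinf_iff)
    have "continuous_on {0..s} \<alpha>"
      using K unfolding class_K_def by (auto intro: continuous_on_subset)
    then show ?thesis using IVT'[of \<alpha> 0 r s] s r K unfolding class_K_def by auto
  qed
  \<comment> \<open>Extended by the identity to negative arguments, \<open>\<beta>\<close> is a
    monotone map onto all of \<open>real\<close>; continuity then follows from monotonicity and an
    open range.\<close>
  define \<beta> where "\<beta> r = (if 0 \<le> r then the_inv_into {0..} \<alpha> r else r)" for r
  have \<beta>: "\<beta> (\<alpha> s) = s" if "0 \<le> s" for s
    using that class_K_nonneg[OF K that] the_inv_into_f_f[OF inj, of s] by (simp add: \<beta>_def)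
  have pos: "0 \<le> \<beta> r" if "0 \<le> r" for r using surj[OF that] \<beta> by auto
  have bless: "\<beta> a < \<beta> b" if ab: "0 \<le> a" "a < b" for a b
  proof -
    obtain s t where "0 \<le> s" "\<alpha> s = a" "0 \<le> t" "\<alpha> t = b" using surj[of a] surj[of b] ab by auto
    then show ?thesis using \<beta> ab class_K_le[OF K, of t s] by force
  qed
  have "continuous_on UNIV \<beta>"
  proof (rule continuous_onI_mono)
    show "\<beta> x \<le> \<beta> y" if "x \<le> y" for x y
    proof (cases "0 \<le> x")
      case True then show ?thesis using bless[of x y] that by (cases "x = y") auto
    next
      case False then show ?thesis using pos[of y] that by (cases "0 \<le> y") (auto simp: \<beta>_def)
    qed
    have "y \<in> range \<beta>" for y
    proof (cases "0 \<le> y")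
      case True then show ?thesis using \<beta>[of y] by (metis rangeI)
    next
      case False then have "\<beta> y = y" by (simp add: \<beta>_def)
      then show ?thesis by (metis rangeI)
    qed
    then have "range \<beta> = UNIV" by auto
    then show "open (range \<beta>)" by simp
  qed
  then have "continuous_on {0..} \<beta>" by (rule continuous_on_subset) simp
  moreover have "\<beta> 0 = 0" using \<beta>[of 0] K by (simp add: class_K_def)
  ultimately have "class_K \<beta>" using bless by (intro class_KI)
  then show thesis using that \<beta> by blast
qed

text \<open>Integrating \<open>\<tau>\<close> over \<open>{0..r + 1}\<close> smooths out its jumps,
  and the range of integration includes \<open>{r..r + 1}\<close>, on which \<open>\<tau>\<close> is
  at least \<open>\<tau> r\<close>.\<close>

lemma mono_continuous_majorant:
  fixes \<tau> :: "real \<Rightarrow> real"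
  assumes "mono \<tau>" "\<And>r. 0 \<le> \<tau> r"
  obtains \<theta> where "continuous_on {0..} \<theta>" "\<And>r s. 0 \<le> r \<Longrightarrow> r \<le> s \<Longrightarrow> \<theta> r \<le> \<theta> s" "\<And>r. 0 \<le> r \<Longrightarrow> \<tau> r \<le> \<theta> r"
proof -
  have int: "\<tau> integrable_on {a..b}" for a b
    by (rule integrable_on_mono_on) (use assms(1) in \<open>auto simp: mono_on_def mono_def\<close>)
  define \<theta> where "\<theta> r = integral {0..r + 1} \<tau>" for r
  have "continuous_on {0..} \<theta>"
    unfolding continuous_on_eq_continuous_within
  proof
    fix r :: real assume r: "r \<in> {0..}"
    have "continuous_on {0..r + 2} (\<lambda>x. integral {0..x} \<tau>)" by (rule indefinite_integral_continuous_1[OF int])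
    then have "continuous_on {0..r + 1} \<theta>"
      unfolding \<theta>_def by (rule continuous_on_compose2[OF _ continuous_on_add[OF continuous_on_id continuous_on_const]]) auto
    then have "continuous (at r within {0..r + 1}) \<theta>" using r by (simp add: continuous_on_eq_continuous_within)
    moreover have "at r within {0..} = at r within {0..r + 1}"
      by (rule at_within_nhd[of _ "{..<r + 1}"]) auto
    ultimately show "continuous (at r within {0..}) \<theta>" by (simp add: continuous_within)
  qed
  moreover have "\<theta> r \<le> \<theta> s" if "0 \<le> r" "r \<le> s" for r s
    unfolding \<theta>_def using that assms(2) by (intro integral_subset_le int) auto
  moreover have "\<tau> r \<le> \<theta> r" if "0 \<le> r" for r
  proof -
    have "\<tau> r = integral {r..r + 1} (\<lambda>_. \<tau> r)" by simp
    also have "\<dots> \<le> integral {r..r + 1} \<tau>"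
      by (rule integral_le[OF _ int]) (use assms(1) in \<open>auto simp: mono_def\<close>)
    also have "\<dots> \<le> \<theta> r"
      unfolding \<theta>_def using that assms(2) by (intro integral_subset_le int) auto
    finally show ?thesis .
  qed
  ultimately show thesis using that by blast
qed

text \<open>A form of Sontag's lemma on KL functions, stated for a relation between initial size,
  time and output. Attraction yields \<open>t \<le> \<theta> s + \<theta> (1 / v)\<close> for the
  times at which an output \<open>v\<close> still occurs; exponentiating this and multiplying by
  \<open>v \<le> \<sigma> s\<close> separates \<open>v\<close> from \<open>s\<close> and
  \<open>t\<close>.\<close>

lemma KL_estimate:
  fixes P :: "real \<Rightarrow> real \<Rightarrow> real \<Rightarrow> bool"
  assumes \<sigma>: "class_Kinf \<sigma>"
    and P: "\<And>s t v. P s t v \<Longrightarrow> 0 \<le> s \<and> 0 \<le> v \<and> v \<le> \<sigma> s"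
    and attr: "\<And>R e. 0 < R \<Longrightarrow> 0 < e \<Longrightarrow> \<exists>T. \<forall>s t v. P s t v \<and> s \<le> R \<and> T \<le> t \<longrightarrow> v < e"
  obtains \<alpha> \<beta> where "class_Kinf \<alpha>" "class_Kinf \<beta>" "\<And>s t v. P s t v \<Longrightarrow> \<alpha> v \<le> \<beta> s * exp (- t)"
proof -
  have "\<forall>n. \<exists>T. \<forall>s t v. P s t v \<and> s \<le> real (Suc n) \<and> T \<le> t \<longrightarrow> v < 1 / real (Suc n)"
    by (intro allI attr) auto
  then obtain T where T: "\<And>n s t v. P s t v \<Longrightarrow> s \<le> real (Suc n) \<Longrightarrow> T n \<le> t \<Longrightarrow> v < 1 / real (Suc n)" by metis
  \<comment> \<open>The sum of absolute values is monotone in \<open>r\<close> and dominates every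
    \<open>T k\<close> that occurs in it, although \<open>T\<close> itself need not be
    monotone.\<close>
  define \<tau> :: "real \<Rightarrow> real" where "\<tau> r = (\<Sum>k\<le>nat \<lceil>r\<rceil>. \<bar>T k\<bar>)" for r
  have "mono \<tau>" unfolding \<tau>_def mono_def by (auto intro!: sum_mono2 nat_mono ceiling_mono)
  moreover have "0 \<le> \<tau> r" for r by (simp add: \<tau>_def sum_nonneg)
  ultimately obtain \<theta> where \<theta>: "continuous_on {0..} \<theta>" "\<And>r s. 0 \<le> r \<Longrightarrow> r \<le> s \<Longrightarrow> \<theta> r \<le> \<theta> s"
    "\<And>r. 0 \<le> r \<Longrightarrow> \<tau> r \<le> \<theta> r" using mono_continuous_majorant by blast
  have \<theta>0: "0 \<le> \<theta> r" if "0 \<le> r" for r using \<theta>(3)[OF that] \<open>\<And>r. 0 \<le> \<tau> r\<close>[of r] by linarith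
  have time: "t \<le> \<theta> s + \<theta> (1 / v)" if Pv: "P s t v" and v: "0 < v" for s t v
  proof -
    have s: "0 \<le> s" using P[OF Pv] by blast
    \<comment> \<open>For this \<open>n\<close>, \<open>s\<close> is within the radius and
      \<open>v\<close> is not below the accuracy for which \<open>T n\<close> was chosen, so
      \<open>t < T n\<close>.\<close>
    define n where "n = nat \<lceil>max s (1 / v)\<rceil>"
    have n: "max s (1 / v) \<le> real n" unfolding n_def by linarith
    have "1 / real (Suc n) \<le> v" using n v by (simp add: field_simps)
    then have "\<not> T n \<le> t" using T[OF Pv, of n] n by fastforce
    then have "t \<le> \<bar>T n\<bar>" by simp
    also have "\<dots> \<le> \<tau> (max s (1 / v))" unfolding \<tau>_def n_def[symmetric] by (rule member_le_sum) auto
    also have "\<dots> \<le> \<theta> (max s (1 / v))" using s by (intro \<theta>(3)) simp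
    also have "\<dots> \<le> \<theta> s + \<theta> (1 / v)" using \<theta>0[of s] \<theta>0[of "1 / v"] s v by (auto simp: max_def)
    finally show ?thesis .
  qed
  define \<alpha> where "\<alpha> v = (if v \<le> 0 then 0 else v * exp (- \<theta> (1 / v)))" for v
  define \<beta> where "\<beta> s = \<sigma> s * exp (\<theta> s)" for s
  have \<sigma>K: "class_K \<sigma>" using \<sigma> by (simp add: class_Kinf_iff)
  have \<alpha>le: "0 \<le> \<alpha> v" "\<alpha> v \<le> v" if "0 \<le> v" for v
    using that \<theta>0[of "1 / v"] by (auto simp: \<alpha>_def mult_left_le)
  have \<alpha>K: "class_K \<alpha>"
  proof (rule class_KI)
    show "\<alpha> 0 = 0" by (simp add: \<alpha>_def)
    show "\<alpha> a < \<alpha> b" if ab: "0 \<le> a" "a < b" for a b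
    proof (cases "a = 0")
      case False
      have "exp (- \<theta> (1 / a)) \<le> exp (- \<theta> (1 / b))" using ab False \<theta>(2)[of "1 / b" "1 / a"] by (simp add: frac_le)
      then have "a * exp (- \<theta> (1 / a)) \<le> a * exp (- \<theta> (1 / b))" using ab by (intro mult_left_mono) auto
      also have "\<dots> < b * exp (- \<theta> (1 / b))" using ab by simp
      finally show ?thesis using ab False by (simp add: \<alpha>_def)
    qed (use ab in \<open>simp add: \<alpha>_def\<close>)
    have c: "continuous_on {0<..} \<alpha>"
    proof (rule continuous_on_eq)
      show "continuous_on {0<..} (\<lambda>v. v * exp (- \<theta> (1 / v)))"
        by (intro continuous_intros continuous_on_compose2[OF \<theta>(1)]) auto
    qed (auto simp: \<alpha>_def)
    show "continuous_on {0..} \<alpha>"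
      unfolding continuous_on_eq_continuous_within
    proof
      fix v :: real assume v: "v \<in> {0..}"
      show "continuous (at v within {0..}) \<alpha>"
      proof (cases "v = 0")
        case True
        have "(\<alpha> \<longlongrightarrow> 0) (at 0 within {0..})"
        proof (rule tendsto_sandwich)
          show "\<forall>\<^sub>F v in at 0 within {0..}. 0 \<le> \<alpha> v" "\<forall>\<^sub>F v in at 0 within {0..}. \<alpha> v \<le> v"
            using \<alpha>le by (auto simp: eventually_at_filter)
        qed (auto intro: tendsto_intros)
        then show ?thesis using True by (simp add: continuous_within \<alpha>_def)
      next
        case False
        then have "isCont \<alpha> v" using c v by (simp add: continuous_on_eq_continuous_at)
        then show ?thesis by (rule continuous_at_imp_continuous_at_within)
      qed
    qed
  qed
  have \<alpha>inf: "class_Kinf \<alpha>"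
    unfolding class_Kinf_iff
  proof (intro conjI allI \<alpha>K)
    fix r :: real
    define v where "v = max 1 ((\<bar>r\<bar> + 1) * exp (\<theta> 1))"
    have "1 / v \<le> 1" "0 < v" by (auto simp: v_def)
    have "r < (\<bar>r\<bar> + 1) * exp (\<theta> 1) * exp (- \<theta> 1)" by (simp add: mult.assoc flip: exp_add)
    also have "\<dots> \<le> v * exp (- \<theta> 1)" by (simp add: v_def)
    also have "\<dots> \<le> \<alpha> v" using \<theta>(2)[of "1 / v" 1] \<open>1 / v \<le> 1\<close> \<open>0 < v\<close> by (simp add: \<alpha>_def)
    finally show "\<exists>s\<ge>0. r < \<alpha> s" using \<open>0 < v\<close> by (intro exI[of _ v]) auto
  qed
  have \<beta>ge: "\<sigma> s \<le> \<beta> s" if "0 \<le> s" for s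
  proof -
    have "\<sigma> s * 1 \<le> \<beta> s" unfolding \<beta>_def
      using \<theta>0[OF that] class_K_nonneg[OF \<sigma>K that] by (intro mult_left_mono) auto
    then show ?thesis by simp
  qed
  have \<beta>K: "class_K \<beta>"
  proof (rule class_KI)
    show "continuous_on {0..} \<beta>" unfolding \<beta>_def using \<sigma>K \<theta>(1) unfolding class_K_def by (intro continuous_intros) auto
    show "\<beta> 0 = 0" using \<sigma>K by (simp add: \<beta>_def class_K_def)
    show "\<beta> a < \<beta> b" if "0 \<le> a" "a < b" for a b
      unfolding \<beta>_def using that \<theta>(2)[of a b] class_K_less[OF \<sigma>K that] class_K_nonneg[OF \<sigma>K that(1)]
      by (intro mult_less_le_imp_less) auto
  qed
  have "class_Kinf \<beta>"
    unfolding class_Kinf_iff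
  proof (intro conjI allI \<beta>K)
    fix r
    obtain s where "0 \<le> s" "r < \<sigma> s" using \<sigma> by (auto simp: class_Kinf_iff)
    then show "\<exists>s\<ge>0. r < \<beta> s" using \<beta>ge[of s] by (intro exI[of _ s]) auto
  qed
  moreover have "\<alpha> v \<le> \<beta> s * exp (- t)" if Pv: "P s t v" for s t v
  proof (cases "v \<le> 0")
    case True
    then show ?thesis using P[OF Pv] class_K_nonneg[OF \<beta>K, of s] by (simp add: \<alpha>_def)
  next
    case False
    have "\<alpha> v = v * exp (- \<theta> (1 / v))" using False by (simp add: \<alpha>_def)
    also have "\<dots> \<le> \<sigma> s * exp (\<theta> s - t)"
      using P[OF Pv] time[OF Pv] False by (intro mult_mono) auto
    also have "\<dots> = \<beta> s * exp (- t)" unfolding \<beta>_def by (simp add: mult.assoc flip: exp_add)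
    finally show ?thesis .
  qed
  ultimately show thesis using that \<alpha>inf by blast
qed

section \<open>From Lyapunov functions to MES\<close>

lemma locally_lipschitz_continuous_on: "locally_lipschitz f \<Longrightarrow> continuous_on UNIV f"
  unfolding continuous_on_eq_continuous_within locally_lipschitz_def
  by (metis continuous_on_eq_continuous_at lipschitz_on_continuous_on)

lemma absolutely_continuous_on_shift:
  assumes "absolutely_continuous_on (a + c) (b + c) x"
  shows "absolutely_continuous_on a b (\<lambda>s. x (c + s))"
  unfolding absolutely_continuous_on_def
proof (intro allI impI)
  fix e :: real assume "e > 0"
  then obtain d where d: "d > 0" "\<forall>D. finite D \<and> (\<forall>(u, v)\<in>D. a + c \<le> u \<and> u \<le> v \<and> v \<le> b + c) \<and>
      disjoint_family_on (\<lambda>(u, v). {u<..<v}) D \<and> (\<Sum>(u, v)\<in>D. v - u) < d \<longrightarrow>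
      (\<Sum>(u, v)\<in>D. norm (x v - x u)) < e"
    using assms unfolding absolutely_continuous_on_def by blast
  show "\<exists>\<delta>>0. \<forall>D. finite D \<and> (\<forall>(u, v)\<in>D. a \<le> u \<and> u \<le> v \<and> v \<le> b) \<and>
      disjoint_family_on (\<lambda>(u, v). {u<..<v}) D \<and> (\<Sum>(u, v)\<in>D. v - u) < \<delta> \<longrightarrow>
      (\<Sum>(u, v)\<in>D. norm (x (c + v) - x (c + u))) < e"
  proof (intro exI[of _ d] conjI allI impI d)
    fix D assume D: "finite D \<and> (\<forall>(u, v)\<in>D. a \<le> u \<and> u \<le> v \<and> v \<le> b) \<and>
      disjoint_family_on (\<lambda>(u, v). {u<..<v}) D \<and> (\<Sum>(u, v)\<in>D. v - u) < d"
    define f where "f = (\<lambda>(u, v). (c + u, c + v :: real))"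
    have inj: "inj_on f D" by (auto simp: f_def inj_on_def)
    have "disjoint_family_on (\<lambda>(u, v). {u<..<v}) (f ` D)"
      unfolding disjoint_family_on_def
    proof (intro ballI impI)
      fix p q assume pq: "p \<in> f ` D" "q \<in> f ` D" "p \<noteq> q"
      then obtain p' q' where p': "p' \<in> D" "q' \<in> D" "p = f p'" "q = f q'" "p' \<noteq> q'" by blast
      then have "(\<lambda>(u, v). {u<..<v}) p' \<inter> (\<lambda>(u, v). {u<..<v}) q' = {}"
        using D unfolding disjoint_family_on_def by blast
      moreover have "(\<lambda>(u, v). {u<..<v}) (f r) = (+) c ` (\<lambda>(u, v). {u<..<v}) r" for r
      proof (intro equalityI subsetI)
        fix y assume "y \<in> (\<lambda>(u, v). {u<..<v}) (f r)"
        then show "y \<in> (+) c ` (\<lambda>(u, v). {u<..<v}) r"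
          by (intro image_eqI[of _ _ "y - c"]) (auto simp: f_def split_def)
      qed (auto simp: f_def split_def)
      ultimately show "(\<lambda>(u, v). {u<..<v}) p \<inter> (\<lambda>(u, v). {u<..<v}) q = {}"
        unfolding p'(3,4) by (metis image_Int image_empty inj_on_add)
    qed
    moreover have "\<forall>(u, v)\<in>f ` D. a + c \<le> u \<and> u \<le> v \<and> v \<le> b + c" using D by (auto simp: f_def)
    moreover have "(\<Sum>(u, v)\<in>f ` D. v - u) < d"
      using D by (subst sum.reindex[OF inj]) (simp add: f_def split_def o_def)
    ultimately have "(\<Sum>(u, v)\<in>f ` D. norm (x v - x u)) < e" using spec[OF d(2), of "f ` D"] D by blast
    then show "(\<Sum>(u, v)\<in>D. norm (x (c + v) - x (c + u))) < e"
      by (subst (asm) sum.reindex[OF inj]) (simp add: f_def split_def o_def)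
  qed
qed

lemma is_solution_velocity:
  assumes "is_solution F \<infinity> x"
  obtains N where "N \<in> null_sets lebesgue"
    "\<And>s. 0 \<le> s \<Longrightarrow> s \<notin> N \<Longrightarrow> \<exists>v\<in>F (x s). (x has_vector_derivative v) (at s within {0..})"
proof -
  have "{s. 0 \<le> s \<and> ereal s < \<infinity>} = {0..}" by auto
  then have "AE t in lebesgue. 0 \<le> t \<longrightarrow> (\<exists>v\<in>F (x t). (x has_vector_derivative v) (at t within {0..}))"
    using assms unfolding is_solution_def by simp
  then obtain N where N: "N \<in> null_sets lebesgue"
    "{t\<in>space lebesgue. \<not> (0 \<le> t \<longrightarrow> (\<exists>v\<in>F (x t). (x has_vector_derivative v) (at t within {0..})))} \<subseteq> N"
    unfolding eventually_ae_filter by blast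
  then show thesis by (intro that[of N]) auto
qed

lemma is_solution_absolutely_continuous:
  "is_solution F \<infinity> x \<Longrightarrow> 0 \<le> a \<Longrightarrow> a \<le> b \<Longrightarrow> absolutely_continuous_on a b x"
  unfolding is_solution_def by simp

lemma is_solution_continuous_on:
  assumes "is_solution F \<infinity> x"
  shows "continuous_on {0..t} x"
proof (cases "0 \<le> t")
  case True
  then show ?thesis
    using is_solution_absolutely_continuous[OF assms, of 0 t] absolutely_continuous_on_imp_continuous_on by blast
qed simp

lemma is_solution_shift:
  assumes x: "is_solution F \<infinity> x" and c: "0 \<le> c"
  shows "is_solution F \<infinity> (\<lambda>s. x (c + s))"
  unfolding is_solution_def
proof (intro conjI allI impI)
  fix a b assume "0 \<le> a \<and> a \<le> b \<and> ereal b < \<infinity>"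
  then show "absolutely_continuous_on a b (\<lambda>s. x (c + s))"
    using is_solution_absolutely_continuous[OF x, of "a + c" "b + c"] c
    by (intro absolutely_continuous_on_shift) simp
next
  obtain N where N: "N \<in> null_sets lebesgue"
    "\<And>s. 0 \<le> s \<Longrightarrow> s \<notin> N \<Longrightarrow> \<exists>v\<in>F (x s). (x has_vector_derivative v) (at s within {0..})"
    using is_solution_velocity[OF x] by blast
  have dom: "{s. 0 \<le> s \<and> ereal s < \<infinity>} = {0..}" by auto
  have "(+) (- c) ` N \<in> null_sets lebesgue"
    using N(1) negligible_translation[of N "- c"] by (simp add: negligible_iff_null_sets)
  moreover have "{t\<in>space lebesgue. \<not> (0 \<le> t \<and> ereal t < \<infinity> \<longrightarrow> (\<exists>v\<in>F (x (c + t)).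
      ((\<lambda>s. x (c + s)) has_vector_derivative v) (at t within {s. 0 \<le> s \<and> ereal s < \<infinity>})))} \<subseteq> (+) (- c) ` N"
    unfolding dom
  proof (rule subsetI, rule ccontr)
    fix t assume t: "t \<in> {t\<in>space lebesgue. \<not> (0 \<le> t \<and> ereal t < \<infinity> \<longrightarrow> (\<exists>v\<in>F (x (c + t)).
      ((\<lambda>s. x (c + s)) has_vector_derivative v) (at t within {0..})))}" and nt: "t \<notin> (+) (- c) ` N"
    have "c + t \<notin> N"
    proof
      assume "c + t \<in> N"
      then have "- c + (c + t) \<in> (+) (- c) ` N" by (rule imageI)
      then show False using nt by simp
    qed
    moreover have "0 \<le> t" using t by simp
    ultimately obtain v where v: "v \<in> F (x (c + t))" "(x has_vector_derivative v) (at (c + t) within {0..})"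
      using N(2)[of "c + t"] c by auto
    have "((+) c has_vector_derivative 1) (at t within {0..})" by (auto intro!: derivative_eq_intros)
    moreover have "(x has_vector_derivative v) (at (c + t) within (+) c ` {0..})"
      by (rule has_vector_derivative_within_subset[OF v(2)]) (use c in auto)
    ultimately have "((x \<circ> (+) c) has_vector_derivative 1 *\<^sub>R v) (at t within {0..})"
      by (rule vector_diff_chain_within)
    then have "((\<lambda>s. x (c + s)) has_vector_derivative v) (at t within {0..})" by (simp add: o_def)
    then show False using t v(1) by blast
  qed
  ultimately show "AE t in lebesgue. 0 \<le> t \<and> ereal t < \<infinity> \<longrightarrow> (\<exists>v\<in>F (x (c + t)).
      ((\<lambda>s. x (c + s)) has_vector_derivative v) (at t within {s. 0 \<le> s \<and> ereal s < \<infinity>}))"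
    by (rule AE_I')
qed simp

lemma is_solution_maximal: "is_solution F \<infinity> x \<Longrightarrow> maximal_solution F \<infinity> x"
  unfolding maximal_solution_def by auto

lemma norm_le_sup_norm:
  assumes "continuous_on {a..b} w" "s \<in> {a..b}"
  shows "norm (w s) \<le> sup_norm w a b"
  unfolding sup_norm_def
proof (rule cSUP_upper[OF assms(2)])
  have "compact ((\<lambda>s. norm (w s)) ` {a..b})"
    by (intro compact_continuous_image continuous_on_norm assms(1)) simp
  then show "bdd_above ((\<lambda>s. norm (w s)) ` {a..b})" by (intro bounded_imp_bdd_above compact_imp_bounded)
qed

lemma sup_norm_le:
  assumes "a \<le> b" "\<And>s. s \<in> {a..b} \<Longrightarrow> norm (w s) \<le> M"
  shows "sup_norm w a b \<le> M"
  unfolding sup_norm_def by (rule cSUP_least) (use assms in auto)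

lemma open_superlevel:
  assumes "lower_semicontinuous V"
  shows "open {y. c < V y}"
proof (subst open_subopen, intro ballI)
  fix y assume "y \<in> {y. c < V y}"
  then have "\<forall>\<^sub>F z in nhds y. c < V z" using assms unfolding lower_semicontinuous_def by blast
  then show "\<exists>T. open T \<and> y \<in> T \<and> T \<subseteq> {y. c < V y}" unfolding eventually_nhds by blast
qed

lemma open_dominance_region:
  fixes h :: "'a::topological_space \<Rightarrow> 'b::real_normed_vector" and g :: "'a \<Rightarrow> 'c::real_normed_vector"
  assumes "continuous_on UNIV h" "continuous_on UNIV g" "class_K \<rho>"
  shows "open {\<xi>. \<rho> (norm (g \<xi>)) < norm (h \<xi>)}"
proof (rule open_Collect_less)
  have "continuous_on {0..} \<rho>" using assms(3) by (simp add: class_K_def)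
  then show "continuous_on UNIV (\<lambda>\<xi>. \<rho> (norm (g \<xi>)))"
    by (rule continuous_on_compose2[OF _ continuous_on_norm[OF assms(2)]]) auto
  show "continuous_on UNIV (\<lambda>\<xi>. norm (h \<xi>))" by (intro continuous_on_norm assms(1))
qed

context lipschitz_system
begin

text \<open>The case \<open>m = 0\<close> of \<open>strong_decrease\<close>. A lower semicontinuous
  \<open>V\<close> may be unbounded above even on a compact trajectory; the continuous majorant
  \<open>b\<close> supplies the level \<open>M\<close>.\<close>

lemma Lyapunov_nonincreasing:
  assumes V: "lower_semicontinuous V" "\<And>y. 0 \<le> V y" and U: "open U"
    and dec: "\<And>y \<zeta> v. y \<in> U \<Longrightarrow> \<zeta> \<in> viscosity_subdiff V y \<Longrightarrow> v \<in> F y \<Longrightarrow> \<zeta> \<bullet> v \<le> 0"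
    and bd: "\<And>y. y \<in> U \<Longrightarrow> V y \<le> b y" "continuous_on UNIV b"
    and x: "is_solution F \<infinity> x" "0 \<le> t" "\<And>r. r \<in> {0..t} \<Longrightarrow> x r \<in> U"
  shows "V (x t) \<le> V (x 0)"
proof -
  obtain N where N: "N \<in> null_sets lebesgue"
    "\<And>s. 0 \<le> s \<Longrightarrow> s \<notin> N \<Longrightarrow> \<exists>v\<in>F (x s). (x has_vector_derivative v) (at s within {0..})"
    using is_solution_velocity[OF x(1)] by blast
  have "bounded ((\<lambda>s. b (x s)) ` {0..t})"
    by (intro compact_imp_bounded compact_continuous_image continuous_on_compose2[OF bd(2)]
        is_solution_continuous_on[OF x(1)]) auto
  then obtain M where M: "\<forall>s\<in>{0..t}. \<bar>b (x s)\<bar> \<le> M" unfolding bounded_iff by auto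
  have "V (x t) \<le> V (x 0) - 0 * t"
  proof (rule strong_decrease[OF V x(2) is_solution_absolutely_continuous[OF x(1) order_refl x(2)] N(1) _ U x(3)])
    show "\<exists>v\<in>F (x s). (x has_vector_derivative v) (at s within {s..t})" if "0 \<le> s" "s < t" "s \<notin> N" for s
      using N(2)[of s] that has_vector_derivative_within_subset[of x _ s "{0..}" "{s..t}"] by fastforce
    show "V (x s) \<le> M" if "s \<in> {0..t}" for s using bd(1)[OF x(3)[OF that]] bspec[OF M that] by linarith
  qed (use dec in auto)
  then show ?thesis by simp
qed

text \<open>While the output is not small, \<open>V\<close> stays bounded below along the whole
  past, because it does not increase. On the compact range of its values the rate
  \<open>\<alpha>3\<close> has a positive minimum, so a large output at a late time would force
  \<open>V\<close> to be negative. \<open>KL_estimate\<close> turns this uniform attraction into an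
  exponential bound, whose two outer functions are then inverted.\<close>

lemma SIT_estimate:
  fixes h :: "'a \<Rightarrow> 'b::real_normed_vector" and g :: "'a \<Rightarrow> 'c::real_normed_vector"
  assumes h: "continuous_on UNIV h" and g: "continuous_on UNIV g"
    and \<omega>: "continuous_on UNIV \<omega>" "\<And>\<xi>. 0 \<le> \<omega> \<xi>" and \<rho>: "class_K \<rho>"
    and V: "lsc_SIT_Lyapunov F \<omega> h g \<rho> V"
  obtains \<alpha> \<beta> where "class_K \<alpha>" "class_Kinf \<beta>"
    "\<And>x t. is_solution F \<infinity> x \<Longrightarrow> 0 \<le> t \<Longrightarrow> (\<And>r. r \<in> {0..t} \<Longrightarrow> \<rho> (norm (g (x r))) < norm (h (x r))) \<Longrightarrow>
      norm (h (x t)) \<le> \<alpha> (\<beta> (\<omega> (x 0)) * exp (- t))"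
proof -
  have lsc: "lower_semicontinuous V" and nn: "\<And>y. 0 \<le> V y" using V unfolding lsc_SIT_Lyapunov_def by auto
  obtain \<alpha>1 \<alpha>2 where \<alpha>12: "class_Kinf \<alpha>1" "class_Kinf \<alpha>2"
    "\<And>\<xi>. \<rho> (norm (g \<xi>)) < norm (h \<xi>) \<Longrightarrow> \<alpha>1 (norm (h \<xi>)) \<le> V \<xi> \<and> V \<xi> \<le> \<alpha>2 (\<omega> \<xi>)"
    using V unfolding lsc_SIT_Lyapunov_def SIT_bounds_def by blast
  obtain \<alpha>3 where \<alpha>3: "continuous_on {0..} \<alpha>3" "pos_def \<alpha>3" "SIT_decay F h g \<rho> \<alpha>3 V"
    using V unfolding lsc_SIT_Lyapunov_def by blast
  have K: "class_K \<alpha>1" "class_K \<alpha>2" using \<alpha>12 by (auto simp: class_Kinf_iff)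
  define U where "U = {\<xi>. \<rho> (norm (g \<xi>)) < norm (h \<xi>)}"
  have U: "open U" unfolding U_def by (rule open_dominance_region[OF h g \<rho>])
  have dec: "\<zeta> \<bullet> v \<le> - \<alpha>3 (V y)" if "y \<in> U" "\<zeta> \<in> viscosity_subdiff V y" "v \<in> F y" for y \<zeta> v
    using \<alpha>3(3) that unfolding SIT_decay_def U_def by blast
  have \<alpha>30: "0 \<le> \<alpha>3 r" if "0 \<le> r" for r using \<alpha>3(2) that unfolding pos_def_def by (cases "r = 0") (auto simp: less_imp_le)
  have b: "continuous_on UNIV (\<lambda>y. \<alpha>2 (\<omega> y))"
    using K(2) unfolding class_K_def by (intro continuous_on_compose2[OF _ \<omega>(1)]) (use \<omega>(2) in auto)
  have noninc: "V (x t) \<le> V (x r)"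
    if x: "is_solution F \<infinity> x" "\<And>r. r \<in> {0..t} \<Longrightarrow> x r \<in> U" and r: "r \<in> {0..t}" for x t r
  proof -
    have "V (x (r + (t - r))) \<le> V (x (r + 0))"
    proof (rule Lyapunov_nonincreasing[OF lsc nn U _ _ b is_solution_shift[OF x(1)]])
      show "\<zeta> \<bullet> v \<le> 0" if "y \<in> U" "\<zeta> \<in> viscosity_subdiff V y" "v \<in> F y" for y \<zeta> v
        using dec[OF that] \<alpha>30[OF nn[of y]] by linarith
      show "V y \<le> \<alpha>2 (\<omega> y)" if "y \<in> U" for y using \<alpha>12(3) that by (simp add: U_def)
    qed (use x(2) r in auto)
    then show ?thesis by simp
  qed
  define P where "P s t v \<longleftrightarrow> (\<exists>x. is_solution F \<infinity> x \<and> 0 \<le> t \<and> (\<forall>r\<in>{0..t}. x r \<in> U) \<and>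
    s = \<omega> (x 0) \<and> v = \<alpha>1 (norm (h (x t))))" for s t v
  have P: "0 \<le> s \<and> 0 \<le> v \<and> v \<le> \<alpha>2 s" if Pv: "P s t v" for s t v
  proof -
    obtain x where x: "is_solution F \<infinity> x" "0 \<le> t" "\<forall>r\<in>{0..t}. x r \<in> U" "s = \<omega> (x 0)" "v = \<alpha>1 (norm (h (x t)))"
      using Pv unfolding P_def by blast
    have "v \<le> V (x t)" "V (x 0) \<le> \<alpha>2 s" using \<alpha>12(3) x unfolding U_def by auto
    moreover have "V (x t) \<le> V (x 0)" by (rule noninc[OF x(1)]) (use x in auto)
    ultimately show ?thesis using \<omega>(2) x class_K_nonneg[OF K(1)] by auto
  qed
  have attr: "\<exists>T. \<forall>s t v. P s t v \<and> s \<le> R \<and> T \<le> t \<longrightarrow> v < e" if R: "0 < R" and e: "0 < e" for R e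
  proof -
    define M where "M = \<alpha>2 R"
    have M: "0 \<le> M" unfolding M_def using class_K_nonneg[OF K(2)] R by simp
    \<comment> \<open>\<open>\<alpha>3\<close> need not be monotone, hence a minimum over a compact
      interval. It starts at \<open>e/2\<close> rather than at \<open>e\<close>, so that the open
      set \<open>{y. e/2 < V y}\<close> contains a trajectory along which
      \<open>e \<le> V\<close>.\<close>
    have "\<exists>m>0. \<forall>r\<in>{e/2..M}. m \<le> \<alpha>3 r"
    proof (cases "e/2 \<le> M")
      case True
      have "continuous_on {e/2..M} \<alpha>3" by (rule continuous_on_subset[OF \<alpha>3(1)]) (use e in auto)
      then obtain r0 where r0: "r0 \<in> {e/2..M}" "\<forall>r\<in>{e/2..M}. \<alpha>3 r0 \<le> \<alpha>3 r"
        using continuous_attains_inf[of "{e/2..M}" \<alpha>3] True by auto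
      then have "0 < \<alpha>3 r0" using \<alpha>3(2) e unfolding pos_def_def by auto
      then show ?thesis using r0 by blast
    qed (auto intro: exI[of _ 1])
    then obtain m where m: "m > 0" "\<And>r. r \<in> {e/2..M} \<Longrightarrow> m \<le> \<alpha>3 r" by blast
    have "v < e" if Pv: "P s t v" and s: "s \<le> R" and t: "M / m + 1 \<le> t" for s t v
    proof (rule ccontr)
      assume "\<not> v < e"
      obtain x where x': "is_solution F \<infinity> x" "0 \<le> t" "\<forall>r\<in>{0..t}. x r \<in> U" "s = \<omega> (x 0)" "v = \<alpha>1 (norm (h (x t)))"
        using Pv unfolding P_def by blast
      note x = x'(1,2) bspec[OF x'(3)] x'(4,5)
      have "v \<le> V (x t)" "V (x 0) \<le> \<alpha>2 s" using \<alpha>12(3) x unfolding U_def by auto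
      moreover have "\<alpha>2 s \<le> M" unfolding M_def by (rule class_K_le[OF K(2)]) (use s x \<omega>(2) in auto)
      ultimately have V0: "V (x 0) \<le> M" and Vt: "e \<le> V (x t)" using \<open>\<not> v < e\<close> by auto
      obtain N where N: "N \<in> null_sets lebesgue"
        "\<And>s. 0 \<le> s \<Longrightarrow> s \<notin> N \<Longrightarrow> \<exists>v\<in>F (x s). (x has_vector_derivative v) (at s within {0..})"
        using is_solution_velocity[OF x(1)] by blast
      have "V (x t) \<le> V (x 0) - m * t"
      proof (rule strong_decrease[OF lsc nn x(2) is_solution_absolutely_continuous[OF x(1) order_refl x(2)] N(1)])
        show "\<exists>v\<in>F (x s). (x has_vector_derivative v) (at s within {s..t})" if "0 \<le> s" "s < t" "s \<notin> N" for s
          using N(2)[of s] that has_vector_derivative_within_subset[of x _ s "{0..}" "{s..t}"] by fastforce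
        show "open (U \<inter> {y. e/2 < V y})" by (intro open_Int U open_superlevel lsc)
        show "x s \<in> U \<inter> {y. e/2 < V y}" if "s \<in> {0..t}" for s
          using x(3)[OF that] noninc[OF x(1,3) that] Vt e by auto
        show "V (x s) \<le> M" if "s \<in> {0..t}" for s
          using noninc[of x s 0] x that V0 by force
        show "\<zeta> \<bullet> v \<le> - m" if y: "y \<in> U \<inter> {y. e/2 < V y}" "V y \<le> M" "\<zeta> \<in> viscosity_subdiff V y" "v \<in> F y" for y \<zeta> v
          using dec[of y \<zeta> v] m(2)[of "V y"] y by auto
      qed
      moreover have "M < m * t" using t m(1) by (simp add: field_simps)
      ultimately show False using V0 Vt e by linarith
    qed
    then show ?thesis by blast
  qed
  obtain a b where ab: "class_Kinf a" "class_Kinf b" "\<And>s t v. P s t v \<Longrightarrow> a v \<le> b s * exp (- t)"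
    using KL_estimate[OF \<alpha>12(2), of P] P attr by blast
  obtain a' where a': "class_K a'" "\<And>s. 0 \<le> s \<Longrightarrow> a' (a s) = s" using class_Kinf_inverse[OF ab(1)] by blast
  obtain \<alpha>1' where \<alpha>1': "class_K \<alpha>1'" "\<And>s. 0 \<le> s \<Longrightarrow> \<alpha>1' (\<alpha>1 s) = s" using class_Kinf_inverse[OF \<alpha>12(1)] by blast
  have aK: "class_K a" "class_K b" using ab by (auto simp: class_Kinf_iff)
  show thesis
  proof (rule that[of "\<lambda>r. \<alpha>1' (a' r)" b])
    show "class_K (\<lambda>r. \<alpha>1' (a' r))" by (rule class_K_comp[OF \<alpha>1'(1) a'(1)])
    fix x t assume x: "is_solution F \<infinity> x" "0 \<le> t" "\<And>r. r \<in> {0..t} \<Longrightarrow> \<rho> (norm (g (x r))) < norm (h (x r))"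
    define v where "v = \<alpha>1 (norm (h (x t)))"
    have v: "0 \<le> v" unfolding v_def by (rule class_K_nonneg[OF K(1)]) simp
    have "P (\<omega> (x 0)) t v" unfolding P_def U_def v_def using x by auto
    then have le: "a v \<le> b (\<omega> (x 0)) * exp (- t)" by (rule ab(3))
    have "a' (a v) \<le> a' (b (\<omega> (x 0)) * exp (- t))" by (rule class_K_le[OF a'(1) class_K_nonneg[OF aK(1) v] le])
    then have "v \<le> a' (b (\<omega> (x 0)) * exp (- t))" using a'(2)[OF v] by simp
    then have "\<alpha>1' v \<le> \<alpha>1' (a' (b (\<omega> (x 0)) * exp (- t)))" by (rule class_K_le[OF \<alpha>1'(1) v])
    then show "norm (h (x t)) \<le> \<alpha>1' (a' (b (\<omega> (x 0)) * exp (- t)))" using \<alpha>1'(2) by (simp add: v_def)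
  qed (rule ab(2))
qed

end

lemma class_KL_exp:
  assumes "class_K \<alpha>" "class_K \<beta>"
  shows "class_KL (\<lambda>s t. \<alpha> (\<beta> s * exp (- t)))"
  unfolding class_KL_def
proof (intro conjI allI impI)
  fix t :: real
  have "class_K (\<lambda>s. exp (- t) * \<beta> s)" by (rule class_K_cmult[OF assms(2)]) simp
  then show "class_K (\<lambda>s. \<alpha> (\<beta> s * exp (- t)))" using class_K_comp[OF assms(1)] by (simp add: mult.commute)
next
  fix s :: real assume s: "0 \<le> s"
  have \<beta>: "0 \<le> \<beta> s" by (rule class_K_nonneg[OF assms(2) s])
  show "antimono_on {0..} (\<lambda>t. \<alpha> (\<beta> s * exp (- t)))"
    unfolding monotone_on_def using \<beta> by (auto intro!: class_K_le[OF assms(1)] mult_left_mono)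
  have "((\<lambda>t. exp (- t)) \<longlongrightarrow> (0 :: real)) at_top"
    by (rule filterlim_compose[OF exp_at_bot filterlim_uminus_at_bot_at_top])
  then have "((\<lambda>t. \<beta> s * exp (- t)) \<longlongrightarrow> \<beta> s * 0) at_top" by (intro tendsto_intros)
  moreover have "continuous_on {0..} \<alpha>" "\<alpha> 0 = 0" using assms(1) by (auto simp: class_K_def)
  ultimately show "((\<lambda>t. \<alpha> (\<beta> s * exp (- t))) \<longlongrightarrow> 0) at_top"
    using continuous_on_tendsto_compose[of "{0..}" \<alpha> "\<lambda>t. \<beta> s * exp (- t)" 0 at_top] \<beta> by simp
qed

context lipschitz_system
begin

theorem RMEB_SIT_imp_MES:
  fixes h :: "'a \<Rightarrow> 'b::real_normed_vector" and g :: "'a \<Rightarrow> 'c::real_normed_vector"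
  assumes fc: "forward_complete F" and h: "continuous_on UNIV h" and g: "continuous_on UNIV g"
    and \<omega>: "continuous_on UNIV \<omega>" "\<And>\<xi>. 0 \<le> \<omega> \<xi>" and \<rho>: "class_K \<rho>"
    and V: "lsc_SIT_Lyapunov F \<omega> h g \<rho> V" and rmeb: "RMEB F h g"
  shows "MES F \<omega> h g"
proof -
  obtain \<alpha> \<beta> where \<alpha>\<beta>: "class_K \<alpha>" "class_Kinf \<beta>"
    "\<And>x t. is_solution F \<infinity> x \<Longrightarrow> 0 \<le> t \<Longrightarrow> (\<And>r. r \<in> {0..t} \<Longrightarrow> \<rho> (norm (g (x r))) < norm (h (x r))) \<Longrightarrow>
      norm (h (x t)) \<le> \<alpha> (\<beta> (\<omega> (x 0)) * exp (- t))"
    using SIT_estimate[OF h g \<omega> \<rho> V] by blast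
  obtain \<rho>1 \<sigma>1 \<sigma>2 where K: "class_K \<rho>1" "class_K \<sigma>1" "class_K \<sigma>2" and
    rm': "\<forall>T x t1. maximal_solution F T x \<and> 0 < t1 \<and> ereal t1 < T \<and>
          (\<forall>t\<in>{0..t1}. norm (h (x t)) > \<rho>1 (norm (g (x t)))) \<longrightarrow>
        (\<forall>t\<in>{0..t1}. norm (h (x t)) \<le> max (\<sigma>1 (norm (h (x 0)))) (\<sigma>2 (sup_norm (\<lambda>s. g (x s)) 0 t)))"
    using rmeb unfolding RMEB_def by (elim exE conjE) (rule that)
  have rm: "norm (h (x t1)) \<le> max (\<sigma>1 (norm (h (x 0)))) (\<sigma>2 (sup_norm (\<lambda>s. g (x s)) 0 t1))"
    if "maximal_solution F \<infinity> x" "0 < t1" "\<forall>t\<in>{0..t1}. norm (h (x t)) > \<rho>1 (norm (g (x t)))" for x t1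
    using spec[OF spec[OF spec[OF rm', of "\<infinity>"], of x], of t1] that by simp
  \<comment> \<open>Above the larger of the two gains both the Lyapunov estimate and RMEB are
    available.\<close>
  define \<rho>' where "\<rho>' r = max (\<rho> r) (\<rho>1 r)" for r
  \<comment> \<open>\<open>\<sigma>1 (\<rho>' r)\<close> is the output bound at the last time in
    \<open>S\<close>, propagated by RMEB; \<open>\<sigma>2 r\<close> is the input term of RMEB;
    \<open>\<rho>' r\<close> serves the case where that last time is \<open>t\<close>
    itself.\<close>
  define \<gamma> where "\<gamma> r = max (max (\<sigma>1 (\<rho>' r)) (\<sigma>2 r)) (\<rho>' r)" for r
  have \<rho>'K: "class_K \<rho>'" unfolding \<rho>'_def by (rule class_K_max[OF \<rho> K(1)])
  have \<gamma>K: "class_K \<gamma>" unfolding \<gamma>_def by (intro class_K_max class_K_comp[OF K(2)] K(3) \<rho>'K)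
  have "norm (h (x t)) \<le> max (\<alpha> (\<beta> (\<omega> (x 0)) * exp (- t))) (\<gamma> (sup_norm (\<lambda>s. g (x s)) 0 t))"
    if x: "is_solution F \<infinity> x" and t: "0 \<le> t" for x t
  proof -
    define w where "w = sup_norm (\<lambda>s. g (x s)) 0 t"
    have cx: "continuous_on {0..t} x" by (rule is_solution_continuous_on[OF x])
    have cg: "continuous_on {0..t} (\<lambda>s. g (x s))" by (rule continuous_on_compose2[OF g cx]) auto
    have ch: "continuous_on {0..t} (\<lambda>s. norm (h (x s)))"
      by (intro continuous_on_norm continuous_on_compose2[OF h cx]) auto
    have w: "norm (g (x s)) \<le> w" if "s \<in> {0..t}" for s unfolding w_def by (rule norm_le_sup_norm[OF cg that])
    define S where "S = {s\<in>{0..t}. norm (h (x s)) \<le> \<rho>' (norm (g (x s)))}"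
    show ?thesis
    proof (cases "S = {}")
      case True
      have "\<rho> (norm (g (x r))) < norm (h (x r))" if "r \<in> {0..t}" for r
        using True that by (auto simp: S_def \<rho>'_def)
      then have "norm (h (x t)) \<le> \<alpha> (\<beta> (\<omega> (x 0)) * exp (- t))" by (rule \<alpha>\<beta>(3)[OF x t])
      then show ?thesis by simp
    next
      case False
      have "continuous_on {0..} \<rho>'" using \<rho>'K by (simp add: class_K_def)
      then have "continuous_on {0..t} (\<lambda>s. \<rho>' (norm (g (x s))))"
        by (rule continuous_on_compose2[OF _ continuous_on_norm[OF cg]]) auto
      then have "closed S" unfolding S_def by (intro continuous_on_closed_Collect_le ch) auto
      moreover have "S \<subseteq> {0..t}" by (auto simp: S_def)
      then have "bounded S" by (rule bounded_subset[OF bounded_closed_interval])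
      ultimately have "compact S" by (simp add: compact_eq_bounded_closed)
      then obtain t0 where t0: "t0 \<in> S" "\<And>s. s \<in> S \<Longrightarrow> s \<le> t0" using compact_attains_sup[OF _ False] by blast
      have t0t: "t0 \<in> {0..t}" "norm (h (x t0)) \<le> \<rho>' (norm (g (x t0)))" using t0(1) by (auto simp: S_def)
      have \<rho>'w: "\<rho>' (norm (g (x t0))) \<le> \<rho>' w" by (rule class_K_le[OF \<rho>'K]) (use w[OF t0t(1)] in auto)
      have "norm (h (x t)) \<le> \<gamma> w"
      proof (cases "t0 = t")
        case True
        then show ?thesis using t0t(2) \<rho>'w by (simp add: \<gamma>_def)
      next
        case False
        then have lt: "t0 < t" using t0t(1) by simp
        \<comment> \<open>RMEB asks for a strict inequality on a closed interval, which may fail at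
          \<open>t0\<close>; hence the start at \<open>c > t0\<close>, followed by the limit as
          \<open>c\<close> tends to \<open>t0\<close>.\<close>
        have alt: "norm (h (x t)) \<le> max (\<sigma>1 (norm (h (x c)))) (\<sigma>2 w)" if c: "c \<in> {t0<..<t}" for c
        proof -
          have c0: "0 \<le> c" using c t0t(1) by simp
          have "\<forall>s\<in>{0..t - c}. norm (h (x (c + s))) > \<rho>1 (norm (g (x (c + s))))"
          proof
            fix s assume s: "s \<in> {0..t - c}"
            then have "c + s \<notin> S" using t0(2)[of "c + s"] c by auto
            then show "norm (h (x (c + s))) > \<rho>1 (norm (g (x (c + s))))" using s c0 by (auto simp: S_def \<rho>'_def)
          qed
          then have "norm (h (x (c + (t - c)))) \<le>
              max (\<sigma>1 (norm (h (x (c + 0))))) (\<sigma>2 (sup_norm (\<lambda>s. g (x (c + s))) 0 (t - c)))"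
            using rm[OF is_solution_maximal[OF is_solution_shift[OF x c0]], of "t - c"] c by simp
          moreover have "\<sigma>2 (sup_norm (\<lambda>s. g (x (c + s))) 0 (t - c)) \<le> \<sigma>2 w"
          proof (rule class_K_le[OF K(3)])
            show "sup_norm (\<lambda>s. g (x (c + s))) 0 (t - c) \<le> w"
              by (rule sup_norm_le) (use c c0 w in auto)
            have "continuous_on {0..t - c} (\<lambda>s. g (x (c + s)))"
              by (rule continuous_on_compose2[OF g is_solution_continuous_on[OF is_solution_shift[OF x c0]]]) auto
            then have "norm (g (x (c + 0))) \<le> sup_norm (\<lambda>s. g (x (c + s))) 0 (t - c)"
              by (rule norm_le_sup_norm) (use c in simp)
            then show "0 \<le> sup_norm (\<lambda>s. g (x (c + s))) 0 (t - c)" by (rule order_trans[OF norm_ge_zero])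
          qed
          ultimately show ?thesis by auto
        qed
        have "norm (h (x t)) \<le> max (\<sigma>1 (norm (h (x t0)))) (\<sigma>2 w)"
        proof (rule continuous_ge_on_closure[where S = "{t0<..<t}" and f = "\<lambda>c. max (\<sigma>1 (norm (h (x c)))) (\<sigma>2 w)"])
          have "continuous_on {0..} \<sigma>1" using K(2) by (simp add: class_K_def)
          then have "continuous_on {0..t} (\<lambda>c. \<sigma>1 (norm (h (x c))))" by (rule continuous_on_compose2[OF _ ch]) auto
          then have "continuous_on {t0..t} (\<lambda>c. \<sigma>1 (norm (h (x c))))" by (rule continuous_on_subset) (use t0t in auto)
          then show "continuous_on (closure {t0<..<t}) (\<lambda>c. max (\<sigma>1 (norm (h (x c)))) (\<sigma>2 w))"
            using lt by (auto intro!: continuous_on_max continuous_on_const)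
        qed (use lt alt in auto)
        moreover have "\<sigma>1 (norm (h (x t0))) \<le> \<sigma>1 (\<rho>' w)"
          by (rule class_K_le[OF K(2)]) (use t0t(2) \<rho>'w in auto)
        ultimately show ?thesis by (auto simp: \<gamma>_def)
      qed
      then show ?thesis by (simp add: w_def)
    qed
  qed
  moreover have "is_solution F \<infinity> x" if "maximal_solution F T x" for T x
    using fc that unfolding forward_complete_def maximal_solution_def by fastforce
  moreover have "class_KL (\<lambda>s t. \<alpha> (\<beta> s * exp (- t)))"
    using \<alpha>\<beta>(1,2) by (intro class_KL_exp) (auto simp: class_Kinf_iff)
  ultimately show ?thesis unfolding MES_def using \<gamma>K by blast
qed

end

section \<open>From MES to Lyapunov functions\<close>

context lipschitz_system
begin

text \<open>Inside \<open>D\<close> the input term of MES is at most half of the largest output on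
  the interval. At a time of largest output that term cannot be the active one, which gives the
  first claim; restarting MES later and later halves the bound each time, which gives the second. A
  restart needs a bound on \<open>\<omega> (x T)\<close> that is uniform in the solution, and here
  the bounded reachable sets enter.\<close>

lemma bounded_time_attractivity:
  fixes h :: "'a \<Rightarrow> 'b::real_normed_vector" and g :: "'a \<Rightarrow> 'c::real_normed_vector"
  assumes fc: "forward_complete F" and h: "continuous_on UNIV h" and g: "continuous_on UNIV g"
    and \<omega>: "continuous_on UNIV \<omega>" "\<And>\<xi>. 0 \<le> \<omega> \<xi>" "\<And>R. bounded {\<xi>. \<omega> \<xi> \<le> R}"
    and \<beta>: "class_KL \<beta>" and \<gamma>: "class_K \<gamma>"
    and mes: "\<forall>x t. maximal_solution F \<infinity> x \<and> 0 \<le> t \<longrightarrow>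
        norm (h (x t)) \<le> max (\<beta> (\<omega> (x 0)) t) (\<gamma> (sup_norm (\<lambda>s. g (x s)) 0 t))"
  defines "D \<equiv> {\<xi>. 2 * \<gamma> (norm (g \<xi>)) < norm (h \<xi>)}"
  shows "\<And>x t. regular_solution F 0 t x \<Longrightarrow> 0 \<le> t \<Longrightarrow> (\<forall>r\<in>{0..t}. x r \<in> D) \<Longrightarrow> norm (h (x t)) \<le> \<beta> (\<omega> (x 0)) 0"
    and "\<And>R e. 0 < R \<Longrightarrow> 0 < e \<Longrightarrow> \<exists>T. \<forall>x t. regular_solution F 0 t x \<and> 0 \<le> t \<and> (\<forall>r\<in>{0..t}. x r \<in> D) \<and>
      \<omega> (x 0) \<le> R \<and> T \<le> t \<longrightarrow> norm (h (x t)) < e"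
proof -
  have \<beta>K: "class_K (\<lambda>s. \<beta> s t)" if "0 \<le> t" for t using \<beta> that unfolding class_KL_def by blast
  have \<beta>anti: "\<beta> s r \<le> \<beta> s t" if "0 \<le> s" "0 \<le> t" "t \<le> r" for s r t
    using \<beta> that unfolding class_KL_def monotone_on_def by auto
  have \<beta>lim: "(\<beta> s \<longlongrightarrow> 0) at_top" if "0 \<le> s" for s using \<beta> that unfolding class_KL_def by blast
  \<comment> \<open>MES restarted at time \<open>a\<close>. The piece on \<open>{a..r}\<close> is
    first extended to a maximal solution, but the estimate at its end involves the piece
    only.\<close>
  have gain: "norm (h (x r)) \<le> max (\<beta> (\<omega> (x a)) (r - a)) (M / 2)"
    if x: "regular_solution F 0 t x" and ar: "0 \<le> a" "a \<le> r" "r \<le> t" and D: "\<forall>r\<in>{0..t}. x r \<in> D"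
      and M: "\<And>s. s \<in> {a..r} \<Longrightarrow> norm (h (x s)) \<le> M" for x t a r M
  proof -
    have "regular_solution F 0 (r - a) (\<lambda>s. x (a + s))"
      using regular_solution_subinterval[OF regular_solution_shift[OF x, of a], of 0 "r - a" "\<lambda>s. x (a + s)"] ar by simp
    then obtain y where y: "\<And>s. s \<le> r - a \<Longrightarrow> y s = x (a + s)" "maximal_solution F \<infinity> y" "\<And>b. regular_solution F 0 b y"
      using regular_solution_extend[OF fc, of "r - a" "\<lambda>s. x (a + s)"] ar by auto
    have cy: "continuous_on {0..r - a} (\<lambda>s. norm (g (y s)))"
      by (intro continuous_on_norm continuous_on_compose2[OF g regular_solution_continuous[OF y(3)]]) auto
    obtain s where s: "s \<in> {0..r - a}" "\<And>q. q \<in> {0..r - a} \<Longrightarrow> norm (g (y q)) \<le> norm (g (y s))"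
      using continuous_attains_sup[OF _ _ cy] ar by auto
    have le: "sup_norm (\<lambda>s. g (y s)) 0 (r - a) \<le> norm (g (y s))" by (rule sup_norm_le) (use ar s in auto)
    have "continuous_on {0..r - a} (\<lambda>s. g (y s))"
      by (rule continuous_on_compose2[OF g regular_solution_continuous[OF y(3)]]) auto
    then have "norm (g (y s)) \<le> sup_norm (\<lambda>s. g (y s)) 0 (r - a)" using s(1) by (rule norm_le_sup_norm)
    then have "\<gamma> (sup_norm (\<lambda>s. g (y s)) 0 (r - a)) \<le> \<gamma> (norm (g (y s)))"
      by (intro class_K_le[OF \<gamma> _ le]) (rule order_trans[OF norm_ge_zero])
    also have "\<dots> \<le> norm (h (y s)) / 2"
    proof -
      have "y s \<in> D" using D s(1) ar y(1)[of s] by auto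
      then show ?thesis by (simp add: D_def)
    qed
    also have "\<dots> \<le> M / 2" using M[of "a + s"] s(1) y(1)[of s] by auto
    finally have "\<gamma> (sup_norm (\<lambda>s. g (y s)) 0 (r - a)) \<le> M / 2" .
    moreover have "norm (h (y (r - a))) \<le> max (\<beta> (\<omega> (y 0)) (r - a)) (\<gamma> (sup_norm (\<lambda>s. g (y s)) 0 (r - a)))"
      using mes y(2) ar by simp
    ultimately show ?thesis using y(1)[of 0] y(1)[of "r - a"] ar by auto
  qed
  have bound: "norm (h (x r)) \<le> \<beta> (\<omega> (x 0)) 0"
    if x: "regular_solution F 0 t x" and D: "\<forall>r\<in>{0..t}. x r \<in> D" and r: "0 \<le> r" "r \<le> t" for x t r
  proof -
    have "continuous_on {0..t} (\<lambda>s. norm (h (x s)))"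
      by (intro continuous_on_norm continuous_on_compose2[OF h regular_solution_continuous[OF x]]) auto
    then obtain s where s: "s \<in> {0..t}" "\<And>q. q \<in> {0..t} \<Longrightarrow> norm (h (x q)) \<le> norm (h (x s))"
      using continuous_attains_sup[of "{0..t}" "\<lambda>s. norm (h (x s))"] r by auto
    have "norm (h (x s)) \<le> max (\<beta> (\<omega> (x 0)) (s - 0)) (norm (h (x s)) / 2)"
      by (rule gain[OF x _ _ _ D]) (use s in auto)
    moreover have "\<beta> (\<omega> (x 0)) s \<le> \<beta> (\<omega> (x 0)) 0" by (rule \<beta>anti) (use \<omega>(2) s in auto)
    moreover have "0 \<le> \<beta> (\<omega> (x 0)) 0" using class_K_nonneg[OF \<beta>K[of 0] \<omega>(2)] by simp
    ultimately have "norm (h (x s)) \<le> \<beta> (\<omega> (x 0)) 0" using norm_ge_zero[of "h (x s)"] by auto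
    then show ?thesis using s(2)[of r] r by auto
  qed
  show "norm (h (x t)) \<le> \<beta> (\<omega> (x 0)) 0"
    if "regular_solution F 0 t x" "0 \<le> t" "\<forall>r\<in>{0..t}. x r \<in> D" for x t
    using bound[OF that(1,3,2)] by simp
  fix R e :: real assume R: "0 < R" and e: "0 < e"
  define b where "b = \<beta> R 0"
  have b: "0 < b" using \<beta>K[of 0] R unfolding class_K_def b_def by auto
  have "\<exists>T\<ge>0. \<forall>x t. regular_solution F 0 t x \<and> (\<forall>r\<in>{0..t}. x r \<in> D) \<and> \<omega> (x 0) \<le> R \<longrightarrow>
     (\<forall>r. T \<le> r \<and> r \<le> t \<longrightarrow> norm (h (x r)) \<le> b / 2 ^ k)" for k
  proof (induction k)
    case 0
    have "norm (h (x r)) \<le> b" if x: "regular_solution F 0 t x" "\<forall>r\<in>{0..t}. x r \<in> D" "\<omega> (x 0) \<le> R" "0 \<le> r" "r \<le> t" for x t r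
    proof -
      have "\<beta> (\<omega> (x 0)) 0 \<le> b" unfolding b_def by (rule class_K_le[OF \<beta>K]) (use x \<omega>(2) in auto)
      then show ?thesis using bound[OF x(1,2,4,5)] by simp
    qed
    then show ?case by (intro exI[of _ 0]) auto
  next
    case (Suc k)
    then obtain T where T: "T \<ge> 0" "\<And>x t r. regular_solution F 0 t x \<Longrightarrow> \<forall>r\<in>{0..t}. x r \<in> D \<Longrightarrow> \<omega> (x 0) \<le> R \<Longrightarrow>
      T \<le> r \<Longrightarrow> r \<le> t \<Longrightarrow> norm (h (x r)) \<le> b / 2 ^ k" by blast
    \<comment> \<open>\<open>R1\<close> bounds the start, \<open>R2\<close> then bounds
      \<open>x T\<close>, and \<open>\<bar>R3\<bar>\<close> bounds \<open>\<omega> (x T)\<close>;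
      none of them depends on the solution.\<close>
    obtain R1 where R1: "\<And>\<xi>. \<omega> \<xi> \<le> R \<Longrightarrow> norm \<xi> \<le> R1" using \<omega>(3)[of R] unfolding bounded_iff by blast
    obtain R2 where R2: "\<And>x s. regular_solution F 0 s x \<Longrightarrow> 0 \<le> s \<Longrightarrow> s \<le> T \<Longrightarrow> norm (x 0) \<le> R1 \<Longrightarrow> norm (x s) \<le> R2"
      using bounded_reachable_set[OF fc, of T R1] by blast
    have "bounded (\<omega> ` cball 0 R2)"
      by (intro compact_imp_bounded compact_continuous_image continuous_on_subset[OF \<omega>(1)]) auto
    then obtain R3 where "\<forall>p\<in>cball 0 R2. \<bar>\<omega> p\<bar> \<le> R3" unfolding bounded_iff by auto
    then have R3: "\<omega> p \<le> \<bar>R3\<bar>" if "norm p \<le> R2" for p using that by force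
    have "\<forall>\<^sub>F \<tau> in at_top. \<beta> \<bar>R3\<bar> \<tau> < b / 2 ^ Suc k"
      by (rule order_tendstoD(2)[OF \<beta>lim]) (use b in auto)
    then obtain \<tau> where \<tau>: "\<tau> \<ge> 0" "\<beta> \<bar>R3\<bar> \<tau> < b / 2 ^ Suc k"
      unfolding eventually_at_top_linorder by (metis max.cobounded1 max.cobounded2)
    have "norm (h (x r)) \<le> b / 2 ^ Suc k"
      if x: "regular_solution F 0 t x" "\<forall>r\<in>{0..t}. x r \<in> D" "\<omega> (x 0) \<le> R" "T + \<tau> \<le> r" "r \<le> t" for x t r
    proof -
      have "norm (h (x r)) \<le> max (\<beta> (\<omega> (x T)) (r - T)) ((b / 2 ^ k) / 2)"
        by (rule gain[OF x(1) T(1) _ x(5,2)]) (use T(2)[OF x(1-3)] x \<tau> in auto)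
      moreover have "\<beta> (\<omega> (x T)) (r - T) \<le> b / 2 ^ Suc k"
      proof -
        have "regular_solution F 0 T x" by (rule regular_solution_subinterval[OF x(1)]) (use x \<tau> in auto)
        then have "norm (x T) \<le> R2" using R2[of T x] T(1) R1[OF x(3)] by simp
        then have "\<beta> (\<omega> (x T)) (r - T) \<le> \<beta> \<bar>R3\<bar> (r - T)"
          by (intro class_K_le[OF \<beta>K] R3 \<omega>(2)) (use x \<tau> in auto)
        also have "\<dots> \<le> \<beta> \<bar>R3\<bar> \<tau>" by (rule \<beta>anti) (use x \<tau> in auto)
        finally show ?thesis using \<tau>(2) by simp
      qed
      ultimately show ?thesis by simp
    qed
    then show ?case using T(1) \<tau>(1) by (intro exI[of _ "T + \<tau>"]) auto
  qed note claim = this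
  obtain k where k: "b / 2 ^ k < e"
  proof -
    obtain k where "b / e < 2 ^ k" using real_arch_pow[of 2 "b / e"] by auto
    then show thesis using that[of k] e by (simp add: field_simps)
  qed
  obtain T where T: "T \<ge> 0" "\<forall>x t. regular_solution F 0 t x \<and> (\<forall>r\<in>{0..t}. x r \<in> D) \<and> \<omega> (x 0) \<le> R \<longrightarrow>
     (\<forall>r. T \<le> r \<and> r \<le> t \<longrightarrow> norm (h (x r)) \<le> b / 2 ^ k)" using claim by blast
  show "\<exists>T. \<forall>x t. regular_solution F 0 t x \<and> 0 \<le> t \<and> (\<forall>r\<in>{0..t}. x r \<in> D) \<and>
      \<omega> (x 0) \<le> R \<and> T \<le> t \<longrightarrow> norm (h (x t)) < e"
  proof (intro exI[of _ T] allI impI)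
    fix x t assume x: "regular_solution F 0 t x \<and> 0 \<le> t \<and> (\<forall>r\<in>{0..t}. x r \<in> D) \<and> \<omega> (x 0) \<le> R \<and> T \<le> t"
    then have "norm (h (x t)) \<le> b / 2 ^ k" using T(2) by blast
    then show "norm (h (x t)) < e" using k by simp
  qed
qed

text \<open>The decay condition quantifies over every \<open>v \<in> F \<xi>\<close>, so each of
  them has to occur as an initial velocity. The quadratic error vanishes in difference
  quotients.\<close>

lemma solution_with_initial_velocity:
  assumes v: "v \<in> F \<xi>" and W: "open W" "\<xi> \<in> W"
  obtains x C s0 where "0 < s0" "0 \<le> C" "x 0 = \<xi>"
    "\<And>s. 0 \<le> s \<Longrightarrow> s \<le> s0 \<Longrightarrow> regular_solution F 0 s x \<and> x s \<in> W \<and> norm (x s - \<xi> - s *\<^sub>R v) \<le> C * s\<^sup>2"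
proof -
  define R where "R = norm \<xi> + 1"
  have R: "0 \<le> R" by (simp add: R_def)
  obtain L B where G: "lipschitz_inclusion (truncated F R) L B"
    using lipschitz_inclusion_truncated[OF F_lip F_compact F_nonempty R] by blast
  have "v \<in> truncated F R \<xi>" using v by (simp add: truncated_eq R_def)
  then obtain x where x: "x 0 = \<xi>" "\<And>b. regular_solution (truncated F R) 0 b x"
    "\<And>b. 0 \<le> b \<Longrightarrow> (L * B * (b - 0))-lipschitz_on {0..b} (\<lambda>t. x t - t *\<^sub>R v)"
    using lipschitz_inclusion_solution[OF G, of v \<xi> 0] by blast
  obtain d where d: "d > 0" "ball \<xi> d \<subseteq> W" by (rule openE[OF W])
  obtain s1 where s1: "s1 > 0" "\<And>s. s \<in> {0..1} \<Longrightarrow> dist s 0 < s1 \<Longrightarrow> dist (x s) (x 0) < min d 1"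
    using regular_solution_continuous[OF x(2)[of 1]] d(1) unfolding continuous_on_iff
    by (metis atLeastAtMost_iff min_less_iff_conj order_refl zero_le_one zero_less_one)
  define s0 where "s0 = min 1 (s1 / 2)"
  have near: "dist (x s) \<xi> < min d 1" if "0 \<le> s" "s \<le> s0" for s
    using s1(2)[of s] that s1(1) x(1) by (auto simp: s0_def dist_real_def)
  show thesis
  proof (rule that[of s0 "L * B" x])
    show "0 < s0" using s1 by (simp add: s0_def)
    show "0 \<le> L * B" using lipschitz_inclusionD(1,2)[OF G] by simp
    fix s assume s: "0 \<le> s" "s \<le> s0"
    have "regular_solution F 0 s x"
    proof (rule regular_solution_mono[OF x(2)])
      fix t assume "t \<in> {0..s}"
      then have "dist (x t) \<xi> < 1" using near[of t] s by auto
      then have "norm (x t) \<le> R" using norm_triangle_sub[of "x t" \<xi>] by (simp add: R_def dist_norm)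
      then show "truncated F R (x t) \<subseteq> F (x t)" by (simp add: truncated_eq)
    qed
    moreover have "x s \<in> W" using d(2) near[OF s] by (auto simp: dist_commute)
    moreover have "norm (x s - \<xi> - s *\<^sub>R v) \<le> L * B * s\<^sup>2"
      using lipschitz_onD[OF x(3)[OF s(1)], of s 0] s x(1)
      by (simp add: dist_norm power2_eq_square algebra_simps)
    ultimately show "regular_solution F 0 s x \<and> x s \<in> W \<and> norm (x s - \<xi> - s *\<^sub>R v) \<le> L * B * s\<^sup>2" by blast
  qed (rule x(1))
qed

text \<open>Test the subgradient along a solution with initial velocity \<open>v\<close>. Divided by
  \<open>s\<close>, the subgradient inequality and the decay of \<open>V\<close> along the solution
  give the claim as \<open>s\<close> tends to \<open>0\<close>.\<close>

lemma viscosity_decay: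
  assumes W: "open W" "\<xi> \<in> W" and v: "v \<in> F \<xi>" and \<zeta>: "\<zeta> \<in> viscosity_subdiff V \<xi>" and nn: "0 \<le> V \<xi>"
    and dyn: "\<And>x s. regular_solution F 0 s x \<Longrightarrow> 0 \<le> s \<Longrightarrow> (\<And>r. r \<in> {0..s} \<Longrightarrow> x r \<in> W) \<Longrightarrow> x 0 = \<xi> \<Longrightarrow>
      V (x s) \<le> exp (- s) * V \<xi>"
  shows "\<zeta> \<bullet> v \<le> - V \<xi>"
proof -
  obtain r O0 where r: "((\<lambda>k. r k / norm k) \<longlongrightarrow> 0) (at 0)" "open O0" "0 \<in> O0"
    "\<And>k. k \<in> O0 \<Longrightarrow> r k \<le> V (\<xi> + k) - V \<xi> - \<zeta> \<bullet> k"
    using \<zeta> unfolding viscosity_subdiff_def by blast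
  have main: "\<zeta> \<bullet> v \<le> - V \<xi> + e * norm v" if e: "e > 0" for e
  proof -
    obtain d1 where d1: "d1 > 0" "\<forall>k. k \<noteq> 0 \<and> norm (k - 0) < d1 \<longrightarrow> norm (r k / norm k - 0) < e"
      using LIM_D[OF r(1) e] by (elim exE conjE) (rule that)
    obtain d2 where d2: "d2 > 0" "ball 0 d2 \<subseteq> O0" by (rule openE[OF r(2,3)])
    \<comment> \<open>Nothing is known about \<open>r 0\<close>; the case \<open>k = 0\<close> is trivial.\<close>
    have sub: "- e * norm k \<le> V (\<xi> + k) - V \<xi> - \<zeta> \<bullet> k" if k: "norm k < min d1 d2" for k
    proof (cases "k = 0")
      case False
      have "k \<in> O0" using d2(2) k by auto
      moreover have "\<bar>r k / norm k\<bar> < e" using spec[OF d1(2), of k] False k by simp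
      then have "\<bar>r k\<bar> < e * norm k" using False by (simp add: field_simps abs_divide)
      ultimately show ?thesis using r(4)[of k] by linarith
    qed simp
    have W': "open (W \<inter> ball \<xi> (min d1 d2))" "\<xi> \<in> W \<inter> ball \<xi> (min d1 d2)" using W d1(1) d2(1) by auto
    obtain x C s0 where x: "0 < s0" "0 \<le> C" "x 0 = \<xi>"
      "\<And>s. 0 \<le> s \<Longrightarrow> s \<le> s0 \<Longrightarrow> regular_solution F 0 s x \<and> x s \<in> W \<inter> ball \<xi> (min d1 d2) \<and>
        norm (x s - \<xi> - s *\<^sub>R v) \<le> C * s\<^sup>2"
      by (rule solution_with_initial_velocity[OF v W']) (rule that)
    \<comment> \<open>The bound for the difference quotient. Replacing \<open>exp (- s)\<close> by
      the larger \<open>1 / (1 + s)\<close> turns \<open>(exp (- s) - 1) / s\<close> into the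
      explicit \<open>- 1 / (1 + s)\<close>, so the limit at \<open>0\<close> can be read
      off.\<close>
    define f where "f s = norm \<zeta> * C * s - V \<xi> / (1 + s) + e * (norm v + C * s)" for s
    have "\<zeta> \<bullet> v \<le> f s" if s: "0 < s" "s < s0" for s
    proof -
      have xs: "x s \<in> ball \<xi> (min d1 d2)" "norm (x s - \<xi> - s *\<^sub>R v) \<le> C * s\<^sup>2" "regular_solution F 0 s x"
        using x(4)[of s] s by auto
      have "V (x s) \<le> exp (- s) * V \<xi>"
        by (rule dyn[OF xs(3)]) (use x(3,4) s in auto)
      moreover have "exp (- s) * V \<xi> \<le> (1 / (1 + s)) * V \<xi>"
      proof (rule mult_right_mono[OF _ nn])
        have "1 + s \<le> exp s" by (rule exp_ge_add_one_self)
        then show "exp (- s) \<le> 1 / (1 + s)" using s by (simp add: exp_minus field_simps)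
      qed
      moreover have "- e * norm (x s - \<xi>) \<le> V (\<xi> + (x s - \<xi>)) - V \<xi> - \<zeta> \<bullet> (x s - \<xi>)"
        by (rule sub) (use xs(1) in \<open>simp add: dist_norm norm_minus_commute\<close>)
      ultimately have 1: "\<zeta> \<bullet> (x s - \<xi>) \<le> (1 / (1 + s)) * V \<xi> - V \<xi> + e * norm (x s - \<xi>)" by simp
      have "\<zeta> \<bullet> (s *\<^sub>R v) - \<zeta> \<bullet> (x s - \<xi>) = \<zeta> \<bullet> (s *\<^sub>R v - (x s - \<xi>))" by (simp add: inner_diff_right)
      also have "\<dots> \<le> norm \<zeta> * norm (s *\<^sub>R v - (x s - \<xi>))" by (rule norm_cauchy_schwarz)
      also have "\<dots> \<le> norm \<zeta> * (C * s\<^sup>2)"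
        using xs(2) by (intro mult_left_mono) (auto simp: norm_minus_commute)
      finally have 2: "\<zeta> \<bullet> (s *\<^sub>R v) \<le> \<zeta> \<bullet> (x s - \<xi>) + norm \<zeta> * (C * s\<^sup>2)" by simp
      have "norm (x s - \<xi>) \<le> norm (s *\<^sub>R v) + C * s\<^sup>2"
        using xs(2) norm_triangle_sub[of "x s - \<xi>" "s *\<^sub>R v"] by simp
      then have 3: "e * norm (x s - \<xi>) \<le> e * (s * norm v + C * s\<^sup>2)" using e s by simp
      have "(1 / (1 + s)) * V \<xi> - V \<xi> = s * (- V \<xi> / (1 + s))" using s by (simp add: field_simps)
      then have "s * (\<zeta> \<bullet> v) \<le> s * f s"
        using 1 2 3 unfolding f_def by (simp add: algebra_simps power2_eq_square)
      then show ?thesis using s by simp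
    qed
    moreover have "(f \<longlongrightarrow> f 0) (at_right 0)"
      unfolding f_def by (intro tendsto_intros) auto
    ultimately have "\<zeta> \<bullet> v \<le> f 0"
      by (intro tendsto_lowerbound[of f "f 0" "at_right 0"])
        (auto simp: eventually_at_right[of 0 1] intro!: exI[of _ s0] x(1))
    then show ?thesis by (simp add: f_def)
  qed
  show ?thesis
  proof (rule field_le_epsilon)
    fix e :: real assume e: "e > 0"
    have p: "0 < norm v + 1" by (simp add: add_nonneg_pos)
    have "e / (norm v + 1) * norm v \<le> e / (norm v + 1) * (norm v + 1)"
      using e p by (intro mult_left_mono) auto
    moreover have "e / (norm v + 1) * (norm v + 1) = e" using p by simp
    moreover have "0 < e / (norm v + 1)" using e p by simp
    ultimately show "\<zeta> \<bullet> v \<le> - V \<xi> + e" using main[of "e / (norm v + 1)"] by linarith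
  qed
qed

theorem MES_imp_exp_SIT:
  fixes h :: "'a \<Rightarrow> 'b::real_normed_vector" and g :: "'a \<Rightarrow> 'c::real_normed_vector"
  assumes fc: "forward_complete F" and h: "continuous_on UNIV h" and g: "continuous_on UNIV g"
    and \<omega>: "continuous_on UNIV \<omega>" "\<And>\<xi>. 0 \<le> \<omega> \<xi>" "\<And>R. bounded {\<xi>. \<omega> \<xi> \<le> R}"
    and mes: "MES F \<omega> h g"
  shows "\<exists>\<rho> V. class_K \<rho> \<and> lsc_exp_SIT_Lyapunov F \<omega> h g \<rho> V"
proof -
  obtain \<beta> \<gamma> where \<beta>\<gamma>: "class_KL \<beta>" "class_K \<gamma>" and
    mes': "\<forall>T x t. maximal_solution F T x \<and> 0 \<le> t \<and> ereal t < T \<longrightarrow>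
        norm (h (x t)) \<le> max (\<beta> (\<omega> (x 0)) t) (\<gamma> (sup_norm (\<lambda>s. g (x s)) 0 t))"
    using mes unfolding MES_def by (elim exE conjE) (rule that)
  have mes'': "\<forall>x t. maximal_solution F \<infinity> x \<and> 0 \<le> t \<longrightarrow>
      norm (h (x t)) \<le> max (\<beta> (\<omega> (x 0)) t) (\<gamma> (sup_norm (\<lambda>s. g (x s)) 0 t))"
    using spec[OF mes', of "\<infinity>"] by simp
  define \<rho> where "\<rho> s = 2 * \<gamma> s" for s
  have \<rho>: "class_K \<rho>" unfolding \<rho>_def by (rule class_K_cmult[OF \<beta>\<gamma>(2)]) simp
  define D where "D = {\<xi>. 2 * \<gamma> (norm (g \<xi>)) < norm (h \<xi>)}"
  have D_\<rho>: "D = {\<xi>. \<rho> (norm (g \<xi>)) < norm (h \<xi>)}" by (simp add: D_def \<rho>_def)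
  have D: "open D" unfolding D_\<rho> by (rule open_dominance_region[OF h g \<rho>])
  define good where "good x t \<longleftrightarrow> regular_solution F 0 t x \<and> 0 \<le> t \<and> (\<forall>r\<in>{0..t}. x r \<in> D)" for x t
  note attract = bounded_time_attractivity[OF fc h g \<omega> \<beta>\<gamma> mes'', folded D_def]
  define P where "P s t v \<longleftrightarrow> (\<exists>x. good x t \<and> s = \<omega> (x 0) \<and> v = norm (h (x t)))" for s t v
  have \<beta>K: "class_K (\<lambda>s. \<beta> s 0)" using \<beta>\<gamma>(1) unfolding class_KL_def by simp
  \<comment> \<open>\<open>\<beta> s 0\<close> is only known to be of class K in \<open>s\<close>;
    adding \<open>s\<close> makes it unbounded, as \<open>KL_estimate\<close> requires.\<close>
  have "class_K (\<lambda>s. \<beta> s 0 + s)" by (rule class_K_add[OF \<beta>K]) (auto simp: class_K_def strict_mono_on_def)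
  moreover have "r < \<beta> (\<bar>r\<bar> + 1) 0 + (\<bar>r\<bar> + 1)" for r
    using class_K_nonneg[OF \<beta>K, of "\<bar>r\<bar> + 1"] by linarith
  ultimately have \<sigma>: "class_Kinf (\<lambda>s. \<beta> s 0 + s)"
    unfolding class_Kinf_iff by (metis abs_ge_zero add_nonneg_nonneg zero_le_one)
  have P1: "0 \<le> s \<and> 0 \<le> v \<and> v \<le> \<beta> s 0 + s" if "P s t v" for s t v
  proof -
    obtain x where x: "good x t" "s = \<omega> (x 0)" "v = norm (h (x t))" using \<open>P s t v\<close> unfolding P_def by blast
    then have "v \<le> \<beta> s 0" using attract(1)[of t x] unfolding good_def by simp
    then show ?thesis using x \<omega>(2)[of "x 0"] by simp
  qed
  have P2: "\<exists>T. \<forall>s t v. P s t v \<and> s \<le> R \<and> T \<le> t \<longrightarrow> v < e" if "0 < R" "0 < e" for R e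
    using attract(2)[OF that] unfolding P_def good_def by blast
  obtain \<alpha>1 \<alpha>2 where \<alpha>: "class_Kinf \<alpha>1" "class_Kinf \<alpha>2" "\<And>s t v. P s t v \<Longrightarrow> \<alpha>1 v \<le> \<alpha>2 s * exp (- t)"
    using KL_estimate[OF \<sigma>, of P] P1 P2 by blast
  have K: "class_K \<alpha>1" "class_K \<alpha>2" using \<alpha> by (auto simp: class_Kinf_iff)
  \<comment> \<open>Outside \<open>D\<close> no solution is good; the inserted \<open>0\<close>
    keeps \<open>A \<xi>\<close> nonempty, so that \<open>V\<close> is \<open>0\<close>
    there.\<close>
  define A where "A \<xi> = insert 0 {\<alpha>1 (norm (h (x t))) * exp t | x t. good x t \<and> x 0 = \<xi>}" for \<xi>
  define V where "V \<xi> = Sup (A \<xi>)" for \<xi>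
  have A_le: "a \<le> \<alpha>2 (\<omega> \<xi>)" if a: "a \<in> A \<xi>" for a \<xi>
  proof (cases "a = 0")
    case True
    then show ?thesis using class_K_nonneg[OF K(2) \<omega>(2)] by simp
  next
    case False
    then obtain x t where x: "good x t" "x 0 = \<xi>" "a = \<alpha>1 (norm (h (x t))) * exp t" using a unfolding A_def by blast
    then have "\<alpha>1 (norm (h (x t))) \<le> \<alpha>2 (\<omega> \<xi>) * exp (- t)" using \<alpha>(3)[of "\<omega> \<xi>" t] unfolding P_def by blast
    then have "\<alpha>1 (norm (h (x t))) * exp t \<le> \<alpha>2 (\<omega> \<xi>) * exp (- t) * exp t" by (rule mult_right_mono) simp
    then show ?thesis using x(3) by (simp add: mult.assoc flip: exp_add)
  qed
  have bdd: "bdd_above (A \<xi>)" for \<xi> by (rule bdd_aboveI) (rule A_le)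
  have A0: "0 \<in> A \<xi>" for \<xi> by (simp add: A_def)
  have Vnn: "0 \<le> V \<xi>" for \<xi> unfolding V_def by (rule cSup_upper[OF A0 bdd])
  have Vle: "V \<xi> \<le> \<alpha>2 (\<omega> \<xi>)" for \<xi> unfolding V_def by (rule cSup_least) (use A0 A_le in auto)
  have Vge: "\<alpha>1 (norm (h (x t))) * exp t \<le> V (x 0)" if "good x t" for x t
    unfolding V_def by (rule cSup_upper[OF _ bdd]) (use that in \<open>auto simp: A_def\<close>)
  have lower: "\<alpha>1 (norm (h \<xi>)) \<le> V \<xi>" if "\<xi> \<in> D" for \<xi>
    using Vge[of "\<lambda>_. \<xi>" 0] that by (simp add: good_def regular_solution_trivial)
  \<comment> \<open>A good solution from \<open>x s\<close> can be appended to \<open>x\<close>. The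
    result is good and lasts \<open>s\<close> longer, so each element of \<open>A (x s)\<close>,
    multiplied by \<open>exp s\<close>, is bounded by \<open>V (x 0)\<close>.\<close>
  have dyn: "V (x s) \<le> exp (- s) * V (x 0)" if x: "good x s" for x s
    unfolding V_def[of "x s"]
  proof (rule cSup_least)
    fix a assume a: "a \<in> A (x s)"
    show "a \<le> exp (- s) * V (x 0)"
    proof (cases "a = 0")
      case True then show ?thesis using Vnn by simp
    next
      case False
      then obtain y t where y: "good y t" "y 0 = x s" "a = \<alpha>1 (norm (h (y t))) * exp t" using a unfolding A_def by blast
      define z where "z r = (if r \<le> s then x r else y (- s + r))" for r
      have "regular_solution F 0 (s + t) z"
        unfolding z_def
      proof (rule regular_solution_concat)
        have "regular_solution F (0 - (- s)) (t - (- s)) (\<lambda>r. y (- s + r))"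
          by (rule regular_solution_shift) (use y(1) in \<open>simp add: good_def\<close>)
        then show "regular_solution F s (s + t) (\<lambda>r. y (- s + r))" by (simp add: add.commute)
      qed (use x y in \<open>auto simp: good_def\<close>)
      moreover have "z r \<in> D" if "r \<in> {0..s + t}" for r
        using x y(1) that by (auto simp: good_def z_def)
      ultimately have "good z (s + t)" using x y(1) by (simp add: good_def)
      from Vge[OF this] have "\<alpha>1 (norm (h (z (s + t)))) * exp (s + t) \<le> V (z 0)" .
      moreover have "z 0 = x 0" "z (s + t) = y t" using x y(1,2) by (auto simp: z_def good_def)
      ultimately have "a * exp s \<le> V (x 0)" by (simp add: y(3) exp_add mult_ac)
      then have "exp (- s) * (a * exp s) \<le> exp (- s) * V (x 0)" by (intro mult_left_mono) auto
      then show ?thesis by (simp add: exp_minus field_simps)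
    qed
  qed (use A0 in auto)
  \<comment> \<open>A near-optimal good solution has a compact trajectory in the open set
    \<open>D\<close>. Its shadows from nearby starting points are therefore good as well, and they
    end with nearly the same output.\<close>
  have lsc: "lower_semicontinuous V"
    unfolding lower_semicontinuous_def
  proof (intro allI impI)
    fix \<xi> c assume c: "c < V \<xi>"
    show "\<forall>\<^sub>F \<eta> in nhds \<xi>. c < V \<eta>"
    proof (cases "c < 0")
      case True
      then show ?thesis using Vnn by (intro always_eventually allI) (meson less_le_trans)
    next
      case False
      obtain a where a: "a \<in> A \<xi>" "c < a" using c less_cSup_iff[OF _ bdd] A0 unfolding V_def by blast
      then have "a \<noteq> 0" using False by auto
      then obtain x t where x: "good x t" "x 0 = \<xi>" "a = \<alpha>1 (norm (h (x t))) * exp t" using a unfolding A_def by blast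
      have xr: "regular_solution F 0 t x" "0 \<le> t" "\<And>r. r \<in> {0..t} \<Longrightarrow> x r \<in> D" using x(1) by (auto simp: good_def)
      have cA: "compact (x ` {0..t})"
        by (intro compact_continuous_image regular_solution_continuous[OF xr(1)]) simp
      obtain R where R: "\<forall>p\<in>x ` {0..t}. norm p \<le> R" using compact_imp_bounded[OF cA] unfolding bounded_iff by blast
      obtain e0 where e0: "e0 > 0" "(\<Union>p\<in>x ` {0..t}. cball p e0) \<subseteq> D"
        using compact_subset_open_imp_cball_epsilon_subset[OF cA D] xr(3) by (metis image_subsetI)
      have ca: "continuous_on UNIV (\<lambda>p. \<alpha>1 (norm (h p)) * exp t)"
      proof -
        have "continuous_on {0..} \<alpha>1" using K(1) by (simp add: class_K_def)
        then have "continuous_on UNIV (\<lambda>p. \<alpha>1 (norm (h p)))"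
          by (rule continuous_on_compose2[OF _ continuous_on_norm[OF h]]) auto
        then show ?thesis by (intro continuous_on_mult continuous_on_const)
      qed
      have "open {p. c < \<alpha>1 (norm (h p)) * exp t}" by (intro open_Collect_less ca continuous_on_const)
      moreover have "x t \<in> {p. c < \<alpha>1 (norm (h p)) * exp t}" using a(2) x(3) by simp
      ultimately obtain e1 where e1: "e1 > 0" "ball (x t) e1 \<subseteq> {p. c < \<alpha>1 (norm (h p)) * exp t}"
        by (rule openE)
      define e where "e = min e0 (e1 / 2)"
      have e: "0 < e" "e \<le> e0" "e < e1" using e0(1) e1(1) by (auto simp: e_def)
      have "norm (x 0) \<le> R" using R xr(2) by auto
      then have R0: "0 \<le> R" by (rule order_trans[OF norm_ge_zero])
      obtain d where d: "d > 0" and tr: "\<And>q. norm (q - x 0) \<le> d \<Longrightarrow> \<exists>y. shadows 0 t x e y \<and> y 0 = q"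
      proof (rule tracking[OF R0 xr(2) e(1)])
        fix d assume "d > 0" and "\<And>a b z q. regular_solution F a b z \<Longrightarrow> a \<le> b \<Longrightarrow> b - a \<le> t \<Longrightarrow>
          (\<And>t. t \<in> {a..b} \<Longrightarrow> norm (z t) \<le> R) \<Longrightarrow>
          (norm (q - z a) \<le> d \<longrightarrow> (\<exists>y. shadows a b z e y \<and> y a = q)) \<and>
          (norm (q - z b) \<le> d \<longrightarrow> (\<exists>y. shadows a b z e y \<and> y b = q))"
        from this(1) this(2)[OF xr(1,2)] show thesis using that R xr(2) by auto
      qed
      have "c < V \<eta>" if \<eta>: "dist \<eta> \<xi> < d" for \<eta>
      proof -
        obtain y where y: "regular_solution F 0 t y" "y 0 = \<eta>" "\<forall>r\<in>{0..t}. norm (y r - x r) \<le> e"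
          using tr[of \<eta>] \<eta> x(2) by (auto simp: dist_norm shadows_def)
        have "y r \<in> D" if r: "r \<in> {0..t}" for r
        proof -
          have "y r \<in> cball (x r) e0" using bspec[OF y(3) r] e by (simp add: dist_norm norm_minus_commute)
          then show ?thesis using e0(2) r by blast
        qed
        then have "good y t" using y(1) xr(2) by (simp add: good_def)
        then have "\<alpha>1 (norm (h (y t))) * exp t \<le> V \<eta>" using Vge y(2) by blast
        moreover have "norm (y t - x t) \<le> e" using y(3) xr(2) by simp
        then have "y t \<in> ball (x t) e1" using e by (simp add: dist_norm norm_minus_commute)
        then have "c < \<alpha>1 (norm (h (y t))) * exp t" using e1(2) by blast
        ultimately show ?thesis by simp
      qed
      then show ?thesis unfolding eventually_nhds_metric using d by blast
    qed
  qed
  have decay: "SIT_decay F h g \<rho> (\<lambda>r. r) V"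
    unfolding SIT_decay_def
  proof (intro allI impI ballI)
    fix \<xi> \<zeta> v assume \<xi>: "norm (h \<xi>) > \<rho> (norm (g \<xi>))" and "\<zeta> \<in> viscosity_subdiff V \<xi>" "v \<in> F \<xi>"
    then show "\<zeta> \<bullet> v \<le> - V \<xi>"
    proof (intro viscosity_decay[OF D, of \<xi>])
      show "\<xi> \<in> D" using \<xi> by (simp add: D_\<rho>)
      show "V (x s) \<le> exp (- s) * V \<xi>"
        if "regular_solution F 0 s x" "0 \<le> s" "\<And>r. r \<in> {0..s} \<Longrightarrow> x r \<in> D" "x 0 = \<xi>" for x s
        using dyn[of x s] that by (simp add: good_def)
    qed (use Vnn in auto)
  qed
  have "SIT_bounds \<omega> h g \<rho> V"
    unfolding SIT_bounds_def using \<alpha>(1,2) lower Vle D_\<rho> by blast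
  moreover have "continuous_on {0..} (\<lambda>r :: real. r)" "pos_def (\<lambda>r. r)" by (auto simp: pos_def_def)
  ultimately have "lsc_exp_SIT_Lyapunov F \<omega> h g \<rho> V"
    unfolding lsc_exp_SIT_Lyapunov_def lsc_SIT_Lyapunov_def using Vnn lsc decay by blast
  then show ?thesis using \<rho> by blast
qed

end

theorem corollary5p3:
  fixes F :: "real ^ 'n \<Rightarrow> (real ^ 'n) set"
    and h :: "real ^ 'n \<Rightarrow> real ^ 'py"
    and g :: "real ^ 'n \<Rightarrow> real ^ 'pw"
    and \<omega> :: "real ^ 'n \<Rightarrow> real"
  assumes "\<And>\<xi>. F \<xi> \<noteq> {}" and "\<And>\<xi>. compact (F \<xi>)"
    and "set_locally_lipschitz F"
    and "forward_complete F"
    and "locally_lipschitz h" and "locally_lipschitz g"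
    and "\<And>\<xi>. 0 \<le> \<omega> \<xi>" and "continuous_on UNIV \<omega>"
    and "proper_map euclidean (top_of_set {0..}) \<omega>"
  shows "(MES F \<omega> h g \<longrightarrow> (\<exists>\<rho> V. class_K \<rho> \<and> lsc_exp_SIT_Lyapunov F \<omega> h g \<rho> V)) \<and>
    (RMEB F h g \<and> (\<exists>\<rho> V. class_K \<rho> \<and> lsc_SIT_Lyapunov F \<omega> h g \<rho> V) \<longrightarrow> MES F \<omega> h g)"
proof -
  interpret lipschitz_system F using assms(1-3) by unfold_locales
  have h: "continuous_on UNIV h" and g: "continuous_on UNIV g"
    using assms(5,6) by (auto intro: locally_lipschitz_continuous_on)
  have "bounded {\<xi>. \<omega> \<xi> \<le> R}" for R
  proof -
    have "compact (\<omega> -` {0..R})" using assms(9) unfolding proper_map_nonneg_iff[OF assms(8)] by blast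
    moreover have "\<omega> -` {0..R} = {\<xi>. \<omega> \<xi> \<le> R}" using assms(7) by auto
    ultimately show ?thesis by (simp add: compact_imp_bounded)
  qed
  then show ?thesis
    using MES_imp_exp_SIT[OF assms(4) h g assms(8,7)] RMEB_SIT_imp_MES[OF assms(4) h g assms(8,7)] by blast
qed

end
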